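(* Let $L_0>0$ and $\omega_0>1$ be fixed. Choose $\gamma>0$ such that $$\gamma>2(\omega_0-1)L_0 .$$ Let $\phi\in Y_\gamma=\{u\in X:\int_0^{L_0}u^3\,dx=\gamma\}$ be a minimizer of the problem $m=\inf_{u\in Y_\gamma}B(u)$, where $$B(u)=\frac12\int_0^{L_0}\left(\omega_0\,u\mathcal{M}u+(\omega_0-1)u^2\right)dx,$$ normalized so that its Lagrange multiplier equals $\frac12$, i.e. such that $\omega_0\mathcal{M}\phi+(\omega_0-1)\phi-\frac12\phi^2=0$. Assume that (H1) $\phi$ is even and $\ker(\mathcal{L}_0)=[\phi']$, where $\mathcal{L}_0=\omega_0\mathcal{M}+(\omega_0-1)-\phi$. Then $\phi$ is orbitally stable in $X$ by the periodic flow of $u_t+u_x+uu_x+(\mathcal{M}u)_t=0$.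
   Context: Functions are real-valued and $L_0$-periodic; $\widehat g(\kappa)$, $\kappa\in\mathbb{Z}$, are Fourier coefficients, $H^s_{per}([0,L_0])$ is the periodic Sobolev space. $\mathcal{M}$ is the Fourier multiplier $\widehat{\mathcal{M}g}(\kappa)=\theta(\kappa)\widehat g(\kappa)$, where $\theta$ is real, even and continuous on $\mathbb{R}$ and $\upsilon_1|\kappa|^{m_1}\le\theta(\kappa)\le\upsilon_2|\kappa|^{m_1}$ for all $\kappa\in\mathbb{Z}$, for some $\upsilon_1,\upsilon_2>0$ and $m_1>1/3$. Put $X=H_{per}^{m_1/2}([0,L_0])$; $\int u\mathcal{M}u\,dx$ for $u\in X$ is understood as a duality pairing. $\mathcal{L}_0$ is considered on $L^2_{per}([0,L_0])$ with domain $H^{m_1}_{per}([0,L_0])$, and $[\phi']$ denotes the linear span of $\phi'$. Standing assumption on the flow: the $L_0$-periodic Cauchy problem for $u_t+u_x+uu_x+(\mathcal{M}u)_t=0$, $u(\cdot,0)=u_0$, is globally well-posed in $X$ (solutions are continuous in time with values in $X$), and the following quantities are conserved along solutions: $P(u)=\frac12\int_0^{L_0}(u\mathcal{M}u-\frac13u^3)dx$, $F(u)=\frac12\int_0^{L_0}(u\mathcal{M}u+u^2)dx$, $M(u)=\int_0^{L_0}u\,dx$. Orbital stability: let $\rho(u,v)=\inf_{y\in\mathbb{R}}\|u-v(\cdot+y)\|_X$. The wave $\phi$ is orbitally stable in $X$ if for every $\varepsilon>0$ there is $\delta>0$ such that for every $u_0\in X$ with $\|u_0-\phi\|_X<\delta$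 the solution $u(t)$ with initial data $u_0$ exists globally and satisfies $\rho(u(t),\phi)<\varepsilon$ for all $t\ge0$. *)

theory Defs
  imports "HOL-Analysis.Analysis"
begin

text \<open>
  Elements of the periodic function spaces are rendered as genuine periodic Borel functions
  \<^term>\<open>g :: real \<Rightarrow> real\<close>; two functions that agree almost everywhere represent the same element,
  so identities between elements are stated almost everywhere. A periodic distribution is
  represented by the sequence of its Fourier coefficients.
\<close>

definition fcoeff :: "real \<Rightarrow> (real \<Rightarrow> real) \<Rightarrow> int \<Rightarrow> complex" where
  "fcoeff L g \<kappa> = (CLBINT x:{0..L}. complex_of_real (g x) * cis (- (2 * pi * of_int \<kappa> * x / L))) / complex_of_real L"

definition L2per :: "real \<Rightarrow> (real \<Rightarrow> real) set" where
  "L2per L = {g. (\<forall>x. g (x + L) = g x) \<and> g \<in> borel_measurable borel \<and>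
     set_integrable lborel {0..L} (\<lambda>x. (g x)\<^sup>2)}"

text \<open>Only Sobolev exponents \<^term>\<open>s \<ge> (0::real)\<close> occur, so that the Sobolev space consists of functions.\<close>

definition Hper :: "real \<Rightarrow> real \<Rightarrow> (real \<Rightarrow> real) set" where
  "Hper L s = {g \<in> L2per L.
     (\<lambda>\<kappa>::int. (1 + (of_int \<kappa>)\<^sup>2) powr s * (cmod (fcoeff L g \<kappa>))\<^sup>2) summable_on UNIV}"

definition Hnorm :: "real \<Rightarrow> real \<Rightarrow> (real \<Rightarrow> real) \<Rightarrow> real" where
  "Hnorm L s g = sqrt (L * (\<Sum>\<^sub>\<infinity>\<kappa>::int. (1 + (of_int \<kappa>)\<^sup>2) powr s * (cmod (fcoeff L g \<kappa>))\<^sup>2))"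

text \<open>Fourier coefficients of \<open>\<M>g\<close>; for \<open>g\<close> in the energy space this is in general only a distribution.\<close>

definition mult_coeff :: "real \<Rightarrow> (real \<Rightarrow> real) \<Rightarrow> (real \<Rightarrow> real) \<Rightarrow> int \<Rightarrow> complex" where
  "mult_coeff L \<theta> g \<kappa> = complex_of_real (\<theta> (of_int \<kappa>)) * fcoeff L g \<kappa>"

text \<open>Duality pairing of the distribution with Fourier coefficients \<open>c\<close> and the function \<open>g\<close>,
  normalised to extend the integral over one period of the product of two functions.\<close>

definition dual_pairing :: "real \<Rightarrow> (int \<Rightarrow> complex) \<Rightarrow> (real \<Rightarrow> real) \<Rightarrow> real" where
  "dual_pairing L c g = L * Re (\<Sum>\<^sub>\<infinity>\<kappa>. c \<kappa> * cnj (fcoeff L g \<kappa>))"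

definition functional_P :: "real \<Rightarrow> (real \<Rightarrow> real) \<Rightarrow> (real \<Rightarrow> real) \<Rightarrow> real" where
  "functional_P L \<theta> u =
     1/2 * (dual_pairing L (mult_coeff L \<theta> u) u - 1/3 * (LBINT x:{0..L}. (u x)^3))"

definition functional_F :: "real \<Rightarrow> (real \<Rightarrow> real) \<Rightarrow> (real \<Rightarrow> real) \<Rightarrow> real" where
  "functional_F L \<theta> u =
     1/2 * (dual_pairing L (mult_coeff L \<theta> u) u + (LBINT x:{0..L}. (u x)\<^sup>2))"

definition functional_M :: "real \<Rightarrow> (real \<Rightarrow> real) \<Rightarrow> real" where
  "functional_M L u = (LBINT x:{0..L}. u x)"

definition functional_B :: "real \<Rightarrow> (real \<Rightarrow> real) \<Rightarrow> real \<Rightarrow> (real \<Rightarrow> real) \<Rightarrow> real" where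
  "functional_B L \<theta> \<omega> u =
     1/2 * (\<omega> * dual_pairing L (mult_coeff L \<theta> u) u + (\<omega> - 1) * (LBINT x:{0..L}. (u x)\<^sup>2))"

definition Yset :: "real \<Rightarrow> real \<Rightarrow> real \<Rightarrow> (real \<Rightarrow> real) set" where
  "Yset L s \<gamma> = {u \<in> Hper L s. (LBINT x:{0..L}. (u x)^3) = \<gamma>}"

text \<open>The identity \<open>\<omega>\<M>\<phi> + (\<omega> - 1)\<phi> - \<phi>\<^sup>2/2 = 0\<close> between periodic distributions.\<close>

definition wave_equation :: "real \<Rightarrow> (real \<Rightarrow> real) \<Rightarrow> real \<Rightarrow> (real \<Rightarrow> real) \<Rightarrow> bool" where
  "wave_equation L \<theta> \<omega> \<phi> \<longleftrightarrow> (\<forall>\<kappa>.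
     of_real \<omega> * mult_coeff L \<theta> \<phi> \<kappa> + of_real (\<omega> - 1) * fcoeff L \<phi> \<kappa>
       - 1/2 * fcoeff L (\<lambda>x. (\<phi> x)\<^sup>2) \<kappa> = 0)"

text \<open>Fourier coefficients of \<open>\<L>v = \<omega>\<M>v + (\<omega> - 1)v - \<phi>v\<close>, and the kernel of \<open>\<L>\<close> on its domain.\<close>

definition lin_op_coeff ::
  "real \<Rightarrow> (real \<Rightarrow> real) \<Rightarrow> real \<Rightarrow> (real \<Rightarrow> real) \<Rightarrow> (real \<Rightarrow> real) \<Rightarrow> int \<Rightarrow> complex" where
  "lin_op_coeff L \<theta> \<omega> \<phi> v \<kappa> =
     of_real \<omega> * mult_coeff L \<theta> v \<kappa> + of_real (\<omega> - 1) * fcoeff L v \<kappa>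
       - fcoeff L (\<lambda>x. \<phi> x * v x) \<kappa>"

definition lin_op_ker ::
  "real \<Rightarrow> (real \<Rightarrow> real) \<Rightarrow> real \<Rightarrow> real \<Rightarrow> (real \<Rightarrow> real) \<Rightarrow> (real \<Rightarrow> real) set" where
  "lin_op_ker L \<theta> m1 \<omega> \<phi> = {v \<in> Hper L m1. \<forall>\<kappa>. lin_op_coeff L \<theta> \<omega> \<phi> v \<kappa> = 0}"

text \<open>The square-integrable function \<open>\<psi>\<close> is the distributional derivative of \<open>g\<close>;
  it is determined up to null sets.\<close>

definition has_per_deriv :: "real \<Rightarrow> (real \<Rightarrow> real) \<Rightarrow> (real \<Rightarrow> real) \<Rightarrow> bool" where
  "has_per_deriv L g \<psi> \<longleftrightarrow> \<psi> \<in> L2per L \<and>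
     (\<forall>\<kappa>. fcoeff L \<psi> \<kappa> = \<i> * of_real (2 * pi * of_int \<kappa> / L) * fcoeff L g \<kappa>)"

definition per_span :: "real \<Rightarrow> (real \<Rightarrow> real) \<Rightarrow> (real \<Rightarrow> real) set" where
  "per_span L \<psi> = {v \<in> L2per L. \<exists>c. AE x in lborel. v x = c * \<psi> x}"

text \<open>
  \<open>u t\<close> is the state at time \<open>t \<ge> 0\<close>; values at negative times are irrelevant. A solution is
  continuous in time with values in the space of exponent \<open>s\<close> and satisfies
  \<open>(u + \<M>u)\<^sub>t + (u + u\<^sup>2/2)\<^sub>x = 0\<close> in the sense of periodic distributions, that is, for every
  Fourier coefficient. At time 0 the time derivative is one-sided.
\<close>

definition global_solution ::
  "real \<Rightarrow> (real \<Rightarrow> real) \<Rightarrow> real \<Rightarrow> (real \<Rightarrow> real) \<Rightarrow> (real \<Rightarrow> real \<Rightarrow> real) \<Rightarrow> bool" where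
  "global_solution L \<theta> s u0 u \<longleftrightarrow>
     (\<forall>t\<ge>0. u t \<in> Hper L s) \<and>
     (\<forall>t\<ge>0. ((\<lambda>r. Hnorm L s (\<lambda>x. u r x - u t x)) \<longlongrightarrow> 0) (at t within {0..})) \<and>
     (\<forall>t\<ge>0. \<forall>\<kappa>.
        ((\<lambda>r. fcoeff L (u r) \<kappa> + mult_coeff L \<theta> (u r) \<kappa>) has_vector_derivative
          - (\<i> * of_real (2 * pi * of_int \<kappa> / L) *
              (fcoeff L (u t) \<kappa> + 1/2 * fcoeff L (\<lambda>x. (u t x)\<^sup>2) \<kappa>)))
        (at t within {0..})) \<and>
     (AE x in lborel. u 0 x = u0 x)"

text \<open>Existence, uniqueness, and continuous dependence on the data, uniformly on bounded time intervals.\<close>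

definition globally_well_posed :: "real \<Rightarrow> (real \<Rightarrow> real) \<Rightarrow> real \<Rightarrow> bool" where
  "globally_well_posed L \<theta> s \<longleftrightarrow>
     (\<forall>u0\<in>Hper L s. \<exists>u. global_solution L \<theta> s u0 u) \<and>
     (\<forall>u0\<in>Hper L s. \<forall>u v. global_solution L \<theta> s u0 u \<longrightarrow> global_solution L \<theta> s u0 v \<longrightarrow>
        (\<forall>t\<ge>0. AE x in lborel. u t x = v t x)) \<and>
     (\<forall>u0\<in>Hper L s. \<forall>u. global_solution L \<theta> s u0 u \<longrightarrow>
        (\<forall>T\<ge>0. \<forall>\<epsilon>>0. \<exists>\<delta>>0. \<forall>v0\<in>Hper L s. \<forall>v. global_solution L \<theta> s v0 v \<longrightarrow>
           Hnorm L s (\<lambda>x. v0 x - u0 x) < \<delta> \<longrightarrow>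
           (\<forall>t\<in>{0..T}. Hnorm L s (\<lambda>x. v t x - u t x) < \<epsilon>)))"

definition conserved ::
  "real \<Rightarrow> (real \<Rightarrow> real) \<Rightarrow> real \<Rightarrow> ((real \<Rightarrow> real) \<Rightarrow> real) \<Rightarrow> bool" where
  "conserved L \<theta> s Q \<longleftrightarrow>
     (\<forall>u0\<in>Hper L s. \<forall>u. global_solution L \<theta> s u0 u \<longrightarrow> (\<forall>t\<ge>0. Q (u t) = Q u0))"

definition orbit_dist :: "real \<Rightarrow> real \<Rightarrow> (real \<Rightarrow> real) \<Rightarrow> (real \<Rightarrow> real) \<Rightarrow> real" where
  "orbit_dist L s u v = (INF y. Hnorm L s (\<lambda>x. u x - v (x + y)))"

definition orbitally_stable ::
  "real \<Rightarrow> (real \<Rightarrow> real) \<Rightarrow> real \<Rightarrow> (real \<Rightarrow> real) \<Rightarrow> bool" where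
  "orbitally_stable L \<theta> s \<phi> \<longleftrightarrow>
     (\<forall>\<epsilon>>0. \<exists>\<delta>>0. \<forall>u0\<in>Hper L s. Hnorm L s (\<lambda>x. u0 x - \<phi> x) < \<delta> \<longrightarrow>
        (\<exists>u. global_solution L \<theta> s u0 u) \<and>
        (\<forall>u. global_solution L \<theta> s u0 u \<longrightarrow> (\<forall>t\<ge>0. orbit_dist L s (u t) \<phi> < \<epsilon>)))"

end

theory Submission
  imports Defs
begin

text \<open>
  The wave is a critical point of the action \<open>\<Lambda> = P + (\<omega> - 1) F\<close>, and the second variation of \<open>\<Lambda>\<close>
  there is the quadratic form \<open>\<L>\<close> of the linearised operator (\<open>lin_form\<close> below). Minimality on the
  hypersurface \<open>\<integral>u\<^sup>3 = \<gamma>\<close> makes \<open>\<L>\<close> nonnegative on \<open>{h. \<integral>\<phi>\<^sup>2h = 0}\<close>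
  (\<open>lin_form_nonneg_on_tangent_space\<close>), so \<open>\<L>\<close> has at most one negative direction. Such a direction is
  \<open>\<Psi> = 1 + \<phi>\<close>: the wave equation gives
  \<open>\<L>(\<Psi>,\<Psi>) = (\<omega> - 1)L - \<gamma>/2 - \<integral>\<phi> - \<integral>\<phi>\<^sup>2\<close> with \<open>\<integral>\<phi> \<ge> 0\<close>, which is negative because
  \<open>\<gamma> > 2(\<omega> - 1)L\<close> (\<open>lin_form_Psi_Psi_neg\<close>).

  What makes \<open>\<Psi>\<close> useful is that \<open>\<L>(\<Psi>,h) = \<integral>((\<omega> - 1) - \<phi> - \<phi>\<^sup>2/2)h\<close> is the derivative at \<open>\<phi>\<close> of
  another conserved quantity, \<open>R = (\<omega> - 1)M - \<omega>F\<close>. With \<open>N = -\<L>(\<Psi>,\<Psi>) > 0\<close> the conserved functional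
  \<open>V = \<Lambda> - \<Lambda>(\<phi>) + (R - R(\<phi>))\<^sup>2/N\<close> has second variation
  \<open>Q(h) = \<L>(h,h) + (2/N) \<L>(\<Psi>,h)\<^sup>2\<close>. The penalty term more than compensates the negative direction, so
  \<open>Q\<close> is nonnegative and vanishes only on the kernel of the linearised operator, that is, on multiples
  of \<open>\<phi>'\<close>. Compactness of \<open>X\<close> in \<open>L\<^sup>2\<close> turns this into a bound \<open>Q(h) \<ge> \<kappa>\<parallel>h\<parallel>\<^sup>2\<close> for all \<open>h\<close> that are
  orthogonal to \<open>\<phi>'\<close> in \<open>X\<close> (\<open>coercivity\<close>).

  The difference between \<open>u\<close> and its nearest translate of \<open>\<phi>\<close> is orthogonal to the derivative of that
  translate (\<open>nearest_translate\<close>). As \<open>V\<close> is invariant under translations, \<open>V(u)\<close> bounds the squared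
  distance from \<open>u\<close> to the orbit as long as this distance is small, the cubic remainder being absorbed
  (\<open>lyapunov_lower_orbit\<close>). Conservation of \<open>V\<close> and continuity in time then confine the solution
  (\<open>orbital_stability\<close>).

  The analysis takes place on Fourier coefficients, in weighted \<open>l\<^sup>2\<close> spaces of sequences. Functions are needed
  for the cubic integral and the potential \<open>\<phi>\<close>. For exponents above \<open>1/6\<close> the dyadic pieces of a Fourier series
  decay geometrically in \<open>L\<^sup>3\<close>; one majorant of all partial sums (\<open>dyadic_series_dominated\<close>) gives the
  embedding into \<open>L\<^sup>3\<close>, the existence of a function with prescribed coefficients, and Parseval's identity.
\<close>

section \<open>Weighted square-summable sequences\<close>

definition ell2w :: "(int \<Rightarrow> real) \<Rightarrow> (int \<Rightarrow> complex) set" where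
  "ell2w \<beta> = {a. (\<lambda>k. \<beta> k * (cmod (a k))\<^sup>2) summable_on UNIV}"

definition wip :: "(int \<Rightarrow> real) \<Rightarrow> (int \<Rightarrow> complex) \<Rightarrow> (int \<Rightarrow> complex) \<Rightarrow> real" where
  "wip \<beta> a b = (\<Sum>\<^sub>\<infinity>k. \<beta> k * Re (a k * cnj (b k)))"

abbreviation l2ip where "l2ip \<equiv> wip (\<lambda>_. 1)"

text \<open>The discriminant argument behind Cauchy--Schwarz. In the degenerate case \<open>B = 0\<close> it forces \<open>C = 0\<close>,
  because an affine function that is bounded below is constant.\<close>

lemma nonneg_quadratic_imp_discriminant:
  fixes A B C :: real
  assumes "\<And>t. A + 2 * t * C + t\<^sup>2 * B \<ge> 0"
  shows "C\<^sup>2 \<le> A * B"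
proof (cases "B = 0")
  case True
  have "C = 0"
  proof (rule ccontr)
    assume "C \<noteq> 0"
    then show False using assms[of "-(A+1)/(2*C)"] True by (simp add: field_simps)
  qed
  then show ?thesis using True by simp
next
  case False
  have "B > 0"
  proof (rule ccontr)
    assume "\<not> B > 0"
    then have B: "B < 0" using False by simp
    define t where "t = (1 + \<bar>A\<bar> + 2 * \<bar>C\<bar>) / (-B) + 1"
    have t1: "t \<ge> 1" using B by (simp add: t_def field_simps)
    have tB: "t * (-B) = 1 + \<bar>A\<bar> + 2 * \<bar>C\<bar> + (-B)" using B by (simp add: t_def field_simps)
    have "t * (1 + \<bar>A\<bar> + 2 * \<bar>C\<bar>) \<le> t * (t * (-B))" using tB B t1 by (intro mult_left_mono) auto
    moreover have "t * \<bar>A\<bar> \<ge> \<bar>A\<bar>" using t1 mult_right_mono[of 1 t "\<bar>A\<bar>"] by simp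
    moreover have "t * C \<le> t * \<bar>C\<bar>" using t1 by (intro mult_left_mono) auto
    moreover have "t * (1 + \<bar>A\<bar> + 2 * \<bar>C\<bar>) = t + t * \<bar>A\<bar> + 2 * (t * \<bar>C\<bar>)" by (simp add: algebra_simps)
    moreover have "A + 2 * (t * C) - t * (t * (-B)) \<ge> 0"
      using assms[of t] by (simp add: power2_eq_square mult.assoc)
    ultimately show False using t1 by linarith
  qed
  then show ?thesis using assms[of "-C/B"] by (simp add: field_simps power2_eq_square)
qed

lemma ell2wD: "a \<in> ell2w \<beta> \<Longrightarrow> (\<lambda>k. \<beta> k * (cmod (a k))\<^sup>2) summable_on UNIV"
  by (simp add: ell2w_def)

lemma ell2w_abs_product:
  assumes "\<And>k. \<beta> k \<ge> 0" "a \<in> ell2w \<beta>" "b \<in> ell2w \<beta>"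
  shows "(\<lambda>k. \<beta> k * (cmod (a k) * cmod (b k))) summable_on UNIV"
proof (rule summable_on_comparison_test)
  show "(\<lambda>k. \<beta> k * (cmod (a k))\<^sup>2 + \<beta> k * (cmod (b k))\<^sup>2) summable_on UNIV"
    using assms by (intro summable_on_add) (auto simp: ell2w_def)
  fix k :: int
  have "cmod (a k) * cmod (b k) \<le> (cmod (a k))\<^sup>2 + (cmod (b k))\<^sup>2"
    using sum_squares_bound[of "cmod (a k)" "cmod (b k)"]
    mult_nonneg_nonneg[OF norm_ge_zero[of "a k"] norm_ge_zero[of "b k"]] by linarith
  then show "\<beta> k * (cmod (a k) * cmod (b k)) \<le> \<beta> k * (cmod (a k))\<^sup>2 + \<beta> k * (cmod (b k))\<^sup>2"
    using assms(1)[of k] by (metis mult_left_mono distrib_left)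
qed (use assms in auto)

lemma ell2w_complex_product:
  assumes "\<And>k. \<beta> k \<ge> 0" "a \<in> ell2w \<beta>" "b \<in> ell2w \<beta>"
  shows "(\<lambda>k. of_real (\<beta> k) * (a k * cnj (b k))) summable_on UNIV"
  by (rule abs_summable_summable, rule summable_on_cong[THEN iffD1, OF _ ell2w_abs_product[OF assms]])
     (use assms(1) in \<open>auto simp: norm_mult\<close>)

lemma wip_summable:
  assumes "\<And>k. \<beta> k \<ge> 0" "a \<in> ell2w \<beta>" "b \<in> ell2w \<beta>"
  shows "(\<lambda>k. \<beta> k * Re (a k * cnj (b k))) summable_on UNIV"
  using summable_on_Re[OF ell2w_complex_product[OF assms]] by simp

lemma wip_eq_Re_infsum:
  assumes "\<And>k. \<beta> k \<ge> 0" "a \<in> ell2w \<beta>" "b \<in> ell2w \<beta>"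
  shows "wip \<beta> a b = Re (\<Sum>\<^sub>\<infinity>k. of_real (\<beta> k) * (a k * cnj (b k)))"
  unfolding wip_def using infsum_Re[OF ell2w_complex_product[OF assms]] by simp

lemma wip_self: "wip \<beta> a a = (\<Sum>\<^sub>\<infinity>k. \<beta> k * (cmod (a k))\<^sup>2)"
  unfolding wip_def by (intro infsum_cong) (metis Re_complex_of_real complex_norm_square)

lemma wip_self_nonneg: "(\<And>k. \<beta> k \<ge> 0) \<Longrightarrow> wip \<beta> a a \<ge> 0"
  unfolding wip_self by (intro infsum_nonneg) auto

lemma wip_commute: "wip \<beta> a b = wip \<beta> b a"
  unfolding wip_def by (intro infsum_cong) (simp add: mult.commute)

lemma ell2w_comb:
  assumes "\<And>k. \<beta> k \<ge> 0" "a \<in> ell2w \<beta>" "b \<in> ell2w \<beta>"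
  shows "(\<lambda>k. a k + c * b k) \<in> ell2w \<beta>"
  unfolding ell2w_def mem_Collect_eq
proof (rule summable_on_comparison_test)
  show "(\<lambda>k. 2 * (\<beta> k * (cmod (a k))\<^sup>2) + (2 * (cmod c)\<^sup>2) * (\<beta> k * (cmod (b k))\<^sup>2)) summable_on UNIV"
    using assms by (intro summable_on_add summable_on_cmult_right) (auto simp: ell2w_def)
  fix k :: int
  have "(cmod (a k + c * b k))\<^sup>2 \<le> (cmod (a k) + cmod c * cmod (b k))\<^sup>2"
    by (intro power_mono) (metis norm_mult norm_triangle_ineq, simp)
  also have "\<dots> \<le> 2 * (cmod (a k))\<^sup>2 + 2 * (cmod c * cmod (b k))\<^sup>2"
    using sum_squares_bound[of "cmod (a k)" "cmod c * cmod (b k)"] by (simp add: power2_sum)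
  finally have "\<beta> k * (cmod (a k + c * b k))\<^sup>2 \<le> \<beta> k * (2 * (cmod (a k))\<^sup>2 + 2 * (cmod c * cmod (b k))\<^sup>2)"
    using assms(1)[of k] by (intro mult_left_mono) auto
  then show "\<beta> k * (cmod (a k + c * b k))\<^sup>2 \<le> 2 * (\<beta> k * (cmod (a k))\<^sup>2) + (2 * (cmod c)\<^sup>2) * (\<beta> k * (cmod (b k))\<^sup>2)"
    by (simp add: algebra_simps power_mult_distrib)
qed (use assms in auto)

lemma wip_comb_left:
  assumes "\<And>k. \<beta> k \<ge> 0" "a \<in> ell2w \<beta>" "b \<in> ell2w \<beta>" "c \<in> ell2w \<beta>"
  shows "wip \<beta> (\<lambda>k. a k + of_real t * b k) c = wip \<beta> a c + t * wip \<beta> b c"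
proof -
  have "wip \<beta> (\<lambda>k. a k + of_real t * b k) c =
     (\<Sum>\<^sub>\<infinity>k. \<beta> k * Re (a k * cnj (c k)) + t * (\<beta> k * Re (b k * cnj (c k))))"
    unfolding wip_def by (intro infsum_cong) (simp add: algebra_simps)
  also have "\<dots> = wip \<beta> a c + t * wip \<beta> b c"
    unfolding wip_def
    by (subst infsum_add[OF wip_summable[OF assms(1,2,4)] summable_on_cmult_right[OF wip_summable[OF assms(1,3,4)]]])
       (simp add: infsum_cmult_right')
  finally show ?thesis .
qed

lemma wip_comb_right:
  assumes "\<And>k. \<beta> k \<ge> 0" "a \<in> ell2w \<beta>" "b \<in> ell2w \<beta>" "c \<in> ell2w \<beta>"
  shows "wip \<beta> c (\<lambda>k. a k + of_real t * b k) = wip \<beta> c a + t * wip \<beta> c b"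
  using wip_comb_left[OF assms] by (simp add: wip_commute[of \<beta> c])

lemma wip_comb_self:
  assumes "\<And>k. \<beta> k \<ge> 0" "a \<in> ell2w \<beta>" "b \<in> ell2w \<beta>"
  shows "wip \<beta> (\<lambda>k. a k + of_real t * b k) (\<lambda>k. a k + of_real t * b k)
     = wip \<beta> a a + 2 * t * wip \<beta> a b + t\<^sup>2 * wip \<beta> b b"
  using assms ell2w_comb[OF assms, of "of_real t"]
  by (simp add: wip_comb_left wip_comb_right wip_commute[of \<beta> b a] power2_eq_square algebra_simps)

lemma wip_Cauchy_Schwarz:
  assumes "\<And>k. \<beta> k \<ge> 0" "a \<in> ell2w \<beta>" "b \<in> ell2w \<beta>"
  shows "\<bar>wip \<beta> a b\<bar> \<le> sqrt (wip \<beta> a a) * sqrt (wip \<beta> b b)"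
proof -
  have "(wip \<beta> a b)\<^sup>2 \<le> wip \<beta> a a * wip \<beta> b b"
  proof (rule nonneg_quadratic_imp_discriminant)
    fix t :: real
    show "wip \<beta> a a + 2 * t * wip \<beta> a b + t\<^sup>2 * wip \<beta> b b \<ge> 0"
      unfolding wip_comb_self[OF assms, symmetric] by (rule wip_self_nonneg[OF assms(1)])
  qed
  then have "sqrt ((wip \<beta> a b)\<^sup>2) \<le> sqrt (wip \<beta> a a * wip \<beta> b b)" by (rule real_sqrt_le_mono)
  then show ?thesis by (simp add: real_sqrt_mult)
qed

lemma wip_triangle:
  assumes "\<And>k. \<beta> k \<ge> 0" "a \<in> ell2w \<beta>" "b \<in> ell2w \<beta>"
  shows "sqrt (wip \<beta> (\<lambda>k. a k + b k) (\<lambda>k. a k + b k)) \<le> sqrt (wip \<beta> a a) + sqrt (wip \<beta> b b)"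
proof (rule real_le_lsqrt)
  have "wip \<beta> (\<lambda>k. a k + b k) (\<lambda>k. a k + b k) = wip \<beta> a a + 2 * wip \<beta> a b + wip \<beta> b b"
    using wip_comb_self[OF assms, of 1] by simp
  also have "\<dots> \<le> wip \<beta> a a + 2 * (sqrt (wip \<beta> a a) * sqrt (wip \<beta> b b)) + wip \<beta> b b"
    using wip_Cauchy_Schwarz[OF assms] by auto
  also have "\<dots> = (sqrt (wip \<beta> a a) + sqrt (wip \<beta> b b))\<^sup>2"
    using assms by (simp add: power2_sum wip_self_nonneg)
  finally show "wip \<beta> (\<lambda>k. a k + b k) (\<lambda>k. a k + b k) \<le> (sqrt (wip \<beta> a a) + sqrt (wip \<beta> b b))\<^sup>2" .
qed (use assms in \<open>auto simp: wip_self_nonneg\<close>)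

lemma ell2w_mono:
  assumes "a \<in> ell2w \<beta>" "\<And>k. 0 \<le> \<beta>' k" "\<And>k. \<beta>' k \<le> C * \<beta> k"
  shows "a \<in> ell2w \<beta>'"
  unfolding ell2w_def mem_Collect_eq
proof (rule summable_on_comparison_test)
  show "(\<lambda>k. C * (\<beta> k * (cmod (a k))\<^sup>2)) summable_on UNIV"
    using assms by (intro summable_on_cmult_right) (auto simp: ell2w_def)
  show "\<beta>' k * (cmod (a k))\<^sup>2 \<le> C * (\<beta> k * (cmod (a k))\<^sup>2)" for k
    using mult_right_mono[OF assms(3)[of k], of "(cmod (a k))\<^sup>2"] by (simp add: mult.assoc)
qed (use assms in auto)

lemma wip_self_mono:
  assumes "a \<in> ell2w \<beta>" "\<And>k. 0 \<le> \<beta>' k" "\<And>k. \<beta>' k \<le> C * \<beta> k"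
  shows "wip \<beta>' a a \<le> C * wip \<beta> a a"
proof -
  have "wip \<beta>' a a \<le> (\<Sum>\<^sub>\<infinity>k. C * (\<beta> k * (cmod (a k))\<^sup>2))"
    unfolding wip_self
  proof (rule infsum_mono)
    show "\<beta>' k * (cmod (a k))\<^sup>2 \<le> C * (\<beta> k * (cmod (a k))\<^sup>2)" for k
      using mult_right_mono[OF assms(3)[of k], of "(cmod (a k))\<^sup>2"] by (simp add: mult.assoc)
  qed (use ell2w_mono[OF assms] assms in \<open>auto simp: ell2w_def intro: summable_on_cmult_right\<close>)
  then show ?thesis by (simp add: wip_self infsum_cmult_right')
qed

lemma finite_sum_le_wip:
  assumes "\<And>k. \<beta> k \<ge> 0" "a \<in> ell2w \<beta>" "finite F"
  shows "(\<Sum>k\<in>F. \<beta> k * (cmod (a k))\<^sup>2) \<le> wip \<beta> a a"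
  unfolding wip_self using assms by (intro finite_sum_le_infsum) (auto simp: ell2w_def)

lemma wip_le_if_finite_sums_le:
  assumes "\<And>k. \<beta> k \<ge> 0" "\<And>F. finite F \<Longrightarrow> (\<Sum>k\<in>F. \<beta> k * (cmod (a k))\<^sup>2) \<le> C"
  shows "a \<in> ell2w \<beta>" "wip \<beta> a a \<le> C"
proof -
  show 1: "a \<in> ell2w \<beta>"
    unfolding ell2w_def mem_Collect_eq
    by (rule nonneg_bdd_above_summable_on) (use assms in \<open>auto intro!: bdd_aboveI2\<close>)
  show "wip \<beta> a a \<le> C" unfolding wip_self
    using 1 assms by (intro infsum_le_finite_sums) (auto simp: ell2w_def)
qed

lemma ell2w_finite_support: "finite {k. a k \<noteq> 0} \<Longrightarrow> a \<in> ell2w \<beta>"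
  unfolding ell2w_def mem_Collect_eq
  by (rule finite_nonzero_values_imp_summable_on) (auto elim: rev_finite_subset)

lemma wip_self_eq_0D:
  assumes "\<And>k. \<beta> k > 0" "a \<in> ell2w \<beta>" "wip \<beta> a a \<le> 0"
  shows "a k = 0"
proof -
  have "\<beta> k * (cmod (a k))\<^sup>2 \<le> wip \<beta> a a"
    using finite_sum_le_wip[of \<beta> a "{k}"] assms by (auto simp: less_imp_le)
  then have "\<beta> k * (cmod (a k))\<^sup>2 \<le> 0" using assms(3) by simp
  then show ?thesis using assms(1)[of k] by (simp add: mult_le_0_iff)
qed

lemma wip_scale_weight:
  "wip \<beta> a b = l2ip a (\<lambda>k. of_real (\<beta> k) * b k)"
  unfolding wip_def by (intro infsum_cong) (simp add: algebra_simps)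

text \<open>Rellich compactness in sequence form: where the weight tends to infinity, boundedness
  controls the tails, so that coefficientwise convergence becomes convergence in the unweighted norm.\<close>

lemma bounded_pointwise_imp_l2_convergent:
  fixes a :: "nat \<Rightarrow> int \<Rightarrow> complex"
  assumes w: "\<And>k. w k \<ge> 1" "\<And>B. finite {k. w k \<le> B}"
    and a: "\<And>n. a n \<in> ell2w w" "\<And>n. wip w (a n) (a n) \<le> S"
    and lim: "\<And>k. (\<lambda>n. a n k) \<longlonglongrightarrow> c k"
  shows "c \<in> ell2w w" "wip w c c \<le> S"
    "(\<lambda>n. l2ip (\<lambda>k. a n k - c k) (\<lambda>k. a n k - c k)) \<longlonglongrightarrow> 0"
proof -
  have w0: "w k \<ge> 0" for k using w(1)[of k] by simp
  have fin: "(\<Sum>k\<in>F. w k * (cmod (c k))\<^sup>2) \<le> S" if "finite F" for F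
  proof (rule LIMSEQ_le_const2)
    show "(\<lambda>n. \<Sum>k\<in>F. w k * (cmod (a n k))\<^sup>2) \<longlonglongrightarrow> (\<Sum>k\<in>F. w k * (cmod (c k))\<^sup>2)"
      by (intro tendsto_intros lim)
    show "\<exists>N. \<forall>n\<ge>N. (\<Sum>k\<in>F. w k * (cmod (a n k))\<^sup>2) \<le> S"
      using finite_sum_le_wip[OF w0 a(1) that] a(2) order_trans by blast
  qed
  show c: "c \<in> ell2w w" "wip w c c \<le> S" using wip_le_if_finite_sums_le[OF w0 fin] by auto
  have S0: "S \<ge> 0" using c(2) wip_self_nonneg[of w c, OF w0] by linarith
  let ?d = "\<lambda>n k. a n k - c k"
  have d: "?d n \<in> ell2w w" for n using ell2w_comb[OF w0 a(1) c(1), of n "-1"] by simp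
  have d2: "wip w (?d n) (?d n) \<le> 4 * S" for n
  proof -
    have "wip w (?d n) (?d n) = wip w (a n) (a n) - 2 * wip w (a n) c + wip w c c"
      using wip_comb_self[OF w0 a(1) c(1), of n "-1"] by simp
    moreover have "\<bar>wip w (a n) c\<bar> \<le> sqrt S * sqrt S"
      by (rule order_trans[OF wip_Cauchy_Schwarz[OF w0 a(1) c(1)]])
         (use a(2)[of n] c(2) wip_self_nonneg[of w] w0 S0 in \<open>intro mult_mono; simp\<close>)
    ultimately show ?thesis using a(2)[of n] c(2) S0 by auto
  qed
  show "(\<lambda>n. l2ip (?d n) (?d n)) \<longlonglongrightarrow> 0"
  proof (rule LIMSEQ_I)
    fix e :: real assume e: "e > 0"
    define B where "B = 8 * S / e + 1"
    have B: "B > 0" using S0 e by (simp add: B_def add_nonneg_pos)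
    define F where "F = {k. w k \<le> B}"
    have F: "finite F" unfolding F_def by (rule w(2))
    have "(\<lambda>n. \<Sum>k\<in>F. (cmod (?d n k))\<^sup>2) \<longlonglongrightarrow> (\<Sum>k\<in>F. (cmod (c k - c k))\<^sup>2)"
      by (intro tendsto_intros lim)
    then have "(\<lambda>n. \<Sum>k\<in>F. (cmod (?d n k))\<^sup>2) \<longlonglongrightarrow> 0" by simp
    from LIMSEQ_D[OF this, of "e/2"] e obtain N where N: "\<And>n. n \<ge> N \<Longrightarrow> (\<Sum>k\<in>F. (cmod (?d n k))\<^sup>2) < e/2"
      by (auto simp: sum_nonneg)
    show "\<exists>N. \<forall>n\<ge>N. norm (l2ip (?d n) (?d n) - 0) < e"
    proof (intro exI allI impI)
      fix n assume n: "n \<ge> N"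
      have "l2ip (?d n) (?d n) \<le> (\<Sum>k\<in>F. (cmod (?d n k))\<^sup>2) + 4 * S / B"
      proof (rule wip_le_if_finite_sums_le)
        fix G :: "int set" assume G: "finite G"
        have "(\<Sum>k\<in>G. (cmod (?d n k))\<^sup>2) \<le> (\<Sum>k\<in>F. (cmod (?d n k))\<^sup>2) + (\<Sum>k\<in>G-F. (cmod (?d n k))\<^sup>2)"
          using F G by (subst sum.union_disjoint[symmetric]) (auto intro!: sum_mono2)
        also have "(\<Sum>k\<in>G-F. (cmod (?d n k))\<^sup>2) \<le> (\<Sum>k\<in>G-F. w k * (cmod (?d n k))\<^sup>2 / B)"
        proof (rule sum_mono)
          fix k assume "k \<in> G - F"
          then have "B \<le> w k" by (auto simp: F_def)
          then show "(cmod (?d n k))\<^sup>2 \<le> w k * (cmod (?d n k))\<^sup>2 / B"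
            using B by (simp add: field_simps mult_right_mono)
        qed
        also have "\<dots> = (\<Sum>k\<in>G-F. w k * (cmod (?d n k))\<^sup>2) / B" by (simp add: sum_divide_distrib)
        also have "\<dots> \<le> 4 * S / B"
          using finite_sum_le_wip[OF w0 d, of "G - F" n] d2[of n] G B
          by (intro divide_right_mono) auto
        finally show "(\<Sum>k\<in>G. 1 * (cmod (?d n k))\<^sup>2) \<le> (\<Sum>k\<in>F. (cmod (?d n k))\<^sup>2) + 4 * S / B" by simp
      qed simp
      also have "\<dots> < e"
      proof -
        have "4 * S / B \<le> e / 2" using B e S0 by (simp add: B_def field_simps)
        then show ?thesis using N[OF n] by simp
      qed
      finally show "norm (l2ip (?d n) (?d n) - 0) < e"
        using wip_self_nonneg[of "\<lambda>_. 1" "?d n"] by simp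
    qed
  qed
qed

text \<open>A diagonal subsequence, in the form of sequential compactness of a countable product of discs.\<close>

lemma bounded_coefficients_convergent_subseq:
  fixes a :: "nat \<Rightarrow> int \<Rightarrow> complex"
  assumes "\<And>n k. cmod (a n k) \<le> R"
  shows "\<exists>r c. strict_mono (r :: nat \<Rightarrow> nat) \<and> (\<forall>k. (\<lambda>n. a (r n) k) \<longlonglongrightarrow> c k)"
proof -
  have "compactin (product_topology (\<lambda>k::int. euclidean) UNIV) (PiE UNIV (\<lambda>k::int. cball (0::complex) R))"
    by (subst compactin_PiE) auto
  then have "compact (PiE UNIV (\<lambda>k::int. cball (0::complex) R))"
    unfolding euclidean_product_topology compactin_euclidean_iff .
  then have "seq_compact (PiE UNIV (\<lambda>k::int. cball (0::complex) R))"
    by (simp add: compact_imp_seq_compact)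
  moreover have "\<forall>n. a n \<in> PiE UNIV (\<lambda>k::int. cball (0::complex) R)" using assms by auto
  ultimately obtain c r where r: "strict_mono (r :: nat \<Rightarrow> nat)" and lim: "(a \<circ> r) \<longlonglongrightarrow> c"
    unfolding seq_compact_def by blast
  have "(\<lambda>n. a (r n) k) \<longlonglongrightarrow> c k" for k
    using continuous_on_tendsto_compose[OF continuous_on_product_coordinates lim, of k] by (simp add: o_def)
  then show ?thesis using r by blast
qed

section \<open>Integration over a period\<close>

definition cell :: "real \<Rightarrow> real measure" where
  "cell L = restrict_space lborel {0..L}"

lemma space_cell [simp]: "space (cell L) = {0..L}"
  by (simp add: cell_def space_restrict_space)

lemma finite_measure_cell: "finite_measure (cell L)"
  by (rule finite_measureI, cases "L \<ge> 0") (simp_all add: cell_def emeasure_restrict_space space_restrict_space)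

lemma sets_cell [measurable_cong]: "sets (cell L) = sets (restrict_space borel {0..L})"
  unfolding cell_def by (rule sets_restrict_space_cong) simp

lemma borel_measurable_cell: "f \<in> borel_measurable borel \<Longrightarrow> f \<in> borel_measurable (cell L)"
  unfolding cell_def by (intro measurable_restrict_space1) simp

lemma set_integral_cell:
  fixes f :: "real \<Rightarrow> 'b::{banach, second_countable_topology}"
  shows "set_lebesgue_integral lborel {0..L} f = integral\<^sup>L (cell L) f"
  unfolding cell_def set_lebesgue_integral_def by (subst integral_restrict_space) auto

lemma set_integrable_cell:
  fixes f :: "real \<Rightarrow> 'b::{banach, second_countable_topology}"
  shows "set_integrable lborel {0..L} f \<longleftrightarrow> integrable (cell L) f"
  unfolding cell_def set_integrable_def by (subst integrable_restrict_space) auto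

lemma AE_cell: "(AE x in cell L. P x) \<longleftrightarrow> (AE x in lborel. x \<in> {0..L} \<longrightarrow> P x)"
  unfolding cell_def by (subst AE_restrict_space_iff) auto

lemma sets_cell_borel: "A \<in> sets (cell L) \<Longrightarrow> A \<in> sets borel"
  unfolding cell_def by (subst (asm) sets_restrict_space_iff) auto

lemma AE_cell_interior: "AE x in cell L. x \<noteq> 0 \<and> x \<noteq> L"
  unfolding AE_cell by (rule AE_I[where N="{0,L}"]) (auto intro!: emeasure_lborel_countable)

lemma measure_cell: "L > 0 \<Longrightarrow> measure (cell L) (space (cell L)) = L"
  by (simp add: cell_def measure_restrict_space space_restrict_space)

lemma integral_const_cell: "L > 0 \<Longrightarrow> (LINT x|cell L. (c::complex)) = c * of_real L"
  using measure_cell[of L] by (simp add: scaleR_conv_of_real)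

lemma integrable_bounded_cell:
  fixes f :: "real \<Rightarrow> 'b::{banach, second_countable_topology}"
  assumes "f \<in> borel_measurable borel" "\<And>x. norm (f x) \<le> B"
  shows "integrable (cell L) f"
  by (rule finite_measure.integrable_const_bound[OF finite_measure_cell, of f B])
     (auto intro: assms(2) borel_measurable_cell[OF assms(1)])

lemma set_integral_translate:
  fixes f :: "real \<Rightarrow> 'b::{banach, second_countable_topology}"
  shows "(LBINT x:{a..b}. f (x + y)) = (LBINT x:{a+y..b+y}. f x)"
    "set_integrable lborel {a..b} (\<lambda>x. f (x + y)) \<longleftrightarrow> set_integrable lborel {a+y..b+y} f"
proof -
  have *: "(\<lambda>x. indicat_real {a..b} x *\<^sub>R f (x + y)) = (\<lambda>x. indicat_real {a+y..b+y} (y + 1 * x) *\<^sub>R f (y + 1 * x))"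
    by (auto simp: indicator_def fun_eq_iff add.commute)
  show "(LBINT x:{a..b}. f (x + y)) = (LBINT x:{a+y..b+y}. f x)"
    unfolding set_lebesgue_integral_def * by (subst lborel_integral_real_affine[where c=1 and t=y]) auto
  show "set_integrable lborel {a..b} (\<lambda>x. f (x + y)) \<longleftrightarrow> set_integrable lborel {a+y..b+y} f"
    unfolding set_integrable_def * by (subst lborel_integrable_real_affine_iff) auto
qed

lemma periodic_of_int:
  assumes "\<And>x::real. f (x + L) = f x"
  shows "f (x + of_int n * L) = f x"
proof -
  have nat: "f (x + of_nat m * L) = f x" for m x
  proof (induction m)
    case (Suc m)
    have "x + of_nat (Suc m) * L = (x + of_nat m * L) + L" by (simp add: algebra_simps)
    then show ?case using assms[of "x + of_nat m * L"] Suc by metis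
  qed simp
  show ?thesis
  proof (cases "n \<ge> 0")
    case True then show ?thesis using nat[of x "nat n"] by simp
  next
    case False then show ?thesis using nat[of "x + of_int n * L" "nat (-n)"] by (simp add: algebra_simps)
  qed
qed

text \<open>Modulo the period \<open>y\<close> lies in \<open>[0,L]\<close>; the part of \<open>[y,L+y]\<close> beyond \<open>L\<close> is moved back by one period.\<close>

lemma integral_cell_shift:
  fixes f :: "real \<Rightarrow> 'b::{banach, second_countable_topology}"
  assumes L: "L > 0" and per: "\<And>x. f (x + L) = f x" and int: "integrable (cell L) f"
  shows "integrable (cell L) (\<lambda>x. f (x + y))" "integral\<^sup>L (cell L) (\<lambda>x. f (x + y)) = integral\<^sup>L (cell L) f"
proof -
  define z where "z = y - L * of_int \<lfloor>y / L\<rfloor>"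
  have "of_int \<lfloor>y / L\<rfloor> \<le> y / L" "y / L \<le> of_int \<lfloor>y / L\<rfloor> + 1" by linarith+
  then have "of_int \<lfloor>y / L\<rfloor> * L \<le> y" "y \<le> (of_int \<lfloor>y / L\<rfloor> + 1) * L"
    using L by (simp_all only: pos_le_divide_eq pos_divide_le_eq)
  then have z: "0 \<le> z" "z \<le> L" by (simp_all add: z_def algebra_simps)
  have fz: "f (x + y) = f (x + z)" for x
    using periodic_of_int[of f L "x + z" "\<lfloor>y / L\<rfloor>", OF per] by (simp add: z_def algebra_simps)
  have I: "set_integrable lborel {0..L} f" using int by (simp add: set_integrable_cell)
  have I1: "set_integrable lborel {0..z} f" and I2: "set_integrable lborel {z..L} f"
    by (rule set_integrable_subset[OF I]; use z in auto)+
  have I3: "set_integrable lborel {L..L+z} f"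
    using I1 set_integrable_cell set_integral_translate(2)[of 0 z f L] by (simp add: per add.commute)
  have V3: "(LBINT x:{L..L+z}. f x) = (LBINT x:{0..z}. f x)"
    using set_integral_translate(1)[of 0 z f L] by (simp add: per add.commute)
  have AE: "AE x in lborel. \<not> (x \<in> {a..b} \<and> x \<in> {b..c})" for a b c :: real
    by (rule AE_I[where N="{b}"]) auto
  have "set_integrable lborel ({z..L} \<union> {L..L+z}) f" using I2 I3 by (rule set_integrable_Un) auto
  moreover have U: "{z..L} \<union> {L..L+z} = {z..L+z}" "{0..z} \<union> {z..L} = {0..L}" using z by auto
  ultimately have J: "set_integrable lborel {z..L+z} f" by simp
  show "integrable (cell L) (\<lambda>x. f (x + y))"
    using set_integral_translate(2)[of 0 L f z] J unfolding fz by (simp add: set_integrable_cell)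
  have "(LBINT x:{z..L+z}. f x) = (LBINT x:{z..L}. f x) + (LBINT x:{L..L+z}. f x)"
    unfolding U(1)[symmetric] by (intro set_integral_Un_AE AE I2 I3) auto
  also have "\<dots> = (LBINT x:{0..z}. f x) + (LBINT x:{z..L}. f x)" unfolding V3 by simp
  also have "\<dots> = (LBINT x:{0..L}. f x)"
    unfolding U(2)[symmetric] by (intro set_integral_Un_AE[symmetric] AE I1 I2) auto
  finally show "integral\<^sup>L (cell L) (\<lambda>x. f (x + y)) = integral\<^sup>L (cell L) f"
    using set_integral_translate(1)[of 0 L f z] unfolding fz by (simp add: set_integral_cell)
qed

section \<open>Fourier coefficients\<close>

definition wave :: "real \<Rightarrow> int \<Rightarrow> real \<Rightarrow> complex" where
  "wave L k x = cis (2 * pi * of_int k * x / L)"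

lemma wave_measurable [measurable]: "wave L k \<in> borel_measurable borel"
  unfolding wave_def cis_conv_exp divide_inverse
  by (intro borel_measurable_continuous_onI continuous_intros)

lemma wave_measurable_cell [measurable]: "wave L k \<in> borel_measurable (cell L')"
  by (rule borel_measurable_cell) simp

lemma norm_wave [simp]: "cmod (wave L k x) = 1" by (simp add: wave_def)

lemma wave_0 [simp]: "wave L 0 x = 1" by (simp add: wave_def)

lemma wave_mult: "wave L k x * wave L j x = wave L (k + j) x"
  by (simp add: wave_def cis_mult add_divide_distrib algebra_simps)

lemma wave_shift: "wave L k (x + y) = wave L k y * wave L k x"
  by (simp add: wave_def cis_mult add_divide_distrib algebra_simps)

lemma cnj_wave: "cnj (wave L k x) = wave L (-k) x"
  by (simp add: wave_def cis_cnj)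

lemma wave_periodic: "L > 0 \<Longrightarrow> wave L k (x + L) = wave L k x"
  unfolding wave_shift by (simp add: wave_def cis_multiple_2pi)

text \<open>Translating by half a wavelength changes the sign of a nonconstant wave and preserves its integral.\<close>

lemma wave_integral:
  assumes L: "L > 0"
  shows "(LINT x|cell L. wave L k x) = (if k = 0 then of_real L else 0)"
proof (cases "k = 0")
  case True then show ?thesis using integral_const_cell[OF L, of 1] by simp
next
  case False
  have i: "integrable (cell L) (wave L k)" by (rule integrable_bounded_cell[of _ 1]) auto
  have "(LINT x|cell L. wave L k (x + L / (2 * of_int k))) = (LINT x|cell L. wave L k x)"
    using L i by (intro integral_cell_shift) (auto simp: wave_periodic)
  moreover have "wave L k (L / (2 * of_int k)) = -1"
    using False L by (simp add: wave_def field_simps)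
  then have "(LINT x|cell L. wave L k (x + L / (2 * of_int k))) = - (LINT x|cell L. wave L k x)"
    by (simp add: wave_shift)
  ultimately show ?thesis using False by simp
qed

lemma fcoeff_wave: "fcoeff L g k = (LINT x|cell L. of_real (g x) * wave L (-k) x) / of_real L"
  by (simp add: fcoeff_def set_integral_cell wave_def)

lemma integrable_wave_mult:
  assumes "integrable (cell L) g"
  shows "integrable (cell L) (\<lambda>x. complex_of_real (g x) * wave L k x)"
proof -
  note [measurable] = borel_measurable_integrable[OF assms]
  show ?thesis
  by (rule Bochner_Integration.integrable_bound[OF integrable_of_real[OF assms, where 'a=complex]])
     (auto simp: norm_mult)
qed

lemma fcoeff_add:
  assumes "integrable (cell L) f" "integrable (cell L) g"
  shows "fcoeff L (\<lambda>x. f x + t * g x) k = fcoeff L f k + of_real t * fcoeff L g k"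
proof -
  have "(LINT x|cell L. of_real (f x + t * g x) * wave L (-k) x)
    = (LINT x|cell L. of_real (f x) * wave L (-k) x + of_real t * (of_real (g x) * wave L (-k) x))"
    by (simp add: algebra_simps)
  also have "\<dots> = (LINT x|cell L. of_real (f x) * wave L (-k) x) + of_real t * (LINT x|cell L. of_real (g x) * wave L (-k) x)"
    using assms by (subst Bochner_Integration.integral_add) (auto intro!: integrable_wave_mult)
  finally show ?thesis by (simp add: fcoeff_wave add_divide_distrib)
qed

lemma fcoeff_cong_AE:
  assumes "f \<in> borel_measurable borel" "g \<in> borel_measurable borel" "AE x in cell L. f x = g x"
  shows "fcoeff L f k = fcoeff L g k"
  unfolding fcoeff_wave by (subst integral_cong_AE[of _ _ "\<lambda>x. of_real (g x) * wave L (-k) x"])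
    (use assms in \<open>auto intro!: borel_measurable_times borel_measurable_of_real borel_measurable_cell\<close>)

lemma fcoeff_uminus_index: "fcoeff L g (-k) = cnj (fcoeff L g k)"
proof -
  have "cnj (LINT x|cell L. of_real (g x) * wave L (-k) x) = (LINT x|cell L. cnj (of_real (g x) * wave L (-k) x))"
    by (rule Bochner_Integration.integral_cnj[symmetric])
  then show ?thesis by (simp add: fcoeff_wave cnj_wave)
qed

lemma fcoeff_shift:
  assumes L: "L > 0" and per: "\<And>x. g (x + L) = g x" and int: "integrable (cell L) g"
  shows "fcoeff L (\<lambda>x. g (x + y)) k = wave L k y * fcoeff L g k"
proof -
  have "(LINT x|cell L. of_real (g (x + y)) * wave L (-k) (x + y)) = (LINT x|cell L. of_real (g x) * wave L (-k) x)"
    by (rule integral_cell_shift[OF L _ integrable_wave_mult[OF int]]) (simp add: per wave_periodic L)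
  moreover have "(\<lambda>x. of_real (g (x + y)) * wave L (-k) (x + y)) = (\<lambda>x. wave L (-k) y * (of_real (g (x + y)) * wave L (-k) x))"
    by (simp only: wave_shift mult.left_commute)
  ultimately have "wave L (-k) y * (LINT x|cell L. of_real (g (x + y)) * wave L (-k) x) = (LINT x|cell L. of_real (g x) * wave L (-k) x)"
    by (simp only: integral_mult_right_zero)
  then have "wave L k y * (LINT x|cell L. of_real (g x) * wave L (-k) x)
    = (wave L k y * wave L (-k) y) * (LINT x|cell L. of_real (g (x + y)) * wave L (-k) x)"
    by (simp add: mult.assoc)
  then show ?thesis by (simp add: fcoeff_wave wave_mult)
qed

lemma fcoeff_const: "L > 0 \<Longrightarrow> fcoeff L (\<lambda>x. c) k = (if k = 0 then of_real c else 0)"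
  by (simp add: fcoeff_wave wave_integral)

lemma fcoeff_0_index: "fcoeff L g 0 = of_real (LINT x|cell L. g x) / of_real L"
  by (simp add: fcoeff_wave)

lemma integral_trig_poly_sq:
  assumes L: "L > 0" and F: "finite F"
  shows "(LINT x|cell L. (cmod (\<Sum>k\<in>F. c k * wave L k x))\<^sup>2) = L * (\<Sum>k\<in>F. (cmod (c k))\<^sup>2)"
proof -
  have "complex_of_real (LINT x|cell L. (cmod (\<Sum>k\<in>F. c k * wave L k x))\<^sup>2)
     = (LINT x|cell L. complex_of_real ((cmod (\<Sum>k\<in>F. c k * wave L k x))\<^sup>2))"
    by (simp only: integral_complex_of_real)
  also have "\<dots> = (LINT x|cell L. (\<Sum>k\<in>F. \<Sum>j\<in>F. c k * cnj (c j) * wave L (k - j) x))"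
  proof (rule Bochner_Integration.integral_cong[OF refl])
    fix x
    have "(c k * wave L k x) * (cnj (c j) * wave L (-j) x) = c k * cnj (c j) * wave L (k - j) x" for k j
      using wave_mult[of L k x "-j"] by (simp add: mult_ac)
    then show "complex_of_real ((cmod (\<Sum>k\<in>F. c k * wave L k x))\<^sup>2) = (\<Sum>k\<in>F. \<Sum>j\<in>F. c k * cnj (c j) * wave L (k - j) x)"
      by (simp only: complex_norm_square cnj_sum complex_cnj_mult cnj_wave sum_product)
  qed
  also have "\<dots> = (\<Sum>k\<in>F. \<Sum>j\<in>F. c k * cnj (c j) * (if k - j = 0 then of_real L else 0))"
  proof -
    have i: "integrable (cell L) (wave L k)" for k by (rule integrable_bounded_cell[of _ 1]) auto
    show ?thesis
      by (subst Bochner_Integration.integral_sum, (intro Bochner_Integration.integrable_sum integrable_mult_right i),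
          intro sum.cong refl, subst Bochner_Integration.integral_sum, (intro integrable_mult_right i),
          simp only: integral_mult_right_zero wave_integral[OF L])
  qed
  also have "\<dots> = (\<Sum>k\<in>F. c k * cnj (c k) * of_real L)"
    using F by (intro sum.cong refl) (simp add: if_distrib[of "\<lambda>x. _ * x"] sum.delta cong: if_cong)
  also have "\<dots> = of_real (L * (\<Sum>k\<in>F. (cmod (c k))\<^sup>2))"
    by (simp add: sum_distrib_left complex_norm_square[symmetric] mult.commute flip: of_real_mult of_real_power)
  finally show ?thesis using of_real_eq_iff by blast
qed

text \<open>The claim is \<open>\<integral>\<bar>f - T\<bar>\<^sup>2 \<ge> 0\<close> for the partial sum \<open>T\<close> of the Fourier series over \<open>F\<close>.\<close>

lemma Bessel:
  assumes L: "L > 0" and f: "f \<in> borel_measurable borel" "integrable (cell L) (\<lambda>x. (f x)\<^sup>2)"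
    and F: "finite F"
  shows "L * (\<Sum>k\<in>F. (cmod (fcoeff L f k))\<^sup>2) \<le> (LINT x|cell L. (f x)\<^sup>2)"
proof -
  let ?c = "fcoeff L f" let ?T = "\<lambda>x. \<Sum>k\<in>F. ?c k * wave L k x"
  have fi: "integrable (cell L) f"
    by (rule finite_measure.square_integrable_imp_integrable[OF finite_measure_cell borel_measurable_cell[OF f(1)] f(2)])
  have Tb: "cmod (?T x) \<le> (\<Sum>k\<in>F. cmod (?c k))" for x
    by (rule order_trans[OF norm_sum]) (simp add: norm_mult)
  have Tm [measurable]: "?T \<in> borel_measurable borel" by measurable
  have iT: "integrable (cell L) (\<lambda>x. (cmod (?T x))\<^sup>2)"
    by (rule integrable_bounded_cell[of _ "(\<Sum>k\<in>F. cmod (?c k))\<^sup>2"]) (use Tb in \<open>auto intro!: power_mono\<close>)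
  have ifT: "integrable (cell L) (\<lambda>x. of_real (f x) * cnj (?T x))"
    unfolding cnj_sum complex_cnj_mult cnj_wave sum_distrib_left
    by (intro Bochner_Integration.integrable_sum)
       (simp add: mult.left_commute[of "of_real _"] integrable_wave_mult[OF fi])
  have "(LINT x|cell L. of_real (f x) * cnj (?T x)) = (LINT x|cell L. (\<Sum>k\<in>F. cnj (?c k) * (of_real (f x) * wave L (-k) x)))"
    by (simp add: cnj_wave sum_distrib_left mult_ac)
  also have "\<dots> = (\<Sum>k\<in>F. cnj (?c k) * (of_real L * ?c k))"
    by (subst Bochner_Integration.integral_sum)
       (use integrable_wave_mult[OF fi] L in \<open>auto simp: fcoeff_wave\<close>)
  also have "\<dots> = of_real (L * (\<Sum>k\<in>F. (cmod (?c k))\<^sup>2))"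
    unfolding sum_distrib_left of_real_sum
  proof (intro sum.cong refl)
    fix k
    have "?c k * cnj (?c k) = of_real ((cmod (?c k))\<^sup>2)" using complex_norm_square[of "?c k"] by simp
    then show "cnj (?c k) * (of_real L * ?c k) = of_real (L * (cmod (?c k))\<^sup>2)"
      by (simp add: mult_ac)
  qed
  finally have fT: "(LINT x|cell L. of_real (f x) * cnj (?T x)) = of_real (L * (\<Sum>k\<in>F. (cmod (?c k))\<^sup>2))" .
  have fT': "(LINT x|cell L. Re (of_real (f x) * cnj (?T x))) = L * (\<Sum>k\<in>F. (cmod (?c k))\<^sup>2)"
    using integral_Re[OF ifT] fT by simp
  have "0 \<le> (LINT x|cell L. (cmod (of_real (f x) - ?T x))\<^sup>2)" by simp
  also have "\<dots> = (LINT x|cell L. ((f x)\<^sup>2 + (cmod (?T x))\<^sup>2) - 2 * Re (of_real (f x) * cnj (?T x)))"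
  proof (rule Bochner_Integration.integral_cong[OF refl])
    fix x
    have "(cmod (of_real r - z))\<^sup>2 = (r\<^sup>2 + (cmod z)\<^sup>2) - 2 * Re (of_real r * cnj z)" for r :: real and z
      unfolding cmod_power2 by (simp add: power2_eq_square algebra_simps)
    then show "(cmod (of_real (f x) - ?T x))\<^sup>2 = ((f x)\<^sup>2 + (cmod (?T x))\<^sup>2) - 2 * Re (of_real (f x) * cnj (?T x))" .
  qed
  also have "\<dots> = (LINT x|cell L. (f x)\<^sup>2) + (LINT x|cell L. (cmod (?T x))\<^sup>2) - 2 * (LINT x|cell L. Re (of_real (f x) * cnj (?T x)))"
    by (simp only: Bochner_Integration.integral_diff[OF Bochner_Integration.integrable_add[OF f(2) iT]
          integrable_mult_right[OF integrable_Re[OF ifT]]]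
        Bochner_Integration.integral_add[OF f(2) iT] integral_mult_right_zero)
  finally show ?thesis unfolding fT' integral_trig_poly_sq[OF L F] by simp
qed

subsection \<open>Uniqueness\<close>

text \<open>All Fourier coefficients of the product \<open>g h\<close> vanish, with the integrability that a junk value
  of the integral would hide.\<close>

definition annihilated :: "real \<Rightarrow> (real \<Rightarrow> real) \<Rightarrow> (real \<Rightarrow> complex) \<Rightarrow> bool" where
  "annihilated L g h \<longleftrightarrow> (\<forall>k. integrable (cell L) (\<lambda>x. of_real (g x) * h x * wave L k x) \<and>
     (LINT x|cell L. of_real (g x) * h x * wave L k x) = 0)"

lemma annihilated_lincomb:
  assumes "annihilated L g h" "annihilated L g h'"
  shows "annihilated L g (\<lambda>x. a * h x + b * h' x)"
proof -
  have *: "(\<lambda>x. of_real (g x) * (a * h x + b * h' x) * wave L k x)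
     = (\<lambda>x. a * (of_real (g x) * h x * wave L k x) + b * (of_real (g x) * h' x * wave L k x))" for k
    by (auto simp: algebra_simps)
  show ?thesis
    unfolding annihilated_def *
    using assms by (auto simp: annihilated_def)
qed

lemma annihilated_wave:
  assumes "annihilated L g h"
  shows "annihilated L g (\<lambda>x. wave L j x * h x)"
proof -
  have *: "(\<lambda>x. of_real (g x) * (wave L j x * h x) * wave L k x)
     = (\<lambda>x. of_real (g x) * h x * wave L (j + k) x)" for k
    by (auto simp: wave_mult[symmetric] mult_ac)
  show ?thesis unfolding annihilated_def * using assms by (auto simp: annihilated_def)
qed

text \<open>The statement quantifies over all annihilated multipliers \<open>h\<close> so that it is stable under
  products of polynomials.\<close>

lemma annihilated_polynomial:
  fixes p :: "complex \<Rightarrow> real"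
  assumes "real_polynomial_function p" "annihilated L g h"
  shows "annihilated L g (\<lambda>x. of_real (p (wave L 1 x)) * h x)"
  using assms
proof (induction arbitrary: h rule: real_polynomial_function.induct)
  case (linear p)
  interpret p: bounded_linear p by fact
  have lin: "of_real (p z) = (of_real (p 1) - \<i> * of_real (p \<i>)) / 2 * z + (of_real (p 1) + \<i> * of_real (p \<i>)) / 2 * cnj z" for z
  proof -
    have "p z = p (Re z *\<^sub>R 1 + Im z *\<^sub>R \<i>)"
      by (rule arg_cong[where f=p]) (simp add: complex_eq_iff)
    also have "\<dots> = Re z * p 1 + Im z * p \<i>" by (simp only: p.add p.scaleR real_scaleR_def)
    finally show ?thesis by (simp add: complex_eq_iff field_simps)
  qed
  have "(\<lambda>x. of_real (p (wave L 1 x)) * h x) = (\<lambda>x. (of_real (p 1) - \<i> * of_real (p \<i>)) / 2 * (wave L 1 x * h x)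
      + (of_real (p 1) + \<i> * of_real (p \<i>)) / 2 * (wave L (-1) x * h x))"
    by (intro ext) (subst lin, simp only: cnj_wave distrib_right mult.assoc)
  then show ?case
    by (simp only:) (intro annihilated_lincomb annihilated_wave linear)
next
  case (const c)
  then show ?case using annihilated_lincomb[OF const const, of "of_real c" 0] by simp
next
  case (add p q)
  show ?case using annihilated_lincomb[OF add.IH(1)[OF add.prems] add.IH(2)[OF add.prems], of 1 1]
    by (simp add: algebra_simps)
next
  case (mult p q)
  show ?case using mult.IH(1)[OF mult.IH(2)[OF mult.prems]] by (simp add: mult.assoc)
qed

lemma annihilates_continuous_on_circle:
  assumes L: "L > 0" and g: "integrable (cell L) g" "\<And>k. fcoeff L g k = 0"
    and f: "continuous_on (sphere 0 1) f"
    and m: "(\<lambda>x. f (wave L 1 x)) \<in> borel_measurable borel"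
  shows "(LINT x|cell L. g x * f (wave L 1 x)) = (0::real)"
proof -
  have ann: "annihilated L g (\<lambda>x. 1)"
    unfolding annihilated_def
  proof (intro allI conjI)
    fix k
    show "integrable (cell L) (\<lambda>x. of_real (g x) * 1 * wave L k x)" using integrable_wave_mult[OF g(1)] by simp
    show "(LINT x|cell L. of_real (g x) * 1 * wave L k x) = 0"
      using g(2)[of "-k"] L by (simp add: fcoeff_wave)
  qed
  note [measurable] = borel_measurable_integrable[OF g(1)] borel_measurable_cell[OF m]
  have bd: "bounded (f ` sphere 0 1)" by (intro compact_imp_bounded compact_continuous_image f) simp
  then obtain B where B: "\<And>z. z \<in> sphere 0 1 \<Longrightarrow> \<bar>f z\<bar> \<le> B"
    unfolding bounded_iff by fastforce
  have igf: "integrable (cell L) (\<lambda>x. g x * f (wave L 1 x))"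
  proof (rule Bochner_Integration.integrable_bound[OF integrable_mult_right[OF integrable_abs[OF g(1)], of B]])
    show "AE x in cell L. norm (g x * f (wave L 1 x)) \<le> norm (B * \<bar>g x\<bar>)"
    proof (rule AE_I2)
      fix x
      have "\<bar>f (wave L 1 x)\<bar> \<le> \<bar>B\<bar>" using B[of "wave L 1 x"] by simp
      then show "norm (g x * f (wave L 1 x)) \<le> norm (B * \<bar>g x\<bar>)"
        by (simp add: abs_mult mult.commute[of "\<bar>B\<bar>"] mult_left_mono)
    qed
  qed simp
  have "\<bar>LINT x|cell L. g x * f (wave L 1 x)\<bar> \<le> e * (LINT x|cell L. \<bar>g x\<bar>)" if e: "e > 0" for e
  proof -
    obtain p where p: "real_polynomial_function p" "\<And>z. z \<in> sphere 0 1 \<Longrightarrow> \<bar>f z - p z\<bar> < e"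
      using Stone_Weierstrass_real_polynomial_function[OF compact_sphere f e] by blast
    have "annihilated L g (\<lambda>x. of_real (p (wave L 1 x)) * 1)" by (rule annihilated_polynomial[OF p(1) ann])
    then have "integrable (cell L) (\<lambda>x. complex_of_real (g x * p (wave L 1 x)))"
      "(LINT x|cell L. complex_of_real (g x * p (wave L 1 x))) = 0"
      unfolding annihilated_def by (auto dest: spec[of _ 0])
    then have igp: "integrable (cell L) (\<lambda>x. g x * p (wave L 1 x))" and "(LINT x|cell L. g x * p (wave L 1 x)) = 0"
      by (simp_all only: complex_of_real_integrable_eq integral_complex_of_real of_real_eq_0_iff)
    then have "(LINT x|cell L. g x * f (wave L 1 x)) = (LINT x|cell L. g x * f (wave L 1 x) - g x * p (wave L 1 x))"
      using igf igp by simp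
    also have "\<bar>\<dots>\<bar> \<le> (LINT x|cell L. \<bar>g x * f (wave L 1 x) - g x * p (wave L 1 x)\<bar>)"
      by (rule integral_abs_bound)
    also have "\<dots> \<le> (LINT x|cell L. e * \<bar>g x\<bar>)"
    proof (rule integral_mono)
      fix x
      have "\<bar>g x * f (wave L 1 x) - g x * p (wave L 1 x)\<bar> = \<bar>g x\<bar> * \<bar>f (wave L 1 x) - p (wave L 1 x)\<bar>"
        by (simp add: abs_mult[symmetric] algebra_simps)
      also have "\<dots> \<le> \<bar>g x\<bar> * e" using p(2)[of "wave L 1 x"] by (intro mult_left_mono) auto
      finally show "\<bar>g x * f (wave L 1 x) - g x * p (wave L 1 x)\<bar> \<le> e * \<bar>g x\<bar>" by (simp add: mult.commute)
    qed (use igf igp g in auto)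
    finally show ?thesis by simp
  qed
  note small = this
  show ?thesis
  proof (rule ccontr)
    assume ne: "(LINT x|cell L. g x * f (wave L 1 x)) \<noteq> 0"
    define I where "I = (LINT x|cell L. \<bar>g x\<bar>)"
    have I: "I \<ge> 0" by (simp add: I_def)
    define a where "a = \<bar>LINT x|cell L. g x * f (wave L 1 x)\<bar>"
    have a: "a > 0" using ne by (simp add: a_def)
    have "a \<le> a / (2 * (I + 1)) * I" using small[of "a / (2 * (I + 1))"] a I
      unfolding a_def[symmetric] I_def[symmetric] by simp
    then have "a * (2 * (I + 1)) \<le> a * I" using I by (simp add: field_simps)
    then show False using a I by (simp add: mult_le_cancel_left)
  qed
qed

text \<open>On the circle only the two endpoints of the period are identified.\<close>

lemma wave_inj:
  assumes L: "L > 0" and x: "0 < x" "x < L" "0 \<le> y" "y \<le> L" and eq: "wave L 1 x = wave L 1 y"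
  shows "x = y"
proof -
  have "cis (2 * pi * x / L) = cis (2 * pi * y / L)" using eq by (simp add: wave_def)
  then have "sin (2 * pi * y / L) = sin (2 * pi * x / L) \<and> cos (2 * pi * y / L) = cos (2 * pi * x / L)"
    by (simp add: complex_eq_iff)
  then obtain n :: int where n: "2 * pi * y / L = 2 * pi * x / L + 2 * pi * n" using sin_cos_eq_iff by blast
  then have "pi * (2 * y) = pi * (2 * x + 2 * n * L)" using L by (simp add: field_simps)
  then have y: "y = x + n * L" by simp
  have "-1 * L < n * L" "n * L < 1 * L" using y x by linarith+
  then have "-1 < real_of_int n" "real_of_int n < 1" using L mult_less_cancel_right_pos[OF L] by blast+
  then have "n = 0" by linarith
  then show ?thesis using y by simp
qed

text \<open>A function with vanishing Fourier coefficients annihilates trigonometric polynomials, hence by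
  Stone--Weierstrass on the circle all continuous functions, hence intervals (as limits of
  tent functions), hence all Borel sets.\<close>

lemma fcoeff_eq_0_imp_AE_0:
  assumes L: "L > 0" and g: "integrable (cell L) g" "\<And>k. fcoeff L g k = 0"
  shows "AE x in cell L. g x = 0"
proof -
  note [measurable] = borel_measurable_integrable[OF g(1)]
  have si: "set_integrable (cell L) A g" if "A \<in> sets borel" for A
    unfolding set_integrable_def
  proof (rule Bochner_Integration.integrable_bound[OF g(1)])
    note [measurable] = borel_measurable_cell[OF borel_measurable_indicator[OF that]]
    show "(\<lambda>x. indicat_real A x *\<^sub>R g x) \<in> borel_measurable (cell L)" by measurable
  qed (simp add: indicator_def)
  have "(LINT x:A|cell L. g x) = 0" if "A \<in> sets borel" for A
    using that
  proof (induction rule: borel_set_induct)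
    case empty
    then show ?case by (simp add: set_lebesgue_integral_def)
  next
    case (interval a b)
    define a' b' where "a' = max a 0" and "b' = min b L"
    show ?case
    proof (cases "a' \<le> b'")
      case False
      then have "{a..b} \<inter> {0..L} = {}" by (auto simp: a'_def b'_def)
      then have "(LINT x:{a..b}|cell L. g x) = (LINT x|cell L. 0)"
        unfolding set_lebesgue_integral_def by (intro Bochner_Integration.integral_cong refl) (auto simp: indicator_def)
      then show ?thesis by simp
    next
      case True
      define K where "K = wave L 1 ` {a'..b'}"
      have cw: "continuous_on A (wave L 1)" for A
        unfolding wave_def cis_conv_exp divide_inverse by (intro continuous_intros)
      have K: "closed K" "K \<noteq> {}" unfolding K_def
        using True by (auto intro!: compact_imp_closed compact_continuous_image cw)
      \<comment> \<open>tent functions on the circle decreasing to the indicator of the closed arc\<close>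
      define f :: "nat \<Rightarrow> complex \<Rightarrow> real" where "f n z = max 0 (1 - real n * infdist z K)" for n z
      have cf: "continuous_on A (f n)" for A n unfolding f_def by (intro continuous_intros)
      have mf: "(\<lambda>x. f n (wave L 1 x)) \<in> borel_measurable borel" for n
        by (intro borel_measurable_continuous_onI continuous_on_compose2[OF cf[of UNIV] cw]) auto
      have z: "(LINT x|cell L. g x * f n (wave L 1 x)) = 0" for n
        by (rule annihilates_continuous_on_circle[OF L g cf mf])
      have lim: "(\<lambda>n. LINT x|cell L. g x * f n (wave L 1 x)) \<longlonglongrightarrow> (LINT x|cell L. indicator {a..b} x *\<^sub>R g x)"
      proof (rule integral_dominated_convergence[where w="\<lambda>x. \<bar>g x\<bar>"])
        show "(\<lambda>x. g x * f n (wave L 1 x)) \<in> borel_measurable (cell L)" for n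
          using borel_measurable_cell[OF mf, of n] by simp
        show "AE x in cell L. norm (g x * f n (wave L 1 x)) \<le> \<bar>g x\<bar>" for n
        proof (rule AE_I2)
          fix x
          have "\<bar>f n (wave L 1 x)\<bar> \<le> 1" by (simp add: f_def infdist_nonneg)
          then show "norm (g x * f n (wave L 1 x)) \<le> \<bar>g x\<bar>" by (simp add: abs_mult mult_left_le)
        qed
        show "AE x in cell L. (\<lambda>n. g x * f n (wave L 1 x)) \<longlonglongrightarrow> indicator {a..b} x *\<^sub>R g x"
          using AE_cell_interior AE_space
        proof eventually_elim
          case (elim x)
          then have x: "0 < x" "x < L" by auto
          have "(\<lambda>n. f n (wave L 1 x)) \<longlonglongrightarrow> indicator {a..b} x"
          proof (cases "wave L 1 x \<in> K")
            case True
            then obtain y where "y \<in> {a'..b'}" "wave L 1 x = wave L 1 y" by (auto simp: K_def)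
            then have "x \<in> {a..b}" using wave_inj[OF L x, of y] by (auto simp: a'_def b'_def)
            then show ?thesis using True by (simp add: f_def)
          next
            case False
            then have xn: "x \<notin> {a..b}" using x by (force simp: K_def a'_def b'_def)
            have pos: "infdist (wave L 1 x) K > 0"
              using in_closed_iff_infdist_zero[OF K] False by (metis infdist_nonneg less_eq_real_def)
            obtain N :: nat where N: "1 / infdist (wave L 1 x) K < real N" using reals_Archimedean2 by blast
            have "f n (wave L 1 x) = 0" if "n \<ge> N" for n
            proof -
              have "1 / infdist (wave L 1 x) K < real n" using N that by linarith
              then show ?thesis using pos by (simp add: f_def field_simps)
            qed
            then have "(\<lambda>n. f n (wave L 1 x)) \<longlonglongrightarrow> 0"
              by (intro tendsto_eventually) (auto simp: eventually_sequentially)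
            then show ?thesis using xn by simp
          qed
          then have "(\<lambda>n. g x * f n (wave L 1 x)) \<longlonglongrightarrow> g x * indicator {a..b} x" by (intro tendsto_intros)
          then show ?case by (simp add: mult.commute)
        qed
        show "(\<lambda>x. indicat_real {a..b} x *\<^sub>R g x) \<in> borel_measurable (cell L)"
          using si[of "{a..b}"] by (simp add: set_integrable_def borel_measurable_integrable)
      qed (use g in auto)
      then show ?thesis unfolding z set_lebesgue_integral_def using LIMSEQ_unique tendsto_const by blast
    qed
  next
    case (compl A)
    have "(LINT x|cell L. g x) = 0" using g(2)[of 0] L by (simp add: fcoeff_0_index)
    moreover have "(LINT x|cell L. g x) = (LINT x|cell L. indicator A x *\<^sub>R g x + indicator (-A) x *\<^sub>R g x)"
      by (intro Bochner_Integration.integral_cong refl) (auto simp: indicator_def)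
    moreover have "\<dots> = (LINT x:A|cell L. g x) + (LINT x:-A|cell L. g x)"
      unfolding set_lebesgue_integral_def using si[of A] si[of "-A"] compl.hyps
      by (intro Bochner_Integration.integral_add) (auto simp: set_integrable_def)
    ultimately show ?case using compl.IH by simp
  next
    case (union A)
    define A' where "A' i = A i \<inter> {0..L}" for i
    have A': "A' i \<in> sets (cell L)" for i
      using union.hyps unfolding cell_def A'_def by (subst sets_restrict_space_iff) auto
    have eq: "(LINT x:B|cell L. g x) = (LINT x:B \<inter> {0..L}|cell L. g x)" for B
      unfolding set_lebesgue_integral_def by (intro Bochner_Integration.integral_cong refl) (auto simp: indicator_def)
    have "(LINT x:(\<Union>i. A' i)|cell L. g x) = (\<Sum>i. (LINT x:A' i|cell L. g x))"
    proof (rule lebesgue_integral_countable_add[OF A'])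
      show "A' i \<inter> A' j = {}" if "i \<noteq> j" for i j
        using union.hyps(1) that unfolding A'_def disjoint_family_on_def by blast
      show "set_integrable (cell L) (\<Union>i. A' i) g"
        by (rule si[OF sets.countable_UN]) (use sets_cell_borel[OF A'] in auto)
    qed
    also have "\<dots> = 0" using union.IH unfolding A'_def eq[symmetric] by simp
    finally have "(LINT x:(\<Union>i. A' i)|cell L. g x) = 0" .
    moreover have "(\<Union>i. A' i) = (\<Union>i. A i) \<inter> {0..L}" by (auto simp: A'_def)
    ultimately show ?case using eq[of "\<Union>i. A i"] by metis
  qed
  note zero = this
  interpret finite_measure "cell L" by (rule finite_measure_cell)
  show ?thesis by (rule density_zero[OF g(1) zero[OF sets_cell_borel]])
qed

section \<open>Dyadic Fourier series and the embedding into cubically integrable functions\<close>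

definition wt :: "real \<Rightarrow> int \<Rightarrow> real" where
  "wt s k = (1 + (of_int k)\<^sup>2) powr s"

definition freq_ball :: "nat \<Rightarrow> int set" where
  "freq_ball n = {k. \<bar>k\<bar> + 1 < 2 ^ n}"

text \<open>Partial sums over dyadic balls, so that consecutive differences are the dyadic blocks. Coefficients
  of real functions satisfy \<open>c (-k) = cnj (c k)\<close>, and the balls are symmetric, so taking the real part
  then changes nothing.\<close>

definition psum :: "real \<Rightarrow> (int \<Rightarrow> complex) \<Rightarrow> nat \<Rightarrow> real \<Rightarrow> real" where
  "psum L c n x = Re (\<Sum>k\<in>freq_ball n. c k * wave L k x)"

lemma wt_ge_1: "s \<ge> 0 \<Longrightarrow> wt s k \<ge> 1"
  unfolding wt_def by (rule ge_one_powr_ge_zero) auto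

lemma wt_pos: "wt s k > 0"
proof -
  have "1 + (real_of_int k)\<^sup>2 > 0" by (intro add_pos_nonneg) auto
  then show ?thesis by (simp add: wt_def)
qed

lemma wt_nonneg: "wt s k \<ge> 0"
  using wt_pos[of s k] by simp

lemma finite_freq_ball [simp]: "finite (freq_ball n)"
  by (rule finite_subset[of _ "{- (2 ^ n)..2 ^ n}"]) (auto simp: freq_ball_def)

lemma freq_ball_mono: "m \<le> n \<Longrightarrow> freq_ball m \<subseteq> freq_ball n"
  unfolding freq_ball_def by (auto intro: less_le_trans power_increasing)

lemma freq_ball_uminus: "k \<in> freq_ball n \<longleftrightarrow> -k \<in> freq_ball n"
  by (simp add: freq_ball_def)

lemma eventually_freq_ball: "\<exists>N. \<forall>n\<ge>N. k \<in> freq_ball n"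
proof -
  have "\<bar>k\<bar> + 1 < 2 ^ n" if "n \<ge> nat (\<bar>k\<bar> + 1)" for n
  proof -
    have "int n < 2 ^ n" using of_nat_less_two_power[of n] by simp
    then show ?thesis using that by linarith
  qed
  then show ?thesis unfolding freq_ball_def by blast
qed

lemma filterlim_freq_ball: "filterlim freq_ball (finite_subsets_at_top UNIV) sequentially"
  unfolding filterlim_finite_subsets_at_top
proof (intro allI impI)
  fix F :: "int set" assume F: "finite F \<and> F \<subseteq> UNIV"
  define b where "b = (\<Sum>k\<in>F. \<bar>k\<bar>)"
  obtain N where N: "\<And>n. n \<ge> N \<Longrightarrow> b \<in> freq_ball n" using eventually_freq_ball by blast
  have "F \<subseteq> freq_ball n" if "n \<ge> N" for n
  proof
    fix k assume "k \<in> F"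
    then have "\<bar>k\<bar> \<le> b" unfolding b_def using F by (intro member_le_sum) auto
    then show "k \<in> freq_ball n" using N[OF that] by (auto simp: freq_ball_def)
  qed
  then show "\<forall>\<^sub>F n in sequentially. finite (freq_ball n) \<and> F \<subseteq> freq_ball n \<and> freq_ball n \<subseteq> UNIV"
    by (auto simp: eventually_sequentially)
qed

lemma has_sum_freq_ball_limit:
  "f summable_on UNIV \<Longrightarrow> (\<lambda>n. sum f (freq_ball n)) \<longlonglongrightarrow> infsum f UNIV"
  by (rule filterlim_compose[OF infsum_tendsto filterlim_freq_ball])

lemma psum_measurable [measurable]: "psum L c n \<in> borel_measurable borel"
  unfolding psum_def by measurable

lemma psum_measurable_cell [measurable]: "psum L c n \<in> borel_measurable (cell L')"
  by (rule borel_measurable_cell) simp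

lemma psum_periodic: "L > 0 \<Longrightarrow> psum L c n (x + L) = psum L c n x"
  by (simp add: psum_def wave_periodic)

lemma psum_of_real:
  assumes "\<And>k. c (-k) = cnj (c k)"
  shows "complex_of_real (psum L c n x) = (\<Sum>k\<in>freq_ball n. c k * wave L k x)"
proof -
  let ?z = "\<Sum>k\<in>freq_ball n. c k * wave L k x"
  have "cnj ?z = (\<Sum>k\<in>freq_ball n. c (-k) * wave L (-k) x)"
    by (simp add: assms cnj_wave)
  also have "\<dots> = ?z"
    by (rule sum.reindex_bij_witness[of _ uminus uminus]) (use freq_ball_uminus in auto)
  finally have "?z \<in> \<real>" by (simp only: Reals_cnj_iff)
  then show ?thesis unfolding psum_def by (rule of_real_Re)
qed

lemma fcoeff_psum:
  assumes L: "L > 0" and c: "\<And>k. c (-k) = cnj (c k)"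
  shows "fcoeff L (psum L c n) j = (if j \<in> freq_ball n then c j else 0)"
proof -
  have i: "integrable (cell L) (wave L k)" for k by (rule integrable_bounded_cell[of _ 1]) auto
  have "(LINT x|cell L. of_real (psum L c n x) * wave L (-j) x) = (LINT x|cell L. (\<Sum>k\<in>freq_ball n. c k * wave L (k - j) x))"
  proof (rule Bochner_Integration.integral_cong[OF refl])
    fix x
    have "wave L k x * wave L (-j) x = wave L (k - j) x" for k using wave_mult[of L k x "-j"] by simp
    then show "of_real (psum L c n x) * wave L (-j) x = (\<Sum>k\<in>freq_ball n. c k * wave L (k - j) x)"
      unfolding psum_of_real[of c, OF c] sum_distrib_right mult.assoc by simp
  qed
  also have "\<dots> = (\<Sum>k\<in>freq_ball n. c k * (if k - j = 0 then of_real L else 0))"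
    by (subst Bochner_Integration.integral_sum, (intro integrable_mult_right i),
        simp only: integral_mult_right_zero wave_integral[OF L])
  also have "\<dots> = (if j \<in> freq_ball n then c j * of_real L else 0)"
    by (simp add: if_distrib[of "\<lambda>x. _ * x"] sum.delta cong: if_cong)
  finally show ?thesis using L by (simp add: fcoeff_wave)
qed

lemma summable_integral_imp_AE_summable:
  fixes f :: "nat \<Rightarrow> 'a \<Rightarrow> real"
  assumes f: "\<And>j. integrable M (f j)" "\<And>j x. f j x \<ge> 0" and sum: "summable (\<lambda>j. integral\<^sup>L M (f j))"
  shows "AE x in M. summable (\<lambda>j. f j x)"
proof -
  note [measurable] = borel_measurable_integrable[OF f(1)]
  have "(\<integral>\<^sup>+x. (\<Sum>j. ennreal (f j x)) \<partial>M) = (\<Sum>j. \<integral>\<^sup>+x. ennreal (f j x) \<partial>M)"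
    by (rule nn_integral_suminf) simp
  also have "\<dots> = (\<Sum>j. ennreal (integral\<^sup>L M (f j)))"
    using f by (simp add: nn_integral_eq_integral)
  also have "\<dots> = ennreal (\<Sum>j. integral\<^sup>L M (f j))"
    using sum f by (intro suminf_ennreal2) auto
  finally have "(\<integral>\<^sup>+x. (\<Sum>j. ennreal (f j x)) \<partial>M) \<noteq> \<infinity>" by simp
  then have "AE x in M. (\<Sum>j. ennreal (f j x)) \<noteq> \<infinity>"
    by (intro nn_integral_PInf_AE) auto
  then show ?thesis
    by eventually_elim (intro summable_suminf_not_top f(2), simp)
qed

text \<open>One dyadic block has about \<open>2^j\<close> frequencies, each of weight at least about \<open>4^(j s)\<close>. Hence its
  maximum is at most \<open>2^(j/2)\<close> times its \<open>l\<^sup>2\<close> norm, and the cube integrates to a multiple of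
  \<open>2^(j/2) 2^(-3 j s)\<close>: geometric decay precisely when \<open>s > 1/6\<close>.\<close>

lemma dyadic_block_cube:
  assumes L: "L > 0" and s: "s > 1/6"
  shows "\<exists>C r. 0 \<le> C \<and> 0 < r \<and> r < 1 \<and> (\<forall>c\<in>ell2w (wt s). \<forall>j.
     integrable (cell L) (\<lambda>x. \<bar>psum L c (Suc j) x - psum L c j x\<bar> ^ 3) \<and>
     (LINT x|cell L. \<bar>psum L c (Suc j) x - psum L c j x\<bar> ^ 3) \<le> C * r ^ j * sqrt (wip (wt s) c c) ^ 3)"
proof -
  define q where "q = 4 powr (- s)"
  define r where "r = sqrt (2 * q) * q"
  define D where "D = 2 powr s"
  define C where "C = 2 * sqrt D * (L * D)"
  have q: "q > 0" and D: "D > 0" by (simp_all add: q_def D_def)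
  have "2 * q ^ 3 < 1"
  proof -
    have "2 * q ^ 3 = 2 powr (1 - 6 * s)"
    proof -
      have "q = 2 powr (- (2 * s))" using powr_powr[of 2 2 "-s"] by (simp add: q_def)
      then have "q ^ 3 = 2 powr (- (2 * s) * 3)" using powr_power[of 2 "- (2 * s)" 3] by simp
      then show ?thesis by (simp add: powr_diff powr_minus field_simps)
    qed
    also have "\<dots> < 2 powr 0" using s by (intro powr_less_mono) auto
    finally show ?thesis by simp
  qed
  moreover have "r\<^sup>2 = 2 * q ^ 3" using q by (simp add: r_def power_mult_distrib power3_eq_cube power2_eq_square)
  ultimately have r1: "r < 1" using power2_less_imp_less[of r 1] by simp
  have r0: "r > 0" using q by (simp add: r_def)
  show ?thesis
  proof (rule exI[of _ C], rule exI[of _ r], intro conjI ballI allI r0 r1)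
    show "0 \<le> C" using L D by (simp add: C_def)
    fix c :: "int \<Rightarrow> complex" and j :: nat assume c: "c \<in> ell2w (wt s)"
    define S where "S = wip (wt s) c c"
    have S: "S \<ge> 0" unfolding S_def by (rule wip_self_nonneg[OF wt_nonneg])
    define K where "K = freq_ball (Suc j) - freq_ball j"
    have K: "finite K" by (simp add: K_def)
    define T where "T x = (\<Sum>k\<in>K. c k * wave L k x)" for x
    define E where "E = (\<Sum>k\<in>K. (cmod (c k))\<^sup>2)"
    have E0: "E \<ge> 0" by (simp add: E_def sum_nonneg)
    have dT: "psum L c (Suc j) x - psum L c j x = Re (T x)" for x
      unfolding psum_def T_def K_def
      by (subst sum_diff) (use freq_ball_mono[of j "Suc j"] in auto)
    have cardK: "card K \<le> 4 * 2 ^ j"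
    proof -
      have "K \<subseteq> {- (2 * 2 ^ j)<..<2 * 2 ^ j}" by (auto simp: K_def freq_ball_def)
      then have "card K \<le> card {- (2 * 2 ^ j)<..<2 * 2 ^ j :: int}" by (intro card_mono) auto
      also have "\<dots> \<le> 4 * 2 ^ j" by (simp add: nat_le_iff)
      finally show ?thesis .
    qed
    have wK: "1 \<le> D * q ^ j * wt s k" if "k \<in> K" for k
    proof -
      have "2 ^ j \<le> \<bar>k\<bar> + 1" using that by (auto simp: K_def freq_ball_def)
      then have "real_of_int (2 ^ j) \<le> real_of_int (\<bar>k\<bar> + 1)" by (simp only: of_int_le_iff)
      then have "(2 ^ j :: real) \<le> \<bar>of_int k\<bar> + 1" by simp
      then have "(2 ^ j)\<^sup>2 \<le> (\<bar>of_int k\<bar> + 1 :: real)\<^sup>2" by (intro power_mono) auto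
      also have "\<dots> \<le> 2 * (1 + (of_int k)\<^sup>2)"
        using sum_squares_bound[of "\<bar>real_of_int k\<bar>" 1] by (simp add: power2_sum)
      finally have "(2 ^ j)\<^sup>2 \<le> 2 * (1 + (of_int k :: real)\<^sup>2)" .
      moreover have "(2 ^ j)\<^sup>2 = ((2::real)\<^sup>2) ^ j" by (simp only: power_mult[symmetric] mult.commute)
      ultimately have "4 ^ j \<le> 2 * (1 + (of_int k :: real)\<^sup>2)" by simp
      then have "(4 ^ j) powr s \<le> (2 * (1 + (of_int k :: real)\<^sup>2)) powr s" using s by (intro powr_mono2) auto
      also have "\<dots> = D * wt s k" unfolding D_def wt_def by (subst powr_mult) auto
      finally have "(4 ^ j) powr s \<le> D * wt s k" .
      moreover have "(4 ^ j) powr s * q ^ j = 1"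
      proof -
        have "(4 ^ j) powr s = (4 powr s) ^ j" by (simp add: powr_power powr_realpow[symmetric] powr_powr mult.commute)
        then show ?thesis by (simp add: q_def power_mult_distrib[symmetric] powr_minus)
      qed
      ultimately show ?thesis using q mult_right_mono[of "(4 ^ j) powr s" "D * wt s k" "q ^ j"] by (simp add: mult_ac)
    qed
    have E: "E \<le> D * q ^ j * S"
    proof -
      have "E \<le> (\<Sum>k\<in>K. D * q ^ j * (wt s k * (cmod (c k))\<^sup>2))"
        unfolding E_def
      proof (rule sum_mono)
        fix k assume "k \<in> K"
        from mult_right_mono[OF wK[OF this], of "(cmod (c k))\<^sup>2"]
        show "(cmod (c k))\<^sup>2 \<le> D * q ^ j * (wt s k * (cmod (c k))\<^sup>2)" by (simp add: mult.assoc)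
      qed
      also have "\<dots> = D * q ^ j * (\<Sum>k\<in>K. wt s k * (cmod (c k))\<^sup>2)" by (simp add: sum_distrib_left)
      also have "\<dots> \<le> D * q ^ j * S"
        unfolding S_def using finite_sum_le_wip[OF wt_nonneg c K] D q by (intro mult_left_mono) auto
      finally show ?thesis .
    qed
    have sup: "cmod (T x) \<le> sqrt (4 * 2 ^ j * E)" for x
    proof -
      have "cmod (T x) \<le> (\<Sum>k\<in>K. cmod (c k))"
        unfolding T_def by (rule order_trans[OF norm_sum]) (simp add: norm_mult)
      also have "\<dots> \<le> sqrt (4 * 2 ^ j * E)"
      proof (rule real_le_rsqrt)
        have "(\<Sum>k\<in>K. cmod (c k))\<^sup>2 \<le> (\<Sum>k\<in>K. (cmod (c k))\<^sup>2) * card K" by (rule sum_squared_le_sum_of_squares)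
        also have "\<dots> \<le> E * (4 * 2 ^ j)"
          unfolding E_def[symmetric] using E0 cardK of_nat_mono[OF cardK, where 'a=real] by (intro mult_left_mono) auto
        finally show "(\<Sum>k\<in>K. cmod (c k))\<^sup>2 \<le> 4 * 2 ^ j * E" by (simp add: mult_ac)
      qed
      finally show ?thesis .
    qed
    have Tm [measurable]: "T \<in> borel_measurable borel" unfolding T_def by measurable
    have m3: "(\<lambda>x. \<bar>psum L c (Suc j) x - psum L c j x\<bar> ^ 3) \<in> borel_measurable borel" by measurable
    have i2: "integrable (cell L) (\<lambda>x. (cmod (T x))\<^sup>2)"
    proof (rule integrable_bounded_cell)
      show "norm ((cmod (T x))\<^sup>2) \<le> (sqrt (4 * 2 ^ j * E))\<^sup>2" for x
        using power_mono[OF sup norm_ge_zero, of x 2] by simp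
    qed measurable
    have pt: "\<bar>psum L c (Suc j) x - psum L c j x\<bar> ^ 3 \<le> sqrt (4 * 2 ^ j * E) * (cmod (T x))\<^sup>2" for x
    proof -
      have "\<bar>Re (T x)\<bar> ^ 3 \<le> cmod (T x) ^ 3" by (intro power_mono abs_Re_le_cmod) auto
      also have "\<dots> = cmod (T x) * (cmod (T x))\<^sup>2" by (simp add: power3_eq_cube power2_eq_square)
      also have "\<dots> \<le> sqrt (4 * 2 ^ j * E) * (cmod (T x))\<^sup>2" by (intro mult_right_mono sup) auto
      finally show ?thesis by (simp add: dT)
    qed
    show i3: "integrable (cell L) (\<lambda>x. \<bar>psum L c (Suc j) x - psum L c j x\<bar> ^ 3)"
      by (rule Bochner_Integration.integrable_bound[OF integrable_mult_right[OF i2, of "sqrt (4 * 2 ^ j * E)"]])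
         (use pt borel_measurable_cell[OF m3] in \<open>auto simp: E0\<close>)
    have "(LINT x|cell L. \<bar>psum L c (Suc j) x - psum L c j x\<bar> ^ 3) \<le> (LINT x|cell L. sqrt (4 * 2 ^ j * E) * (cmod (T x))\<^sup>2)"
      by (intro integral_mono i3 integrable_mult_right i2 pt)
    also have "\<dots> = sqrt (4 * 2 ^ j * E) * (L * E)"
      using integral_trig_poly_sq[OF L K, of c] by (simp add: T_def E_def)
    also have "\<dots> \<le> sqrt (4 * 2 ^ j * (D * q ^ j * S)) * (L * (D * q ^ j * S))"
      using E E0 L by (intro mult_mono real_sqrt_le_mono mult_left_mono) auto
    also have "\<dots> = C * r ^ j * sqrt S ^ 3"
    proof -
      have "sqrt S ^ 3 = sqrt S * S" using S by (simp add: power3_eq_cube)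
      moreover have "sqrt (4 * 2 ^ j * (D * q ^ j * S)) = 2 * sqrt D * sqrt (2 * q) ^ j * sqrt S"
        by (simp add: real_sqrt_mult real_sqrt_power power_mult_distrib mult_ac)
      ultimately show ?thesis by (simp add: C_def r_def power_mult_distrib mult_ac)
    qed
    finally show "(LINT x|cell L. \<bar>psum L c (Suc j) x - psum L c j x\<bar> ^ 3) \<le> C * r ^ j * sqrt (wip (wt s) c c) ^ 3"
      by (simp add: S_def)
  qed
qed

abbreviation cube_majorant :: "real \<Rightarrow> (real \<Rightarrow> real) \<Rightarrow> real \<Rightarrow> bool" where
  "cube_majorant L G b \<equiv> G \<in> borel_measurable (cell L) \<and> (\<forall>x. G x \<ge> 0) \<and>
     integrable (cell L) (\<lambda>x. G x ^ 3) \<and> (LINT x|cell L. G x ^ 3) \<le> b"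

text \<open>Dividing the \<open>j\<close>-th block by \<open>p^j\<close> with \<open>p^6 = r\<close> leaves a summable series of cubes whose sum \<open>H\<close> dominates
  every block: \<open>\<bar>D\<^sub>j\<bar> \<le> p^j H^(1/3)\<close>. Summing the geometric series bounds all partial sums by a single function
  with integrable cube, so that the series converges almost everywhere and in a dominated way.\<close>

lemma dyadic_series_dominated:
  assumes L: "L > 0" and s: "s > 1/6"
  shows "\<exists>C\<ge>0. \<forall>c\<in>ell2w (wt s). \<exists>G. cube_majorant L G (C * sqrt (wip (wt s) c c) ^ 3) \<and>
     (AE x in cell L. convergent (\<lambda>n. psum L c n x) \<and> (\<forall>n. \<bar>psum L c n x\<bar> \<le> G x))"
proof -
  obtain C r where C: "C \<ge> 0" and r: "0 < r" "r < 1"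
    and block: "\<And>c j. c \<in> ell2w (wt s) \<Longrightarrow> integrable (cell L) (\<lambda>x. \<bar>psum L c (Suc j) x - psum L c j x\<bar> ^ 3)"
      "\<And>c j. c \<in> ell2w (wt s) \<Longrightarrow> (LINT x|cell L. \<bar>psum L c (Suc j) x - psum L c j x\<bar> ^ 3) \<le> C * r ^ j * sqrt (wip (wt s) c c) ^ 3"
    using dyadic_block_cube[OF L s] by blast
  define p where "p = root 6 r"
  have p: "0 < p" "p < 1" using r by (auto simp: p_def)
  have p6: "p ^ 6 = r" using r by (simp add: p_def)
  have p3: "0 < p ^ 3" "p ^ 3 < 1" using p by (auto simp: power_less_one_iff)
  define A where "A = 1 / (1 - p)"
  have A: "A > 0" using p by (simp add: A_def)
  define C' where "C' = A ^ 3 * (C * (1 / (1 - p ^ 3)))"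
  have C': "C' \<ge> 0" using A C p3 by (simp add: C'_def)
  show ?thesis
  proof (intro exI[of _ C'] conjI C' ballI)
    fix c assume c: "c \<in> ell2w (wt s)"
    define B where "B = sqrt (wip (wt s) c c) ^ 3"
    have B: "B \<ge> 0" by (simp add: B_def wip_self_nonneg wt_nonneg)
    define D where "D j x = psum L c (Suc j) x - psum L c j x" for j x
    define h where "h j x = \<bar>D j x\<bar> ^ 3 / (p ^ 3) ^ j" for j x
    have h0: "h j x \<ge> 0" for j x using p by (simp add: h_def)
    have hi: "integrable (cell L) (h j)" for j
      unfolding h_def D_def by (intro integrable_divide block(1) c)
    have hI: "integral\<^sup>L (cell L) (h j) \<le> C * B * (p ^ 3) ^ j" for j
    proof -
      have "integral\<^sup>L (cell L) (h j) = (LINT x|cell L. \<bar>D j x\<bar> ^ 3) / (p ^ 3) ^ j"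
        unfolding h_def by simp
      also have "\<dots> \<le> (C * r ^ j * B) / (p ^ 3) ^ j"
        using block(2)[OF c, of j] p unfolding D_def B_def by (intro divide_right_mono) auto
      also have "r ^ j = (p ^ 3) ^ j * (p ^ 3) ^ j"
        unfolding p6[symmetric] by (simp add: power_mult[symmetric] power_add[symmetric])
      finally show ?thesis using p by (simp add: field_simps)
    qed
    have hI0: "integral\<^sup>L (cell L) (h j) \<ge> 0" for j using h0 by simp
    have sg: "summable (\<lambda>j. C * B * (p ^ 3) ^ j)" using p3 by (intro summable_mult summable_geometric) auto
    have sI: "summable (\<lambda>j. integral\<^sup>L (cell L) (h j))"
      by (rule summable_comparison_test'[OF sg, of 0]) (use hI hI0 in auto)
    have AEs: "AE x in cell L. summable (\<lambda>j. h j x)"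
      by (rule summable_integral_imp_AE_summable[OF hi h0 sI])
    have AEn: "AE x in cell L. summable (\<lambda>j. norm (h j x))" using AEs h0 by simp
    have sIn: "summable (\<lambda>j. LINT x|cell L. norm (h j x))" using sI h0 by simp
    define H where "H x = (\<Sum>j. h j x)" for x
    have Hi: "integrable (cell L) H" unfolding H_def by (rule integrable_suminf[OF hi AEn sIn])
    have "integral\<^sup>L (cell L) H = (\<Sum>j. integral\<^sup>L (cell L) (h j))"
      unfolding H_def by (rule integral_suminf[OF hi AEn sIn])
    also have "\<dots> \<le> (\<Sum>j. C * B * (p ^ 3) ^ j)" by (intro suminf_le hI sI sg)
    also have "\<dots> = C * B * (1 / (1 - p ^ 3))"
      using p3 by (subst suminf_mult) (auto simp: suminf_geometric summable_geometric)
    finally have HI: "integral\<^sup>L (cell L) H \<le> C * B * (1 / (1 - p ^ 3))" .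
    note [measurable] = borel_measurable_integrable[OF Hi]
    define G where "G x = A * root 3 \<bar>H x\<bar>" for x
    have G3: "G x ^ 3 = A ^ 3 * \<bar>H x\<bar>" for x by (simp add: G_def power_mult_distrib)
    show "\<exists>G. cube_majorant L G (C' * sqrt (wip (wt s) c c) ^ 3) \<and>
       (AE x in cell L. convergent (\<lambda>n. psum L c n x) \<and> (\<forall>n. \<bar>psum L c n x\<bar> \<le> G x))"
    proof (intro exI[of _ G] conjI allI)
      show "G \<in> borel_measurable (cell L)" unfolding G_def by measurable
      show "G x \<ge> 0" for x using A by (simp add: G_def)
      show "integrable (cell L) (\<lambda>x. G x ^ 3)" unfolding G3 using Hi by auto
      have "AE x in cell L. \<bar>H x\<bar> = H x"
        using AEs by eventually_elim (simp add: H_def suminf_nonneg h0)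
      then have "(LINT x|cell L. \<bar>H x\<bar>) = integral\<^sup>L (cell L) H" by (intro integral_cong_AE) auto
      then have "(LINT x|cell L. G x ^ 3) = A ^ 3 * integral\<^sup>L (cell L) H" unfolding G3 by simp
      also have "\<dots> \<le> A ^ 3 * (C * B * (1 / (1 - p ^ 3)))" using HI A by (intro mult_left_mono) auto
      finally show "(LINT x|cell L. G x ^ 3) \<le> C' * sqrt (wip (wt s) c c) ^ 3"
        by (simp add: C'_def B_def mult_ac)
      show "AE x in cell L. convergent (\<lambda>n. psum L c n x) \<and> (\<forall>n. \<bar>psum L c n x\<bar> \<le> G x)"
        using AEs
      proof eventually_elim
        case (elim x)
        have H0: "H x \<ge> 0" unfolding H_def using elim h0 by (intro suminf_nonneg)
        have Db: "\<bar>D j x\<bar> \<le> p ^ j * root 3 (H x)" for j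
        proof (rule power_le_imp_le_base[of _ 2])
          have "h j x \<le> H x" unfolding H_def using elim h0 sum_le_suminf[of "\<lambda>j. h j x" "{j}"] by simp
          then have "\<bar>D j x\<bar> ^ 3 \<le> (p ^ 3) ^ j * H x" using p by (simp add: h_def field_simps)
          also have "\<dots> = (p ^ j * root 3 (H x)) ^ 3"
            using H0 by (simp add: power_mult_distrib power_mult[symmetric] mult.commute)
          finally show "\<bar>D j x\<bar> ^ Suc 2 \<le> (p ^ j * root 3 (H x)) ^ Suc 2" by (simp add: eval_nat_numeral)
        qed (use p H0 in auto)
        have sp: "summable (\<lambda>j. p ^ j * root 3 (H x))" using p by (intro summable_mult2 summable_geometric) auto
        have sD: "summable (\<lambda>j. \<bar>D j x\<bar>)" by (rule summable_comparison_test'[OF sp, of 0]) (use Db in auto)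
        have tele: "(\<Sum>j<n. D j x) = psum L c n x" for n
          by (induction n) (auto simp: D_def psum_def freq_ball_def)
        have "convergent (\<lambda>n. \<Sum>j<n. D j x)"
          using summable_rabs_cancel[OF sD] by (simp add: summable_iff_convergent)
        moreover have "\<bar>psum L c n x\<bar> \<le> G x" for n
        proof -
          have "\<bar>psum L c n x\<bar> \<le> (\<Sum>j<n. \<bar>D j x\<bar>)" unfolding tele[symmetric] by (rule sum_abs)
          also have "\<dots> \<le> (\<Sum>j<n. p ^ j * root 3 (H x))" by (intro sum_mono Db)
          also have "\<dots> \<le> (\<Sum>j. p ^ j * root 3 (H x))" using p H0 by (intro sum_le_suminf sp) auto
          also have "\<dots> = G x"
            using p H0 suminf_mult2[OF summable_geometric[of p], of "root 3 (H x)"]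
            by (simp add: G_def A_def suminf_geometric)
          finally show ?thesis .
        qed
        ultimately show ?case by (simp add: tele)
      qed
    qed
  qed
qed


subsection \<open>Periodic Sobolev functions\<close>

lemma integrable_lower_powers_cell:
  assumes m: "G \<in> borel_measurable (cell L)" and i: "integrable (cell L) (\<lambda>x. \<bar>G x\<bar> ^ 3)"
  shows "integrable (cell L) (G :: real \<Rightarrow> real)" "integrable (cell L) (\<lambda>x. (G x)\<^sup>2)"
proof -
  interpret finite_measure "cell L" by (rule finite_measure_cell)
  note [measurable] = m
  have i1: "integrable (cell L) (\<lambda>x. 1 + \<bar>G x\<bar> ^ 3)" using i by (intro Bochner_Integration.integrable_add) auto
  have "t \<le> 1 + t ^ 3 \<and> t\<^sup>2 \<le> 1 + t ^ 3" if "t \<ge> 0" for t :: real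
  proof (cases "t \<le> 1")
    case True
    then show ?thesis using that power_le_one[OF that True, of 2] zero_le_power[OF that, of 3] by linarith
  next
    case False
    then have "t ^ 1 \<le> t ^ 3" "t ^ 2 \<le> t ^ 3" by (intro power_increasing; simp)+
    then show ?thesis by (intro conjI; unfold power_one_right; linarith)
  qed
  then have b: "\<bar>G x\<bar> \<le> 1 + \<bar>G x\<bar> ^ 3 \<and> \<bar>G x\<bar>\<^sup>2 \<le> 1 + \<bar>G x\<bar> ^ 3" for x by (meson abs_ge_zero)
  show "integrable (cell L) G"
    by (rule Bochner_Integration.integrable_bound[OF i1]) (use b in auto)
  show "integrable (cell L) (\<lambda>x. (G x)\<^sup>2)"
    by (rule Bochner_Integration.integrable_bound[OF i1]) (use b in auto)
qed

lemma L2perD: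
  assumes "u \<in> L2per L"
  shows "u (x + L) = u x" "u \<in> borel_measurable borel" "u \<in> borel_measurable (cell L)"
    "integrable (cell L) (\<lambda>x. (u x)\<^sup>2)" "integrable (cell L) u"
proof -
  show "u (x + L) = u x" and m: "u \<in> borel_measurable borel" and i: "integrable (cell L) (\<lambda>x. (u x)\<^sup>2)"
    using assms by (auto simp: L2per_def set_integrable_cell)
  show m': "u \<in> borel_measurable (cell L)" by (rule borel_measurable_cell[OF m])
  show "integrable (cell L) u"
    by (rule finite_measure.square_integrable_imp_integrable[OF finite_measure_cell m' i])
qed

lemma Hper_iff: "u \<in> Hper L s \<longleftrightarrow> u \<in> L2per L \<and> fcoeff L u \<in> ell2w (wt s)"
  by (simp add: Hper_def ell2w_def wt_def)

lemma HperD: "u \<in> Hper L s \<Longrightarrow> u \<in> L2per L" "u \<in> Hper L s \<Longrightarrow> fcoeff L u \<in> ell2w (wt s)"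
  by (auto simp: Hper_iff)

lemma Hnorm_wip: "Hnorm L s u = sqrt (L * wip (wt s) (fcoeff L u) (fcoeff L u))"
  by (simp add: Hnorm_def wip_self wt_def)

lemma Bessel_ell2:
  assumes L: "L > 0" and f: "f \<in> borel_measurable borel" "integrable (cell L) (\<lambda>x. (f x)\<^sup>2)"
  shows "fcoeff L f \<in> ell2w (\<lambda>_. 1)"
  by (rule wip_le_if_finite_sums_le(1)[of _ _ "(LINT x|cell L. (f x)\<^sup>2) / L"])
     (use Bessel[OF L f] L in \<open>auto simp: field_simps\<close>)

text \<open>Riesz--Fischer: the limit of the dyadic partial sums exists almost everywhere and, by dominated
  convergence, has the prescribed coefficients.\<close>

lemma fcoeff_realization:
  assumes L: "L > 0" and s: "s > 1/6" and c: "c \<in> ell2w (wt s)" and sym: "\<And>k. c (-k) = cnj (c k)"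
  shows "(\<lambda>x. lim (\<lambda>n. psum L c n x)) \<in> Hper L s" "fcoeff L (\<lambda>x. lim (\<lambda>n. psum L c n x)) = c"
proof -
  define g where "g x = lim (\<lambda>n. psum L c n x)" for x
  obtain G where [measurable]: "G \<in> borel_measurable (cell L)" and G0: "\<And>x. G x \<ge> 0"
    and G3: "integrable (cell L) (\<lambda>x. G x ^ 3)"
    and ae: "AE x in cell L. convergent (\<lambda>n. psum L c n x) \<and> (\<forall>n. \<bar>psum L c n x\<bar> \<le> G x)"
    using dyadic_series_dominated[OF L s] c by meson
  have G: "integrable (cell L) G" "integrable (cell L) (\<lambda>x. (G x)\<^sup>2)"
    using integrable_lower_powers_cell[of G L] G3 G0 by auto
  have gm [measurable]: "g \<in> borel_measurable borel" unfolding g_def by measurable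
  note [measurable] = borel_measurable_cell[OF gm]
  have lim: "AE x in cell L. (\<lambda>n. psum L c n x) \<longlonglongrightarrow> g x"
    using ae by eventually_elim (simp add: g_def convergent_LIMSEQ_iff)
  have gG: "AE x in cell L. \<bar>g x\<bar> \<le> G x"
    using ae lim
  proof eventually_elim
    case (elim x)
    then show ?case by (intro LIMSEQ_le_const2[OF tendsto_rabs[OF elim(2)]]) auto
  qed
  have g2: "integrable (cell L) (\<lambda>x. (g x)\<^sup>2)"
  proof (rule Bochner_Integration.integrable_bound[OF G(2)])
    show "AE x in cell L. norm ((g x)\<^sup>2) \<le> norm ((G x)\<^sup>2)"
      using gG by eventually_elim (use G0 in \<open>simp add: abs_le_square_iff[symmetric]\<close>)
  qed simp
  have gL: "g \<in> L2per L"
    using g2 gm psum_periodic[OF L] by (auto simp: L2per_def set_integrable_cell g_def)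
  have fg: "fcoeff L g = c"
  proof
    fix k
    have "(\<lambda>n. LINT x|cell L. of_real (psum L c n x) * wave L (-k) x) \<longlonglongrightarrow> (LINT x|cell L. of_real (g x) * wave L (-k) x)"
    proof (rule integral_dominated_convergence[where w=G])
      show "AE x in cell L. (\<lambda>n. of_real (psum L c n x) * wave L (-k) x) \<longlonglongrightarrow> of_real (g x) * wave L (-k) x"
        using lim by eventually_elim (intro tendsto_intros)
      show "AE x in cell L. norm (of_real (psum L c n x) * wave L (-k) x) \<le> G x" for n
        using ae by eventually_elim (simp add: norm_mult)
    qed (use G in auto)
    from tendsto_divide[OF this tendsto_const[of "of_real L"]] L
    have lim1: "(\<lambda>n. fcoeff L (psum L c n) k) \<longlonglongrightarrow> fcoeff L g k" by (simp add: fcoeff_wave)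
    obtain N where N: "\<And>n. n \<ge> N \<Longrightarrow> k \<in> freq_ball n" using eventually_freq_ball by blast
    have "(\<lambda>n. fcoeff L (psum L c n) k) \<longlonglongrightarrow> c k"
      by (rule tendsto_eventually) (use N in \<open>auto simp: eventually_sequentially fcoeff_psum[OF L, of c, OF sym]\<close>)
    then show "fcoeff L g k = c k" using lim1 LIMSEQ_unique by blast
  qed
  show "(\<lambda>x. lim (\<lambda>n. psum L c n x)) \<in> Hper L s" "fcoeff L (\<lambda>x. lim (\<lambda>n. psum L c n x)) = c"
    using gL fg c unfolding g_def Hper_iff by auto
qed

text \<open>By uniqueness of Fourier coefficients a function in the space agrees almost everywhere with the sum
  of its own series, and so inherits the majorant.\<close>

lemma Hper_dominated_series:
  assumes L: "L > 0" and s: "s > 1/6"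
  shows "\<exists>C\<ge>0. \<forall>u\<in>Hper L s. \<exists>G. cube_majorant L G (C * sqrt (wip (wt s) (fcoeff L u) (fcoeff L u)) ^ 3) \<and>
     (AE x in cell L. (\<lambda>n. psum L (fcoeff L u) n x) \<longlonglongrightarrow> u x \<and> (\<forall>n. \<bar>psum L (fcoeff L u) n x\<bar> \<le> G x) \<and> \<bar>u x\<bar> \<le> G x)"
proof -
  obtain C where C: "C \<ge> 0" and main: "\<And>c. c\<in>ell2w (wt s) \<Longrightarrow> \<exists>G. cube_majorant L G (C * sqrt (wip (wt s) c c) ^ 3) \<and>
     (AE x in cell L. convergent (\<lambda>n. psum L c n x) \<and> (\<forall>n. \<bar>psum L c n x\<bar> \<le> G x))"
    using dyadic_series_dominated[OF L s] by blast
  show ?thesis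
  proof (intro exI[of _ C] conjI C ballI)
    fix u assume u: "u \<in> Hper L s"
    define c where "c = fcoeff L u"
    note uD = L2perD[OF HperD(1)[OF u]]
    have c: "c \<in> ell2w (wt s)" using u by (simp add: c_def Hper_iff)
    have sym: "c (-k) = cnj (c k)" for k by (simp add: c_def fcoeff_uminus_index)
    define g where "g x = lim (\<lambda>n. psum L c n x)" for x
    have g: "g \<in> Hper L s" "fcoeff L g = c"
      using fcoeff_realization[OF L s c sym] by (auto simp: g_def[abs_def])
    note gD = L2perD[OF HperD(1)[OF g(1)]]
    have "fcoeff L (\<lambda>x. u x + (-1) * g x) k = 0" for k
      using fcoeff_add[OF uD(5) gD(5), of "-1"] g(2) by (simp add: c_def)
    then have "AE x in cell L. u x + (-1) * g x = 0"
      by (intro fcoeff_eq_0_imp_AE_0[OF L] Bochner_Integration.integrable_add integrable_mult_right uD(5) gD(5))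
    then have ug: "AE x in cell L. u x = g x" by eventually_elim simp
    obtain G where G: "G \<in> borel_measurable (cell L)" "\<And>x. G x \<ge> 0"
      "integrable (cell L) (\<lambda>x. G x ^ 3)" "(LINT x|cell L. G x ^ 3) \<le> C * sqrt (wip (wt s) c c) ^ 3"
      and ae: "AE x in cell L. convergent (\<lambda>n. psum L c n x) \<and> (\<forall>n. \<bar>psum L c n x\<bar> \<le> G x)"
      using main[OF c] by blast
    have "AE x in cell L. (\<lambda>n. psum L c n x) \<longlonglongrightarrow> u x \<and> (\<forall>n. \<bar>psum L c n x\<bar> \<le> G x) \<and> \<bar>u x\<bar> \<le> G x"
      using ae ug
    proof eventually_elim
      case (elim x)
      then have l: "(\<lambda>n. psum L c n x) \<longlonglongrightarrow> u x" by (simp add: g_def convergent_LIMSEQ_iff)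
      moreover have "\<bar>u x\<bar> \<le> G x" by (rule LIMSEQ_le_const2[OF tendsto_rabs[OF l]]) (use elim in auto)
      ultimately show ?case using elim by blast
    qed
    then show "\<exists>G. cube_majorant L G (C * sqrt (wip (wt s) (fcoeff L u) (fcoeff L u)) ^ 3) \<and>
     (AE x in cell L. (\<lambda>n. psum L (fcoeff L u) n x) \<longlonglongrightarrow> u x \<and> (\<forall>n. \<bar>psum L (fcoeff L u) n x\<bar> \<le> G x) \<and> \<bar>u x\<bar> \<le> G x)"
      using G unfolding c_def by blast
  qed
qed

lemma Hper_cube_bound:
  assumes L: "L > 0" and s: "s > 1/6"
  shows "\<exists>C\<ge>0. \<forall>u\<in>Hper L s. integrable (cell L) (\<lambda>x. \<bar>u x\<bar> ^ 3) \<and>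
     (LINT x|cell L. \<bar>u x\<bar> ^ 3) \<le> C * sqrt (wip (wt s) (fcoeff L u) (fcoeff L u)) ^ 3"
proof -
  obtain C where C: "C \<ge> 0" and main: "\<And>u. u\<in>Hper L s \<Longrightarrow> \<exists>G. cube_majorant L G (C * sqrt (wip (wt s) (fcoeff L u) (fcoeff L u)) ^ 3) \<and>
     (AE x in cell L. (\<lambda>n. psum L (fcoeff L u) n x) \<longlonglongrightarrow> u x \<and> (\<forall>n. \<bar>psum L (fcoeff L u) n x\<bar> \<le> G x) \<and> \<bar>u x\<bar> \<le> G x)"
    using Hper_dominated_series[OF L s] by blast
  show ?thesis
  proof (intro exI[of _ C] conjI C ballI)
    fix u assume u: "u \<in> Hper L s"
    note [measurable] = L2perD(3)[OF HperD(1)[OF u]]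
    obtain G where G: "G \<in> borel_measurable (cell L)" "\<And>x. G x \<ge> 0"
      "integrable (cell L) (\<lambda>x. G x ^ 3)" "(LINT x|cell L. G x ^ 3) \<le> C * sqrt (wip (wt s) (fcoeff L u) (fcoeff L u)) ^ 3"
      and ae0: "AE x in cell L. (\<lambda>n. psum L (fcoeff L u) n x) \<longlonglongrightarrow> u x \<and> (\<forall>n. \<bar>psum L (fcoeff L u) n x\<bar> \<le> G x) \<and> \<bar>u x\<bar> \<le> G x"
      using main[OF u] by blast
    have ae: "AE x in cell L. \<bar>u x\<bar> \<le> G x" using ae0 by eventually_elim blast
    have ae3: "AE x in cell L. \<bar>u x\<bar> ^ 3 \<le> G x ^ 3"
      using ae by eventually_elim (intro power_mono, auto)
    show i: "integrable (cell L) (\<lambda>x. \<bar>u x\<bar> ^ 3)"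
    proof (rule Bochner_Integration.integrable_bound[OF G(3)])
      show "AE x in cell L. norm (\<bar>u x\<bar> ^ 3) \<le> norm (G x ^ 3)"
        using ae3 by eventually_elim (use G(2) in simp)
    qed simp
    have "(LINT x|cell L. \<bar>u x\<bar> ^ 3) \<le> (LINT x|cell L. G x ^ 3)"
      by (rule integral_mono_AE[OF i G(3) ae3])
    then show "(LINT x|cell L. \<bar>u x\<bar> ^ 3) \<le> C * sqrt (wip (wt s) (fcoeff L u) (fcoeff L u)) ^ 3"
      using G(4) by linarith
  qed
qed

text \<open>Dominated convergence along the dyadic partial sums of \<open>u\<close>; the product of \<open>f\<close> with the majorant is
  integrable because both are square integrable.\<close>

lemma Parseval:
  assumes L: "L > 0" and s: "s > 1/6" and u: "u \<in> Hper L s"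
    and f: "f \<in> borel_measurable borel" "integrable (cell L) (\<lambda>x. (f x)\<^sup>2)"
  shows "integrable (cell L) (\<lambda>x. f x * u x)" "(LINT x|cell L. f x * u x) = L * l2ip (fcoeff L f) (fcoeff L u)"
proof -
  let ?c = "fcoeff L u"
  obtain G where G [measurable]: "G \<in> borel_measurable (cell L)" and G0: "\<And>x. G x \<ge> 0"
    and G3: "integrable (cell L) (\<lambda>x. G x ^ 3)"
    and ae: "AE x in cell L. (\<lambda>n. psum L ?c n x) \<longlonglongrightarrow> u x \<and> (\<forall>n. \<bar>psum L ?c n x\<bar> \<le> G x) \<and> \<bar>u x\<bar> \<le> G x"
    using Hper_dominated_series[OF L s] u by meson
  note [measurable] = L2perD(3)[OF HperD(1)[OF u]] borel_measurable_cell[OF f(1)]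
  have fi: "integrable (cell L) f"
    by (rule finite_measure.square_integrable_imp_integrable[OF finite_measure_cell borel_measurable_cell[OF f(1)] f(2)])
  have G2: "integrable (cell L) (\<lambda>x. (G x)\<^sup>2)"
    using integrable_lower_powers_cell(2)[of G L] G3 G0 by auto
  have w: "integrable (cell L) (\<lambda>x. (f x)\<^sup>2 + (G x)\<^sup>2)" by (intro Bochner_Integration.integrable_add f(2) G2)
  have b: "\<bar>f x * v\<bar> \<le> (f x)\<^sup>2 + (G x)\<^sup>2" if "\<bar>v\<bar> \<le> G x" for x v
  proof -
    have "\<bar>f x * v\<bar> \<le> \<bar>f x\<bar> * G x" using that by (simp add: abs_mult mult_left_mono)
    also have "\<dots> \<le> (f x)\<^sup>2 + (G x)\<^sup>2"
      using sum_squares_bound[of "\<bar>f x\<bar>" "G x"] mult_nonneg_nonneg[OF abs_ge_zero G0, of "f x" x] by simp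
    finally show ?thesis .
  qed
  have lim: "(\<lambda>n. LINT x|cell L. f x * psum L ?c n x) \<longlonglongrightarrow> (LINT x|cell L. f x * u x)"
    and int: "integrable (cell L) (\<lambda>x. f x * u x)"
  proof -
    have A: "AE x in cell L. (\<lambda>n. f x * psum L ?c n x) \<longlonglongrightarrow> f x * u x"
      using ae by eventually_elim (auto intro!: tendsto_intros)
    have B: "AE x in cell L. norm (f x * psum L ?c n x) \<le> (f x)\<^sup>2 + (G x)\<^sup>2" for n
      using ae by eventually_elim (simp only: real_norm_def, intro b, blast)
    show "(\<lambda>n. LINT x|cell L. f x * psum L ?c n x) \<longlonglongrightarrow> (LINT x|cell L. f x * u x)"
      by (rule integral_dominated_convergence[OF _ _ w A B]) simp_all
    show "integrable (cell L) (\<lambda>x. f x * u x)"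
      by (rule integrable_dominated_convergence[OF _ _ w A B]) simp_all
  qed
  show "integrable (cell L) (\<lambda>x. f x * u x)" by fact
  have sum: "(LINT x|cell L. f x * psum L ?c n x) = L * (\<Sum>k\<in>freq_ball n. 1 * Re (fcoeff L f k * cnj (?c k)))" for n
  proof -
    have i: "integrable (cell L) (\<lambda>x. ?c k * (of_real (f x) * wave L k x))" for k
      by (intro integrable_mult_right integrable_wave_mult fi)
    have iS: "integrable (cell L) (\<lambda>x. \<Sum>k\<in>freq_ball n. ?c k * (of_real (f x) * wave L k x))"
      by (intro Bochner_Integration.integrable_sum i)
    have "(LINT x|cell L. f x * psum L ?c n x) = (LINT x|cell L. Re (\<Sum>k\<in>freq_ball n. ?c k * (of_real (f x) * wave L k x)))"
    proof (rule Bochner_Integration.integral_cong[OF refl])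
      fix x
      have "(\<Sum>k\<in>freq_ball n. ?c k * (of_real (f x) * wave L k x)) = of_real (f x) * (\<Sum>k\<in>freq_ball n. ?c k * wave L k x)"
        by (simp add: sum_distrib_left mult.left_commute)
      then show "f x * psum L ?c n x = Re (\<Sum>k\<in>freq_ball n. ?c k * (of_real (f x) * wave L k x))"
        by (simp only: psum_def Re_complex_of_real Im_complex_of_real times_complex.sel mult_zero_left diff_zero)
    qed
    also have "\<dots> = Re (LINT x|cell L. (\<Sum>k\<in>freq_ball n. ?c k * (of_real (f x) * wave L k x)))"
      by (rule integral_Re[OF iS])
    also have "(LINT x|cell L. (\<Sum>k\<in>freq_ball n. ?c k * (of_real (f x) * wave L k x)))
       = (\<Sum>k\<in>freq_ball n. ?c k * (of_real L * cnj (fcoeff L f k)))"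
    proof -
      have "(LINT x|cell L. of_real (f x) * wave L k x) = of_real L * cnj (fcoeff L f k)" for k
        using L unfolding fcoeff_uminus_index[symmetric] by (simp add: fcoeff_wave)
      then show ?thesis by (subst Bochner_Integration.integral_sum[OF i]) simp
    qed
    also have "Re \<dots> = L * (\<Sum>k\<in>freq_ball n. 1 * Re (fcoeff L f k * cnj (?c k)))"
      unfolding Re_sum sum_distrib_left by (intro sum.cong refl) (simp add: algebra_simps)
    finally show ?thesis .
  qed
  have "?c \<in> ell2w (\<lambda>_. 1)"
    using Bessel_ell2[OF L L2perD(2)[OF HperD(1)[OF u]] L2perD(4)[OF HperD(1)[OF u]]] .
  then have "(\<lambda>k. 1 * Re (fcoeff L f k * cnj (?c k))) summable_on UNIV"
    using wip_summable[of "\<lambda>_. 1", OF _ Bessel_ell2[OF L f]] by simp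
  from has_sum_freq_ball_limit[OF this]
  have "(\<lambda>n. L * (\<Sum>k\<in>freq_ball n. 1 * Re (fcoeff L f k * cnj (?c k)))) \<longlonglongrightarrow> L * l2ip (fcoeff L f) ?c"
    unfolding wip_def by (intro tendsto_intros)
  then show "(LINT x|cell L. f x * u x) = L * l2ip (fcoeff L f) ?c"
    using lim unfolding sum using LIMSEQ_unique by blast
qed

section \<open>The quadratic form of the linearised operator\<close>

lemma wip_weight_comb:
  assumes "\<And>k. \<beta> k \<ge> 0" "\<And>k. \<beta>' k \<ge> 0" "a \<in> ell2w \<beta>" "b \<in> ell2w \<beta>" "a \<in> ell2w \<beta>'" "b \<in> ell2w \<beta>'"
  shows "wip (\<lambda>k. p * \<beta> k + q * \<beta>' k) a b = p * wip \<beta> a b + q * wip \<beta>' a b"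
proof -
  have "wip (\<lambda>k. p * \<beta> k + q * \<beta>' k) a b
      = (\<Sum>\<^sub>\<infinity>k. p * (\<beta> k * Re (a k * cnj (b k))) + q * (\<beta>' k * Re (a k * cnj (b k))))"
    unfolding wip_def by (intro infsum_cong) (simp only: distrib_right mult.assoc)
  also have "\<dots> = p * wip \<beta> a b + q * wip \<beta>' a b"
    unfolding wip_def
    by (subst infsum_add[OF summable_on_cmult_right[OF wip_summable[OF assms(1,3,4)]]
          summable_on_cmult_right[OF wip_summable[OF assms(2,5,6)]]])
       (simp only: infsum_cmult_right')
  finally show ?thesis .
qed

lemma square_powr_half:
  fixes x :: real
  assumes "x \<noteq> 0"
  shows "(x\<^sup>2) powr (m/2) = \<bar>x\<bar> powr m"
proof -
  have "x\<^sup>2 = \<bar>x\<bar> powr 2" using assms by simp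
  then show ?thesis by (simp only: powr_powr) simp
qed

lemma dual_pairing_wip:
  assumes "\<And>k. \<theta> (of_int k) \<ge> 0" "fcoeff L u \<in> ell2w (\<lambda>k. \<theta> (of_int k))"
  shows "dual_pairing L (mult_coeff L \<theta> u) u = L * wip (\<lambda>k. \<theta> (of_int k)) (fcoeff L u) (fcoeff L u)"
  using wip_eq_Re_infsum[OF assms(1) assms(2) assms(2)]
  by (simp add: dual_pairing_def mult_coeff_def mult.assoc)

lemma summable_on_int_inverse_squares: "(\<lambda>k::int. 1 / (1 + (of_int k :: real)\<^sup>2)) summable_on UNIV"
proof -
  have "(\<lambda>n. 1 / (1 + (real n)\<^sup>2)) summable_on UNIV"
  proof (rule summable_nonneg_imp_summable_on)
    show "summable (\<lambda>n. 1 / (1 + (real n)\<^sup>2))"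
    proof (rule summable_comparison_test'[OF inverse_power_summable[of 2, where 'a=real], of 1])
      fix n :: nat assume "n \<ge> 1"
      then show "norm (1 / (1 + (real n)\<^sup>2)) \<le> inverse (real n ^ 2)"
        by (simp add: inverse_eq_divide frac_le)
    qed simp
  qed simp
  then have "((\<lambda>k::int. 1 / (1 + (of_int k :: real)\<^sup>2)) \<circ> int) summable_on UNIV"
    "((\<lambda>k::int. 1 / (1 + (of_int k :: real)\<^sup>2)) \<circ> (\<lambda>n. - int n)) summable_on UNIV"
    by (simp_all add: o_def)
  then have "(\<lambda>k::int. 1 / (1 + (of_int k :: real)\<^sup>2)) summable_on (range int)"
    "(\<lambda>k::int. 1 / (1 + (of_int k :: real)\<^sup>2)) summable_on (range (\<lambda>n. - int n))"
    by (subst summable_on_reindex; simp add: inj_on_def)+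
  then have "(\<lambda>k::int. 1 / (1 + (of_int k :: real)\<^sup>2)) summable_on (range int \<union> range (\<lambda>n. - int n))"
    by (rule summable_on_union)
  moreover have "range int \<union> range (\<lambda>n. - int n) = UNIV"
  proof -
    have "k \<in> range int \<union> range (\<lambda>n. - int n)" for k
      by (cases k rule: int_cases2) auto
    then show ?thesis by blast
  qed
  ultimately show ?thesis by simp
qed

text \<open>The second-order condition at a minimum of a quadratic functional under a cubic constraint, reduced to
  one variable: both sides agree up to first order, so the coefficients of \<open>t\<^sup>2\<close> are ordered.\<close>

lemma second_variation_scalar:
  fixes A a b :: real
  assumes "\<And>t. 1 + 3 * t\<^sup>2 * a + t ^ 3 * b > 0 \<Longrightarrow> (1 + 3 * t\<^sup>2 * a + t ^ 3 * b)\<^sup>2 \<le> (1 + 2 * t\<^sup>2 * A) ^ 3"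
  shows "a \<le> A"
proof -
  have "((\<lambda>t. 1 + 3 * t\<^sup>2 * a + t ^ 3 * b) \<longlongrightarrow> 1 + 3 * 0\<^sup>2 * a + 0 ^ 3 * b) (at_right 0)"
    by (intro tendsto_intros)
  then have ev: "\<forall>\<^sub>F t in at_right 0. 1 + 3 * t\<^sup>2 * a + t ^ 3 * b > 0"
    by (intro order_tendstoD(1)) auto
  have "((\<lambda>t. 12 * t\<^sup>2 * A\<^sup>2 + 8 * t ^ 4 * A ^ 3 - 2 * t * b) \<longlongrightarrow> 12 * 0\<^sup>2 * A\<^sup>2 + 8 * 0 ^ 4 * A ^ 3 - 2 * 0 * b) (at_right 0)"
    by (intro tendsto_intros)
  then have lim: "((\<lambda>t. 12 * t\<^sup>2 * A\<^sup>2 + 8 * t ^ 4 * A ^ 3 - 2 * t * b) \<longlongrightarrow> 0) (at_right 0)" by simp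
  have "6 * (a - A) \<le> 0"
  proof (rule tendsto_lowerbound[OF lim])
    show "\<forall>\<^sub>F t in at_right 0. 6 * (a - A) \<le> 12 * t\<^sup>2 * A\<^sup>2 + 8 * t ^ 4 * A ^ 3 - 2 * t * b"
      using ev eventually_at_right_less[of 0]
    proof eventually_elim
      case (elim t)
      have "1 + 6 * t\<^sup>2 * a + 2 * t ^ 3 * b \<le> (1 + 3 * t\<^sup>2 * a + t ^ 3 * b)\<^sup>2"
      proof -
        have "(1 + 3 * t\<^sup>2 * a + t ^ 3 * b)\<^sup>2 = 1 + 6 * t\<^sup>2 * a + 2 * t ^ 3 * b + (3 * t\<^sup>2 * a + t ^ 3 * b)\<^sup>2"
          by (simp add: power2_eq_square algebra_simps)
        then show ?thesis by simp
      qed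
      also have "\<dots> \<le> (1 + 2 * t\<^sup>2 * A) ^ 3" by (rule assms[OF elim(1)])
      also have "\<dots> = 1 + 6 * t\<^sup>2 * A + 12 * t ^ 4 * A\<^sup>2 + 8 * t ^ 6 * A ^ 3"
        by (simp add: power2_eq_square eval_nat_numeral algebra_simps)
      finally have "t\<^sup>2 * (6 * (a - A)) \<le> t\<^sup>2 * (12 * t\<^sup>2 * A\<^sup>2 + 8 * t ^ 4 * A ^ 3 - 2 * t * b)"
        by (simp add: power2_eq_square eval_nat_numeral algebra_simps)
      then show ?case using elim(2) by (subst (asm) mult_le_cancel_left_pos) auto
    qed
  qed simp
  then show ?thesis by simp
qed

locale constrained_wave =
  fixes L m1 \<upsilon>1 \<upsilon>2 \<omega> \<gamma> :: real and \<theta> \<phi> \<psi> :: "real \<Rightarrow> real"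
  assumes L: "L > 0" and m1: "m1 > 1/3" and \<upsilon>: "\<upsilon>1 > 0" "\<upsilon>2 > 0" and \<omega>: "\<omega> > 1"
    and \<theta>_even: "\<And>x. \<theta> (- x) = \<theta> x"
    and \<theta>_lower: "\<And>\<kappa>::int. \<upsilon>1 * \<bar>of_int \<kappa>\<bar> powr m1 \<le> \<theta> (of_int \<kappa>)"
    and \<theta>_upper: "\<And>\<kappa>::int. \<theta> (of_int \<kappa>) \<le> \<upsilon>2 * \<bar>of_int \<kappa>\<bar> powr m1"
    and \<gamma>: "\<gamma> > 0" "\<gamma> > 2 * (\<omega> - 1) * L"
    and minimizer: "is_arg_min (functional_B L \<theta> \<omega>) (\<lambda>u. u \<in> Yset L (m1/2) \<gamma>) \<phi>"
    and multiplier: "wave_equation L \<theta> \<omega> \<phi>"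
    and deriv: "has_per_deriv L \<phi> \<psi>"
    and kernel: "lin_op_ker L \<theta> m1 \<omega> \<phi> = per_span L \<psi>"
begin

abbreviation X where "X \<equiv> Hper L (m1/2)"
abbreviation w where "w \<equiv> wt (m1/2)"
abbreviation ft where "ft \<equiv> fcoeff L"
abbreviation Xnorm where "Xnorm \<equiv> Hnorm L (m1/2)"
abbreviation odist where "odist u \<equiv> orbit_dist L (m1/2) u \<phi>"
abbreviation tw where "tw \<equiv> (\<lambda>k::int. \<theta> (of_int k))"

text \<open>The symbol of \<open>\<omega>\<M> + (\<omega> - 1)\<close>; its form is equivalent to the square of the norm of \<open>X\<close>.\<close>

definition alpha :: "int \<Rightarrow> real" where
  "alpha k = \<omega> * \<theta> (of_int k) + (\<omega> - 1)"

definition nsq :: "(real \<Rightarrow> real) \<Rightarrow> real" where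
  "nsq u = wip w (ft u) (ft u)"

definition lin_form :: "(real \<Rightarrow> real) \<Rightarrow> (real \<Rightarrow> real) \<Rightarrow> real" where
  "lin_form u v = L * wip alpha (ft u) (ft v) - (LINT x|cell L. \<phi> x * u x * v x)"

lemma exponent: "m1/2 > 1/6" using m1 by simp

lemma tw_nonneg: "tw k \<ge> 0"
proof -
  have "0 \<le> \<upsilon>1 * \<bar>of_int k\<bar> powr m1" using \<upsilon> by simp
  then show ?thesis using \<theta>_lower[of k] by linarith
qed

lemma tw_0: "\<theta> 0 = 0"
  using \<theta>_lower[of 0] \<theta>_upper[of 0] by simp

lemma alpha_pos: "alpha k > 0"
  unfolding alpha_def using tw_nonneg[of k] \<omega> by (simp add: add_nonneg_pos)

lemma alpha_nonneg: "alpha k \<ge> 0" using alpha_pos[of k] by simp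

lemma w_ge_1: "w k \<ge> 1" using wt_ge_1 m1 by simp

lemma tw_le: "tw k \<le> \<upsilon>2 * w k"
proof -
  have "\<bar>of_int k :: real\<bar> powr m1 \<le> w k"
  proof (cases "k = 0")
    case True then show ?thesis using w_ge_1[of 0] by simp
  next
    case False
    then have "\<bar>of_int k :: real\<bar> powr m1 = (\<bar>of_int k\<bar>\<^sup>2) powr (m1/2)"
      using square_powr_half[of "of_int k" m1] by simp
    also have "\<dots> \<le> w k" unfolding wt_def using m1 by (intro powr_mono2) auto
    finally show ?thesis .
  qed
  then show ?thesis using \<theta>_upper[of k] \<upsilon> mult_left_mono[of _ "w k" \<upsilon>2] by (meson less_imp_le order_trans)
qed

lemma alpha_le: "alpha k \<le> (\<omega> * \<upsilon>2 + (\<omega> - 1)) * w k"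
proof -
  have "\<omega> * tw k \<le> \<omega> * (\<upsilon>2 * w k)" using tw_le \<omega> by (intro mult_left_mono) auto
  moreover have "(\<omega> - 1) * 1 \<le> (\<omega> - 1) * w k" using w_ge_1 \<omega> by (intro mult_left_mono) auto
  ultimately show ?thesis by (simp add: alpha_def algebra_simps)
qed

definition coerc :: real where "coerc = 1 / (\<omega> - 1) + 2 powr (m1/2) / \<upsilon>1"

lemma coerc_pos: "coerc > 0"
  unfolding coerc_def using \<omega> \<upsilon> by (simp add: add_pos_pos)

lemma w_le: "w k \<le> coerc * alpha k"
proof (cases "k = 0")
  case True
  have "(1 / (\<omega> - 1)) * alpha k \<le> coerc * alpha k"
    using alpha_nonneg[of k] \<upsilon> unfolding coerc_def by (intro mult_right_mono) auto
  moreover have "(1 / (\<omega> - 1)) * alpha k = 1" using True \<omega> tw_0 by (simp add: alpha_def)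
  ultimately show ?thesis using True by (simp add: wt_def)
next
  case False
  have "1 \<le> (of_int k :: real)\<^sup>2"
  proof -
    have "1 \<le> \<bar>k\<bar>" using False by simp
    then have "1 \<le> \<bar>of_int k :: real\<bar>" by linarith
    then show ?thesis using power_mono[of 1 "\<bar>of_int k :: real\<bar>" 2] by simp
  qed
  then have "w k \<le> (2 * (of_int k)\<^sup>2) powr (m1/2)"
    unfolding wt_def using m1 by (intro powr_mono2) auto
  also have "\<dots> = 2 powr (m1/2) * ((\<bar>of_int k\<bar>\<^sup>2) powr (m1/2))" by (subst powr_mult) auto
  also have "(\<bar>of_int k :: real\<bar>\<^sup>2) powr (m1/2) = \<bar>of_int k\<bar> powr m1"
    using False square_powr_half[of "of_int k" m1] by simp
  also have "\<dots> \<le> tw k / \<upsilon>1" using \<theta>_lower[of k] \<upsilon> by (simp add: field_simps)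
  finally have "w k \<le> 2 powr (m1/2) * (tw k / \<upsilon>1)" by simp
  also have "\<dots> = (2 powr (m1/2) / \<upsilon>1) * tw k" by simp
  also have "\<dots> \<le> coerc * alpha k"
  proof (rule mult_mono)
    show "2 powr (m1/2) / \<upsilon>1 \<le> coerc" unfolding coerc_def using \<omega> by simp
    have "1 * tw k \<le> \<omega> * tw k" using tw_nonneg[of k] \<omega> by (intro mult_right_mono) auto
    then show "tw k \<le> alpha k" using \<omega> by (simp add: alpha_def)
  qed (use coerc_pos tw_nonneg in \<open>auto intro: less_imp_le\<close>)
  finally show ?thesis .
qed

lemma finite_w_sublevel: "finite {k. w k \<le> B}"
proof (rule finite_subset)
  define N where "N = \<lceil>(max B 1) powr (2/m1)\<rceil>"
  show "{k. w k \<le> B} \<subseteq> {-N..N}"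
  proof (clarify)
    fix k assume "w k \<le> B"
    then have "w k powr (2/m1) \<le> (max B 1) powr (2/m1)" using wt_nonneg m1 by (intro powr_mono2) auto
    moreover have "w k powr (2/m1) = 1 + (of_int k)\<^sup>2"
    proof -
      have "1 + (real_of_int k)\<^sup>2 > 0" by (intro add_pos_nonneg) auto
      then show ?thesis using m1 by (simp add: wt_def powr_powr)
    qed
    moreover have "\<bar>real_of_int k\<bar> \<le> 1 + (of_int k)\<^sup>2"
      using sum_squares_bound[of "\<bar>real_of_int k\<bar>" 1] by simp
    ultimately have "\<bar>real_of_int k\<bar> \<le> (max B 1) powr (2/m1)" by linarith
    then have "\<bar>k\<bar> \<le> N" unfolding N_def by linarith
    then show "k \<in> {-N..N}" by auto
  qed
qed simp

lemma ell2w_weights: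
  assumes "a \<in> ell2w w"
  shows "a \<in> ell2w alpha" "a \<in> ell2w tw" "a \<in> ell2w (\<lambda>_. 1)"
  using ell2w_mono[OF assms alpha_nonneg alpha_le] ell2w_mono[OF assms tw_nonneg tw_le]
    ell2w_mono[OF assms, of "\<lambda>_. 1" 1] w_ge_1 by auto

lemmas XL2 = L2perD[OF HperD(1)]

lemma X_ell:
  assumes "u \<in> X"
  shows "ft u \<in> ell2w w" "ft u \<in> ell2w alpha" "ft u \<in> ell2w tw" "ft u \<in> ell2w (\<lambda>_. 1)"
  using HperD(2)[OF assms] ell2w_weights by auto

lemma X_comb:
  assumes "u \<in> X" "v \<in> X"
  shows "(\<lambda>x. u x + t * v x) \<in> X" "ft (\<lambda>x. u x + t * v x) = (\<lambda>k. ft u k + of_real t * ft v k)"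
proof -
  show f: "ft (\<lambda>x. u x + t * v x) = (\<lambda>k. ft u k + of_real t * ft v k)"
    using fcoeff_add[OF XL2(5)[OF assms(1)] XL2(5)[OF assms(2)]] by blast
  have "integrable (cell L) (\<lambda>x. (u x + t * v x)\<^sup>2)"
  proof (rule Bochner_Integration.integrable_bound)
    show "integrable (cell L) (\<lambda>x. 2 * (u x)\<^sup>2 + (2 * t\<^sup>2) * (v x)\<^sup>2)"
      using XL2(4) assms by (intro Bochner_Integration.integrable_add integrable_mult_right) auto
    show "(\<lambda>x. (u x + t * v x)\<^sup>2) \<in> borel_measurable (cell L)"
      using XL2(3)[OF assms(1)] XL2(3)[OF assms(2)] by measurable
    show "AE x in cell L. norm ((u x + t * v x)\<^sup>2) \<le> norm (2 * (u x)\<^sup>2 + (2 * t\<^sup>2) * (v x)\<^sup>2)"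
    proof (rule AE_I2)
      fix x
      have "(u x + t * v x)\<^sup>2 \<le> 2 * (u x)\<^sup>2 + 2 * (t * v x)\<^sup>2"
        using sum_squares_bound[of "u x" "t * v x"] by (simp add: power2_sum)
      then show "norm ((u x + t * v x)\<^sup>2) \<le> norm (2 * (u x)\<^sup>2 + (2 * t\<^sup>2) * (v x)\<^sup>2)"
        by (simp add: power_mult_distrib)
    qed
  qed
  then show "(\<lambda>x. u x + t * v x) \<in> X"
    using XL2(1,2)[OF assms(1)] XL2(1,2)[OF assms(2)] X_ell(1)[OF assms(1)] X_ell(1)[OF assms(2)]
    unfolding Hper_iff f by (auto simp: L2per_def set_integrable_cell intro!: ell2w_comb wt_nonneg)
qed

lemma X_cube: "u \<in> X \<Longrightarrow> integrable (cell L) (\<lambda>x. \<bar>u x\<bar> ^ 3)"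
  using Hper_cube_bound[OF L exponent] by blast

lemma X_product3:
  assumes "u \<in> X" "v \<in> X" "z \<in> X"
  shows "integrable (cell L) (\<lambda>x. u x * v x * z x)"
proof (rule Bochner_Integration.integrable_bound)
  show "integrable (cell L) (\<lambda>x. \<bar>u x\<bar> ^ 3 + \<bar>v x\<bar> ^ 3 + \<bar>z x\<bar> ^ 3)"
    using assms by (intro Bochner_Integration.integrable_add X_cube)
  show "(\<lambda>x. u x * v x * z x) \<in> borel_measurable (cell L)"
    using XL2(3)[OF assms(1)] XL2(3)[OF assms(2)] XL2(3)[OF assms(3)] by measurable
  have amgm: "a * b * c \<le> a ^ 3 + b ^ 3 + c ^ 3" if "a \<ge> 0" "b \<ge> 0" "c \<ge> 0" for a b c :: real
  proof -
    define m where "m = max a (max b c)"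
    have "a * b * c \<le> m * m * m" using that by (intro mult_mono) (auto simp: m_def)
    also have "\<dots> = m ^ 3" by (simp add: power3_eq_cube)
    also have "\<dots> \<le> a ^ 3 + b ^ 3 + c ^ 3"
      using that zero_le_power[of a 3] zero_le_power[of b 3] zero_le_power[of c 3]
      unfolding m_def by (auto simp: max_def)
    finally show ?thesis .
  qed
  show "AE x in cell L. norm (u x * v x * z x) \<le> norm (\<bar>u x\<bar> ^ 3 + \<bar>v x\<bar> ^ 3 + \<bar>z x\<bar> ^ 3)"
    using amgm[of "\<bar>u _\<bar>" "\<bar>v _\<bar>" "\<bar>z _\<bar>"] by (intro AE_I2) (simp add: abs_mult)
qed

lemma X_product2:
  assumes "u \<in> X" "v \<in> X"
  shows "integrable (cell L) (\<lambda>x. u x * v x)"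
  using Parseval(1)[OF L exponent assms(2) XL2(2)[OF assms(1)] XL2(4)[OF assms(1)]] .

lemma integral_sq: "u \<in> X \<Longrightarrow> (LINT x|cell L. (u x)\<^sup>2) = L * l2ip (ft u) (ft u)"
  using Parseval(2)[OF L exponent _ XL2(2) XL2(4), of u u] by (simp add: power2_eq_square)

lemma const_X: "(\<lambda>x. c) \<in> X" "ft (\<lambda>x. c) = (\<lambda>k. if k = 0 then of_real c else 0)"
proof -
  show f: "ft (\<lambda>x. c) = (\<lambda>k. if k = 0 then of_real c else 0)" using fcoeff_const[OF L, of c] by blast
  have "integrable (cell L) (\<lambda>x. c\<^sup>2)" using integrable_bounded_cell[of "\<lambda>x. c\<^sup>2" "c\<^sup>2" L] by simp
  moreover have "(\<lambda>k::int. if k = 0 then complex_of_real c else 0) \<in> ell2w w"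
    by (rule ell2w_finite_support) (auto intro: finite_subset[of _ "{0}"])
  ultimately show "(\<lambda>x. c) \<in> X"
    unfolding Hper_iff f by (auto simp: L2per_def set_integrable_cell)
qed

lemma nsq_nonneg: "nsq u \<ge> 0"
  unfolding nsq_def by (rule wip_self_nonneg[OF wt_nonneg])

lemma Hnorm_nsq: "Xnorm u = sqrt (L * nsq u)"
  by (simp add: Hnorm_wip nsq_def)

lemma lin_form_commute: "lin_form u v = lin_form v u"
  unfolding lin_form_def by (simp add: wip_commute[of alpha "ft u"] mult_ac)

lemma phi_X: "\<phi> \<in> X" and phi_cube: "(LINT x|cell L. (\<phi> x) ^ 3) = \<gamma>"
  using minimizer by (auto simp: is_arg_min_def Yset_def set_integral_cell)

lemma lin_form_comb:
  assumes "u \<in> X" "v \<in> X" "z \<in> X"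
  shows "lin_form (\<lambda>x. u x + t * v x) z = lin_form u z + t * lin_form v z"
proof -
  have "(LINT x|cell L. \<phi> x * (u x + t * v x) * z x) = (LINT x|cell L. \<phi> x * u x * z x + t * (\<phi> x * v x * z x))"
    by (simp add: algebra_simps)
  also have "\<dots> = (LINT x|cell L. \<phi> x * u x * z x) + t * (LINT x|cell L. \<phi> x * v x * z x)"
    using assms phi_X X_product3 by (subst Bochner_Integration.integral_add) auto
  finally show ?thesis
    unfolding lin_form_def X_comb(2)[OF assms(1,2)]
    using X_ell(2)[OF assms(1)] X_ell(2)[OF assms(2)] X_ell(2)[OF assms(3)]
    by (simp add: wip_comb_left[OF alpha_nonneg] algebra_simps)
qed

lemma lin_form_comb_right:
  assumes "u \<in> X" "v \<in> X" "z \<in> X"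
  shows "lin_form z (\<lambda>x. u x + t * v x) = lin_form z u + t * lin_form z v"
  using lin_form_comb[OF assms] by (simp add: lin_form_commute[of z])

lemma lin_form_comb_self:
  assumes "u \<in> X" "v \<in> X"
  shows "lin_form (\<lambda>x. u x + t * v x) (\<lambda>x. u x + t * v x) = lin_form u u + 2 * t * lin_form u v + t\<^sup>2 * lin_form v v"
  using assms X_comb(1)[OF assms]
  by (simp add: lin_form_comb lin_form_comb_right lin_form_commute[of v u] power2_eq_square algebra_simps)

text \<open>A square-integrable derivative makes the Fourier series of the wave absolutely convergent.\<close>

lemma phi_bounded: "\<exists>b\<ge>0. AE x in cell L. \<bar>\<phi> x\<bar> \<le> b"
proof -
  let ?c = "ft \<phi>"
  have psi: "\<psi> \<in> L2per L" "\<And>k. ft \<psi> k = \<i> * of_real (2 * pi * of_int k / L) * ?c k"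
    using deriv by (auto simp: has_per_deriv_def)
  have "ft \<psi> \<in> ell2w (\<lambda>_. 1)" by (rule Bessel_ell2[OF L L2perD(2,4)[OF psi(1)]])
  then have "(\<lambda>k. (cmod (ft \<psi> k))\<^sup>2) summable_on UNIV" by (simp add: ell2w_def)
  then have "(\<lambda>k. (L / (2 * pi))\<^sup>2 * (cmod (ft \<psi> k))\<^sup>2) summable_on UNIV"
    by (rule summable_on_cmult_right)
  moreover have "(L / (2 * pi))\<^sup>2 * (cmod (ft \<psi> k))\<^sup>2 = (of_int k)\<^sup>2 * (cmod (?c k))\<^sup>2" for k
    using L by (simp add: psi(2) norm_mult power_mult_distrib norm_divide power_divide)
  ultimately have s1: "(\<lambda>k. (of_int k)\<^sup>2 * (cmod (?c k))\<^sup>2) summable_on UNIV" by simp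
  have s2: "(\<lambda>k. (cmod (?c k))\<^sup>2) summable_on UNIV"
    using X_ell(4)[OF phi_X] by (simp add: ell2w_def)
  have "(\<lambda>k. cmod (?c k)) summable_on UNIV"
  proof (rule summable_on_comparison_test)
    show "(\<lambda>k. 1 / (1 + (of_int k)\<^sup>2) + ((cmod (?c k))\<^sup>2 + (of_int k)\<^sup>2 * (cmod (?c k))\<^sup>2)) summable_on UNIV"
      by (intro summable_on_add s1 s2 summable_on_int_inverse_squares)
    fix k :: int
    have pos: "1 + (real_of_int k)\<^sup>2 > 0" by (intro add_pos_nonneg) auto
    let ?q = "sqrt (1 + (real_of_int k)\<^sup>2)"
    have "cmod (?c k) = (1 / ?q) * (?q * cmod (?c k))" using pos by simp
    also have "\<dots> \<le> (1 / ?q)\<^sup>2 + (?q * cmod (?c k))\<^sup>2"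
    proof -
      have amgm: "x * y \<le> x\<^sup>2 + y\<^sup>2" if "x \<ge> 0" "y \<ge> 0" for x y :: real
        using sum_squares_bound[of x y] mult_nonneg_nonneg[OF that] by linarith
      show ?thesis by (rule amgm) (use pos in auto)
    qed
    also have "\<dots> = 1 / (1 + (of_int k)\<^sup>2) + ((cmod (?c k))\<^sup>2 + (of_int k)\<^sup>2 * (cmod (?c k))\<^sup>2)"
      using pos by (simp add: power_divide power_mult_distrib algebra_simps)
    finally show "cmod (?c k) \<le> 1 / (1 + (of_int k)\<^sup>2) + ((cmod (?c k))\<^sup>2 + (of_int k)\<^sup>2 * (cmod (?c k))\<^sup>2)" .
  qed simp
  then have abs: "(\<lambda>k. cmod (?c k)) summable_on UNIV" .
  define b where "b = (\<Sum>\<^sub>\<infinity>k. cmod (?c k))"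
  have pb: "\<bar>psum L ?c n x\<bar> \<le> b" for n x
  proof -
    have "\<bar>psum L ?c n x\<bar> \<le> cmod (\<Sum>k\<in>freq_ball n. ?c k * wave L k x)"
      unfolding psum_def by (rule abs_Re_le_cmod)
    also have "\<dots> \<le> (\<Sum>k\<in>freq_ball n. cmod (?c k))"
      by (rule order_trans[OF norm_sum]) (simp add: norm_mult)
    also have "\<dots> \<le> b" unfolding b_def by (intro finite_sum_le_infsum abs) auto
    finally show ?thesis .
  qed
  obtain G where ae: "AE x in cell L. (\<lambda>n. psum L ?c n x) \<longlonglongrightarrow> \<phi> x \<and> (\<forall>n. \<bar>psum L ?c n x\<bar> \<le> G x) \<and> \<bar>\<phi> x\<bar> \<le> G x"
    using Hper_dominated_series[OF L exponent] phi_X by meson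
  have "AE x in cell L. \<bar>\<phi> x\<bar> \<le> b"
    using ae
  proof eventually_elim
    case (elim x)
    then show ?case by (intro LIMSEQ_le_const2[OF tendsto_rabs]) (use pb in auto)
  qed
  moreover have "b \<ge> 0" unfolding b_def by (intro infsum_nonneg) auto
  ultimately show ?thesis by blast
qed


lemma AE_bounded_square_integrable:
  fixes f :: "real \<Rightarrow> real"
  assumes "f \<in> borel_measurable borel" "AE x in cell L. \<bar>f x\<bar> \<le> B"
  shows "integrable (cell L) (\<lambda>x. (f x)\<^sup>2)"
proof (rule finite_measure.integrable_const_bound[OF finite_measure_cell, of "\<lambda>x. (f x)\<^sup>2" "B\<^sup>2"])
  note [measurable] = borel_measurable_cell[OF assms(1)]
  show "(\<lambda>x. (f x)\<^sup>2) \<in> borel_measurable (cell L)" by measurable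
  show "AE x in cell L. norm ((f x)\<^sup>2) \<le> B\<^sup>2"
    using assms(2)
  proof eventually_elim
    case (elim x)
    then show ?case using power_mono[OF elim abs_ge_zero, of 2] by simp
  qed
qed

lemma phi_square_L2: "(\<lambda>x. (\<phi> x)\<^sup>2 / 2) \<in> borel_measurable borel" "integrable (cell L) (\<lambda>x. ((\<phi> x)\<^sup>2 / 2)\<^sup>2)"
proof -
  note [measurable] = XL2(2)[OF phi_X]
  show m: "(\<lambda>x. (\<phi> x)\<^sup>2 / 2) \<in> borel_measurable borel" by measurable
  obtain b where b: "AE x in cell L. \<bar>\<phi> x\<bar> \<le> b" using phi_bounded by blast
  have "AE x in cell L. \<bar>(\<phi> x)\<^sup>2 / 2\<bar> \<le> b\<^sup>2"
    using b
  proof eventually_elim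
    case (elim x)
    have "(\<phi> x)\<^sup>2 \<le> b\<^sup>2" using power_mono[OF elim abs_ge_zero, of 2] by simp
    moreover have "\<bar>(\<phi> x)\<^sup>2 / 2\<bar> = (\<phi> x)\<^sup>2 / 2" by simp
    ultimately show ?case using zero_le_power2[of b] by linarith
  qed
  then show "integrable (cell L) (\<lambda>x. ((\<phi> x)\<^sup>2 / 2)\<^sup>2)" by (rule AE_bounded_square_integrable[OF m])
qed

lemma phi_mult_L2:
  assumes "h \<in> X"
  shows "(\<lambda>x. \<phi> x * h x) \<in> borel_measurable borel" "integrable (cell L) (\<lambda>x. (\<phi> x * h x)\<^sup>2)"
proof -
  note [measurable] = XL2(2)[OF phi_X] XL2(2)[OF assms]
  show m: "(\<lambda>x. \<phi> x * h x) \<in> borel_measurable borel" by measurable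
  obtain b where b: "AE x in cell L. \<bar>\<phi> x\<bar> \<le> b" using phi_bounded by blast
  show "integrable (cell L) (\<lambda>x. (\<phi> x * h x)\<^sup>2)"
  proof (rule Bochner_Integration.integrable_bound)
    show "integrable (cell L) (\<lambda>x. b\<^sup>2 * (h x)\<^sup>2)" using XL2(4)[OF assms] by simp
    show "(\<lambda>x. (\<phi> x * h x)\<^sup>2) \<in> borel_measurable (cell L)" by (rule borel_measurable_cell) measurable
    show "AE x in cell L. norm ((\<phi> x * h x)\<^sup>2) \<le> norm (b\<^sup>2 * (h x)\<^sup>2)"
      using b
    proof eventually_elim
      case (elim x)
      have "(\<phi> x)\<^sup>2 \<le> b\<^sup>2" using power_mono[OF elim abs_ge_zero, of 2] by simp
      then show ?case by (simp add: power_mult_distrib mult_right_mono)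
    qed
  qed
qed

text \<open>The potential is controlled by the unweighted norm, in which bounded sequences of \<open>X\<close> are compact.\<close>

lemma potential_bound:
  assumes b: "AE x in cell L. \<bar>\<phi> x\<bar> \<le> b" and h: "h \<in> X"
  shows "\<bar>LINT x|cell L. \<phi> x * h x * h x\<bar> \<le> b * (L * l2ip (ft h) (ft h))"
proof -
  have "\<bar>LINT x|cell L. \<phi> x * h x * h x\<bar> \<le> (LINT x|cell L. \<bar>\<phi> x * h x * h x\<bar>)" by (rule integral_abs_bound)
  also have "\<dots> \<le> (LINT x|cell L. b * (h x)\<^sup>2)"
  proof (rule integral_mono_AE)
    show "AE x in cell L. \<bar>\<phi> x * h x * h x\<bar> \<le> b * (h x)\<^sup>2"
      using b
    proof eventually_elim
      case (elim x)
      from mult_right_mono[OF elim, of "(h x)\<^sup>2"] show ?case by (simp add: abs_mult power2_eq_square mult.assoc)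
    qed
  qed (use X_product3[OF phi_X h h] XL2(4)[OF h] in auto)
  finally show ?thesis using integral_sq[OF h] by simp
qed

lemma alpha_form_eq_integral:
  assumes u: "u \<in> X" and v: "v \<in> X" and f: "f \<in> borel_measurable borel" "integrable (cell L) (\<lambda>x. (f x)\<^sup>2)"
    and eq: "\<And>k. of_real (alpha k) * ft u k = ft f k"
  shows "L * wip alpha (ft u) (ft v) = (LINT x|cell L. f x * v x)"
proof -
  have "wip alpha (ft u) (ft v) = l2ip (ft f) (ft v)"
    unfolding wip_def eq[symmetric] by (intro infsum_cong) (simp add: algebra_simps)
  then show ?thesis using Parseval(2)[OF L exponent v f] by simp
qed

lemma fcoeff_half: "ft (\<lambda>x. f x / 2) k = ft f k / 2"
proof -
  have "(LINT x|cell L. of_real (f x / 2) * wave L (-k) x) = (LINT x|cell L. (of_real (f x) * wave L (-k) x) / 2)"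
    by simp
  also have "\<dots> = (LINT x|cell L. of_real (f x) * wave L (-k) x) / 2" by (rule integral_divide_zero)
  finally show ?thesis by (simp add: fcoeff_wave)
qed

lemma alpha_phi: "of_real (alpha k) * ft \<phi> k = ft (\<lambda>x. (\<phi> x)\<^sup>2 / 2) k"
  using multiplier[unfolded wave_equation_def, rule_format, of k]
  unfolding fcoeff_half by (simp add: mult_coeff_def alpha_def algebra_simps)

lemma wave_weak:
  "v \<in> X \<Longrightarrow> L * wip alpha (ft \<phi>) (ft v) = (LINT x|cell L. (\<phi> x)\<^sup>2 / 2 * v x)"
  by (rule alpha_form_eq_integral[OF phi_X _ phi_square_L2 alpha_phi])

lemma const_weak:
  assumes "v \<in> X"
  shows "L * wip alpha (ft (\<lambda>x. 1)) (ft v) = (LINT x|cell L. (\<omega> - 1) * v x)"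
proof (rule alpha_form_eq_integral[OF const_X(1) assms])
  show "integrable (cell L) (\<lambda>x. (\<omega> - 1)\<^sup>2)" using XL2(4)[OF const_X(1)] .
  show "of_real (alpha k) * ft (\<lambda>x. 1) k = ft (\<lambda>x. \<omega> - 1) k" for k
    by (simp add: const_X(2) alpha_def tw_0)
qed simp

text \<open>The factor \<open>1\<close> gives \<open>\<Psi>\<close> the shape of the linear combinations for which the forms are expanded.\<close>

definition Psi :: "real \<Rightarrow> real" where "Psi x = 1 + 1 * \<phi> x"

text \<open>The linearised operator applied to \<open>1 + \<phi>\<close>, simplified with the wave equation.\<close>

definition op_Psi :: "real \<Rightarrow> real" where "op_Psi x = (\<omega> - 1) - \<phi> x - (\<phi> x)\<^sup>2 / 2"

lemma Psi_X: "Psi \<in> X" and fcoeff_Psi: "ft Psi = (\<lambda>k. ft (\<lambda>x. 1) k + of_real 1 * ft \<phi> k)"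
  unfolding Psi_def[abs_def] using X_comb[OF const_X(1)[of 1] phi_X, of 1] by auto

lemma op_Psi_L2: "op_Psi \<in> borel_measurable borel" "integrable (cell L) (\<lambda>x. (op_Psi x)\<^sup>2)"
proof -
  note [measurable] = XL2(2)[OF phi_X]
  show m: "op_Psi \<in> borel_measurable borel" unfolding op_Psi_def[abs_def] by measurable
  obtain b where b: "AE x in cell L. \<bar>\<phi> x\<bar> \<le> b" using phi_bounded by blast
  have "AE x in cell L. \<bar>op_Psi x\<bar> \<le> (\<omega> - 1) + b + b\<^sup>2 / 2"
    using b
  proof eventually_elim
    case (elim x)
    have "(\<phi> x)\<^sup>2 \<le> b\<^sup>2" using power_mono[OF elim abs_ge_zero, of 2] by simp
    then show ?case unfolding op_Psi_def using elim \<omega> zero_le_power2[of "\<phi> x"] by linarith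
  qed
  then show "integrable (cell L) (\<lambda>x. (op_Psi x)\<^sup>2)" by (rule AE_bounded_square_integrable[OF m])
qed

lemma lin_form_Psi:
  assumes v: "v \<in> X"
  shows "lin_form Psi v = (LINT x|cell L. op_Psi x * v x)"
proof -
  have i: "integrable (cell L) v" "integrable (cell L) (\<lambda>x. \<phi> x * v x)" "integrable (cell L) (\<lambda>x. \<phi> x * \<phi> x * v x)"
    using XL2(5)[OF v] X_product2[OF phi_X v] X_product3[OF phi_X phi_X v] by auto
  have "L * wip alpha (ft Psi) (ft v) = (LINT x|cell L. (\<omega> - 1) * v x) + (LINT x|cell L. (\<phi> x)\<^sup>2 / 2 * v x)"
    unfolding fcoeff_Psi wip_comb_left[OF alpha_nonneg X_ell(2)[OF const_X(1)] X_ell(2)[OF phi_X] X_ell(2)[OF v]]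
    using const_weak[OF v] wave_weak[OF v] by (simp add: algebra_simps)
  then have "lin_form Psi v = (LINT x|cell L. (\<omega> - 1) * v x) + (LINT x|cell L. (\<phi> x)\<^sup>2 / 2 * v x) - (LINT x|cell L. \<phi> x * Psi x * v x)"
    by (simp add: lin_form_def)
  also have "(LINT x|cell L. (\<omega> - 1) * v x) = (\<omega> - 1) * (LINT x|cell L. v x)" by simp
  also have "(LINT x|cell L. (\<phi> x)\<^sup>2 / 2 * v x) = 1/2 * (LINT x|cell L. \<phi> x * \<phi> x * v x)"
    unfolding integral_mult_right_zero[symmetric] by (intro Bochner_Integration.integral_cong) (auto simp: power2_eq_square)
  also have "(LINT x|cell L. \<phi> x * Psi x * v x) = (LINT x|cell L. \<phi> x * v x + \<phi> x * \<phi> x * v x)"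
    by (intro Bochner_Integration.integral_cong) (auto simp: Psi_def algebra_simps)
  also have "\<dots> = (LINT x|cell L. \<phi> x * v x) + (LINT x|cell L. \<phi> x * \<phi> x * v x)"
    by (rule Bochner_Integration.integral_add[OF i(2,3)])
  finally have A: "lin_form Psi v = (\<omega> - 1) * (LINT x|cell L. v x) - (LINT x|cell L. \<phi> x * v x) - 1/2 * (LINT x|cell L. \<phi> x * \<phi> x * v x)"
    by simp
  have "(LINT x|cell L. op_Psi x * v x) = (LINT x|cell L. (\<omega> - 1) * v x - \<phi> x * v x - 1/2 * (\<phi> x * \<phi> x * v x))"
    by (intro Bochner_Integration.integral_cong) (auto simp: op_Psi_def power2_eq_square algebra_simps)
  also have "\<dots> = (\<omega> - 1) * (LINT x|cell L. v x) - (LINT x|cell L. \<phi> x * v x) - 1/2 * (LINT x|cell L. \<phi> x * \<phi> x * v x)"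
    using i by (simp add: Bochner_Integration.integral_diff)
  finally show ?thesis using A by simp
qed

text \<open>The direction \<open>1 + \<phi>\<close> is where the size of the constraint enters: testing the wave equation
  against \<open>1\<close> turns the mean of \<open>\<phi>\<close> into a positive multiple of its square integral, and what is
  left is \<open>(\<omega> - 1) L - \<gamma>/2\<close> minus nonnegative terms.\<close>

lemma lin_form_Psi_Psi_neg: "lin_form Psi Psi < 0"
proof -
  have i: "integrable (cell L) \<phi>" "integrable (cell L) (\<lambda>x. (\<phi> x)\<^sup>2)" "integrable (cell L) (\<lambda>x. (\<phi> x) ^ 3)"
    using XL2(4,5)[OF phi_X] X_product3[OF phi_X phi_X phi_X] by (auto simp: power3_eq_cube)
  have one: "(LINT x|cell L. (1::real)) = L" using measure_cell[OF L] by simp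
  have "integrable (cell L) (\<lambda>x. 1::real)" using XL2(5)[OF const_X(1)] .
  note i = i this
  have mean: "(\<omega> - 1) * (LINT x|cell L. \<phi> x) = 1/2 * (LINT x|cell L. (\<phi> x)\<^sup>2)"
    using wave_weak[OF const_X(1)[of 1]] const_weak[OF phi_X]
    by (simp add: wip_commute[of alpha "ft \<phi>"])
  have "lin_form Psi Psi = (LINT x|cell L. op_Psi x * Psi x)" by (rule lin_form_Psi[OF Psi_X])
  also have "\<dots> = (LINT x|cell L. (\<omega> - 1) * 1 + (\<omega> - 2) * \<phi> x - 3/2 * (\<phi> x)\<^sup>2 - 1/2 * (\<phi> x) ^ 3)"
    by (intro Bochner_Integration.integral_cong)
       (auto simp: op_Psi_def Psi_def power2_eq_square power3_eq_cube algebra_simps)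
  also have "\<dots> = (\<omega> - 1) * L + (\<omega> - 2) * (LINT x|cell L. \<phi> x) - 3/2 * (LINT x|cell L. (\<phi> x)\<^sup>2) - 1/2 * \<gamma>"
  proof -
    note j = integrable_mult_right[OF i(4), of "\<omega> - 1"] integrable_mult_right[OF i(1), of "\<omega> - 2"]
      integrable_mult_right[OF i(2), of "3/2"] integrable_mult_right[OF i(3), of "1/2"]
    note j1 = Bochner_Integration.integrable_add[OF j(1,2)]
    note j2 = Bochner_Integration.integrable_diff[OF j1 j(3)]
    show ?thesis
      by (simp only: Bochner_Integration.integral_diff[OF j2 j(4)] Bochner_Integration.integral_diff[OF j1 j(3)]
          Bochner_Integration.integral_add[OF j(1,2)] integral_mult_right_zero one phi_cube)
  qed
  also have "\<dots> = (\<omega> - 1) * L - \<gamma> / 2 - (LINT x|cell L. \<phi> x) - (LINT x|cell L. (\<phi> x)\<^sup>2)"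
    using mean by (simp add: algebra_simps)
  also have "\<dots> < 0"
  proof -
    have sq: "(LINT x|cell L. (\<phi> x)\<^sup>2) \<ge> 0" by simp
    then have "(\<omega> - 1) * (LINT x|cell L. \<phi> x) \<ge> 0" using mean by linarith
    then have "(LINT x|cell L. \<phi> x) \<ge> 0" using \<omega> by (simp add: zero_le_mult_iff)
    moreover have "2 * ((\<omega> - 1) * L) < \<gamma>" using \<gamma>(2) by (simp only: mult.assoc)
    ultimately show ?thesis using sq by linarith
  qed
  finally show ?thesis .
qed

lemma functional_B_wip: "u \<in> X \<Longrightarrow> functional_B L \<theta> \<omega> u = 1/2 * (L * wip alpha (ft u) (ft u))"
proof -
  assume u: "u \<in> X"
  have "wip alpha (ft u) (ft u) = \<omega> * wip tw (ft u) (ft u) + (\<omega> - 1) * l2ip (ft u) (ft u)"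
    using wip_weight_comb[of tw "\<lambda>_. 1" "ft u" "ft u" \<omega> "\<omega> - 1"] X_ell[OF u] tw_nonneg
    by (simp add: alpha_def[abs_def])
  then have "L * wip alpha (ft u) (ft u)
      = \<omega> * dual_pairing L (mult_coeff L \<theta> u) u + (\<omega> - 1) * (LINT x|cell L. (u x)\<^sup>2)"
    unfolding integral_sq[OF u] dual_pairing_wip[OF tw_nonneg X_ell(3)[OF u]] by (simp only: distrib_left mult.left_commute)
  then show ?thesis by (simp add: functional_B_def set_integral_cell)
qed

text \<open>Scaling a competitor back to the constraint surface bounds \<open>B\<close> from below by the two-thirds power of
  the cubic integral; the second-order expansion along \<open>\<phi> + t h\<close> is the claimed inequality.\<close>

lemma lin_form_nonneg_on_tangent_space:
  assumes h: "h \<in> X" and tang: "(LINT x|cell L. (\<phi> x)\<^sup>2 / 2 * h x) = 0"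
  shows "lin_form h h \<ge> 0"
proof -
  define A where "A = L * wip alpha (ft h) (ft h)"
  define a where "a = (LINT x|cell L. \<phi> x * h x * h x)"
  define b where "b = (LINT x|cell L. h x * h x * h x)"
  have pp: "L * wip alpha (ft \<phi>) (ft \<phi>) = \<gamma> / 2"
    unfolding wave_weak[OF phi_X] phi_cube[symmetric] by (simp add: power2_eq_square power3_eq_cube)
  have Bphi: "functional_B L \<theta> \<omega> \<phi> = \<gamma> / 4" using functional_B_wip[OF phi_X] pp by simp
  have B: "functional_B L \<theta> \<omega> (\<lambda>x. \<phi> x + t * h x) = \<gamma> / 4 + t\<^sup>2 * A / 2" for t
  proof -
    have "L * wip alpha (ft \<phi>) (ft h) = 0" using wave_weak[OF h] tang by simp
    then have ph: "wip alpha (ft \<phi>) (ft h) = 0" using L by simp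
    show ?thesis
      unfolding functional_B_wip[OF X_comb(1)[OF phi_X h]] X_comb(2)[OF phi_X h]
        wip_comb_self[OF alpha_nonneg X_ell(2)[OF phi_X] X_ell(2)[OF h]] ph A_def
      using pp by (simp add: algebra_simps)
  qed
  have cube: "(LINT x|cell L. (\<phi> x + t * h x) ^ 3) = \<gamma> + 3 * t\<^sup>2 * a + t ^ 3 * b" for t
  proof -
    have "(LINT x|cell L. (\<phi> x + t * h x) ^ 3)
      = (LINT x|cell L. (\<phi> x * \<phi> x * \<phi> x + (3 * t) * (\<phi> x * \<phi> x * h x)) + ((3 * t\<^sup>2) * (\<phi> x * h x * h x) + t ^ 3 * (h x * h x * h x)))"
      by (intro Bochner_Integration.integral_cong) (auto simp: power2_eq_square power3_eq_cube algebra_simps)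
    also have "\<dots> = (LINT x|cell L. \<phi> x * \<phi> x * \<phi> x) + (3 * t) * (LINT x|cell L. \<phi> x * \<phi> x * h x) + (3 * t\<^sup>2) * a + t ^ 3 * b"
      unfolding a_def b_def using X_product3 phi_X h by simp
    also have "(LINT x|cell L. \<phi> x * \<phi> x * \<phi> x) = \<gamma>" using phi_cube by (simp add: power3_eq_cube)
    also have "(LINT x|cell L. \<phi> x * \<phi> x * h x) = 2 * (LINT x|cell L. (\<phi> x)\<^sup>2 / 2 * h x)"
      unfolding integral_mult_right_zero[symmetric] by (intro Bochner_Integration.integral_cong) (auto simp: power2_eq_square)
    finally show ?thesis using tang by simp
  qed
  have scaled: "c\<^sup>2 * (\<gamma> / 4) ^ 3 \<le> \<gamma>\<^sup>2 * (functional_B L \<theta> \<omega> u) ^ 3"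
    if u: "u \<in> X" and c: "c = (LINT x|cell L. (u x) ^ 3)" "c > 0" for u c
  proof -
    define r where "r = root 3 (\<gamma> / c)"
    have r3: "r ^ 3 * c = \<gamma>" using c(2) \<gamma>(1) by (simp add: r_def)
    \<comment> \<open>the multiple \<open>r u\<close>, written as a linear combination in \<open>X\<close>\<close>
    let ?v = "\<lambda>x. u x + (r - 1) * u x"
    have v: "?v \<in> X" by (rule X_comb(1)[OF u u])
    have "(LINT x|cell L. (?v x) ^ 3) = (LINT x|cell L. r ^ 3 * (u x) ^ 3)"
      by (intro Bochner_Integration.integral_cong) (auto simp: algebra_simps power_mult_distrib)
    also have "\<dots> = \<gamma>" using r3 c by simp
    finally have "?v \<in> Yset L (m1/2) \<gamma>" using v by (simp add: Yset_def set_integral_cell)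
    then have "\<gamma> / 4 \<le> functional_B L \<theta> \<omega> ?v"
      using minimizer Bphi unfolding is_arg_min_def by (metis not_le)
    also have "\<dots> = r\<^sup>2 * functional_B L \<theta> \<omega> u"
      unfolding functional_B_wip[OF v] functional_B_wip[OF u] X_comb(2)[OF u u]
        wip_comb_self[OF alpha_nonneg X_ell(2)[OF u] X_ell(2)[OF u]]
      by (simp add: power2_eq_square algebra_simps)
    finally have "(\<gamma> / 4) ^ 3 \<le> (r\<^sup>2 * functional_B L \<theta> \<omega> u) ^ 3" using \<gamma> by (intro power_mono) auto
    then have "c\<^sup>2 * (\<gamma> / 4) ^ 3 \<le> c\<^sup>2 * (r\<^sup>2 * functional_B L \<theta> \<omega> u) ^ 3" by (intro mult_left_mono) auto
    also have "\<dots> = (r ^ 3 * c)\<^sup>2 * (functional_B L \<theta> \<omega> u) ^ 3"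
      by (simp add: power2_eq_square eval_nat_numeral algebra_simps)
    finally show ?thesis unfolding r3 .
  qed
  have "a / \<gamma> \<le> A / \<gamma>"
  proof (rule second_variation_scalar[where b = "b / \<gamma>"])
    fix t
    define c where "c = \<gamma> + 3 * t\<^sup>2 * a + t ^ 3 * b"
    have c: "1 + 3 * t\<^sup>2 * (a / \<gamma>) + t ^ 3 * (b / \<gamma>) = c / \<gamma>" using \<gamma> by (simp add: c_def field_simps)
    assume "1 + 3 * t\<^sup>2 * (a / \<gamma>) + t ^ 3 * (b / \<gamma>) > 0"
    then have c0: "c > 0" unfolding c using \<gamma> by (simp add: zero_less_divide_iff)
    have "c\<^sup>2 * (\<gamma> / 4) ^ 3 \<le> \<gamma>\<^sup>2 * (\<gamma> / 4 + t\<^sup>2 * A / 2) ^ 3"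
      using scaled[OF X_comb(1)[OF phi_X h, of t], of c] c0 cube[of t] B[of t] by (simp add: c_def)
    also have "\<gamma> / 4 + t\<^sup>2 * A / 2 = (\<gamma> / 4) * (1 + 2 * t\<^sup>2 * (A / \<gamma>))" using \<gamma> by (simp add: field_simps)
    finally have "(\<gamma> / 4) ^ 3 * c\<^sup>2 \<le> (\<gamma> / 4) ^ 3 * (\<gamma>\<^sup>2 * (1 + 2 * t\<^sup>2 * (A / \<gamma>)) ^ 3)"
      by (simp only: power_mult_distrib mult_ac)
    then have "c\<^sup>2 \<le> \<gamma>\<^sup>2 * (1 + 2 * t\<^sup>2 * (A / \<gamma>)) ^ 3" using \<gamma> by (subst (asm) mult_le_cancel_left_pos) auto
    then show "(1 + 3 * t\<^sup>2 * (a / \<gamma>) + t ^ 3 * (b / \<gamma>))\<^sup>2 \<le> (1 + 2 * t\<^sup>2 * (A / \<gamma>)) ^ 3"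
      unfolding c using \<gamma> by (simp add: power_divide field_simps)
  qed
  then have "a \<le> A" using \<gamma> by (simp add: divide_le_cancel)
  then show ?thesis by (simp add: lin_form_def A_def a_def)
qed

end

section \<open>Coercivity modulo translations\<close>

lemma wip_finite_support:
  assumes "finite S" "\<And>k. k \<notin> S \<Longrightarrow> b k = 0"
  shows "wip \<beta> a b = (\<Sum>k\<in>S. \<beta> k * Re (a k * cnj (b k)))"
proof -
  have "wip \<beta> a b = (\<Sum>\<^sub>\<infinity>k\<in>S. \<beta> k * Re (a k * cnj (b k)))"
    unfolding wip_def by (rule infsum_cong_neutral) (use assms(2) in auto)
  then show ?thesis using assms(1) by simp
qed

context constrained_wave
begin

text \<open>Otherwise \<open>h\<close> and \<open>\<Psi>\<close> would span a plane on which the form is negative definite, and such a plane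
  meets the tangent hyperplane \<open>\<integral>\<phi>\<^sup>2v = 0\<close> in a nonzero vector.\<close>

lemma lin_form_nonneg_orthogonal:
  assumes h: "h \<in> X" and orth: "lin_form h Psi = 0"
  shows "lin_form h h \<ge> 0"
proof (rule ccontr)
  assume neg: "\<not> lin_form h h \<ge> 0"
  let ?l = "\<lambda>v. (LINT x|cell L. (\<phi> x)\<^sup>2 / 2 * v x)"
  have lh: "?l h \<noteq> 0" using lin_form_nonneg_on_tangent_space[OF h] neg by blast
  define t where "t = - ?l Psi / ?l h"
  let ?z = "\<lambda>x. Psi x + t * h x"
  have z: "?z \<in> X" by (rule X_comb(1)[OF Psi_X h])
  have "?l ?z = (LINT x|cell L. (\<phi> x)\<^sup>2 / 2 * Psi x + t * ((\<phi> x)\<^sup>2 / 2 * h x))"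
    by (intro Bochner_Integration.integral_cong) (auto simp: algebra_simps)
  also have "\<dots> = ?l Psi + t * ?l h"
    by (subst Bochner_Integration.integral_add[OF Parseval(1)[OF L exponent Psi_X phi_square_L2]
          integrable_mult_right[OF Parseval(1)[OF L exponent h phi_square_L2]]])
       (simp only: integral_mult_right_zero)
  also have "\<dots> = 0" using lh by (simp add: t_def)
  finally have "lin_form ?z ?z \<ge> 0" by (rule lin_form_nonneg_on_tangent_space[OF z])
  moreover have "lin_form ?z ?z = lin_form Psi Psi + t\<^sup>2 * lin_form h h"
    using lin_form_comb_self[OF Psi_X h, of t] orth lin_form_commute[of h Psi] by simp
  moreover have "t\<^sup>2 * lin_form h h \<le> 0" using neg by (simp add: mult_le_0_iff)
  ultimately show False using lin_form_Psi_Psi_neg by linarith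
qed

text \<open>Cauchy--Schwarz for the form restricted to the complement of \<open>\<Psi>\<close>, where it is nonnegative; every \<open>v\<close> lies
  in this complement up to a multiple of \<open>\<Psi>\<close>.\<close>

lemma null_vector_in_radical:
  assumes h: "h \<in> X" "lin_form h Psi = 0" "lin_form h h = 0" and v: "v \<in> X"
  shows "lin_form h v = 0"
proof -
  define t where "t = - lin_form v Psi / lin_form Psi Psi"
  let ?v = "\<lambda>x. v x + t * Psi x"
  have v0: "?v \<in> X" by (rule X_comb(1)[OF v Psi_X])
  have o: "lin_form ?v Psi = 0"
    unfolding lin_form_comb[OF v Psi_X Psi_X] using lin_form_Psi_Psi_neg by (simp add: t_def)
  have hv: "lin_form ?v h = lin_form h v"
    using lin_form_comb[OF v Psi_X h(1), of t] h(2) lin_form_commute[of Psi h] lin_form_commute[of v h] by simp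
  have "(lin_form ?v h)\<^sup>2 \<le> lin_form ?v ?v * lin_form h h"
  proof (rule nonneg_quadratic_imp_discriminant)
    fix r
    have "lin_form (\<lambda>x. ?v x + r * h x) (\<lambda>x. ?v x + r * h x) \<ge> 0"
    proof (rule lin_form_nonneg_orthogonal)
      show "(\<lambda>x. ?v x + r * h x) \<in> X" by (rule X_comb(1)[OF v0 h(1)])
      show "lin_form (\<lambda>x. ?v x + r * h x) Psi = 0" using lin_form_comb[OF v0 h(1) Psi_X, of r] o h(2) by simp
    qed
    then show "0 \<le> lin_form ?v ?v + 2 * r * lin_form ?v h + r\<^sup>2 * lin_form h h"
      unfolding lin_form_comb_self[OF v0 h(1)] .
  qed
  then show ?thesis unfolding hv h(3) by simp
qed

text \<open>The derivative of the wave spans the kernel and therefore lies in the domain of the operator. This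
  regularity lets the orthogonality condition pass to limits in \<open>L\<^sup>2\<close>.\<close>

lemma psi_facts:
  shows psi_X: "\<psi> \<in> X" and psi_m1: "ft \<psi> \<in> ell2w (wt m1)"
    and fcoeff_psi: "ft \<psi> k = \<i> * of_real (2 * pi * of_int k / L) * ft \<phi> k"
proof -
  have psi: "\<psi> \<in> L2per L" "\<And>k. ft \<psi> k = \<i> * of_real (2 * pi * of_int k / L) * ft \<phi> k"
    using deriv by (auto simp: has_per_deriv_def)
  have "\<psi> \<in> per_span L \<psi>" unfolding per_span_def using psi(1) by (auto intro!: exI[of _ 1])
  then have H: "\<psi> \<in> Hper L m1" unfolding kernel[symmetric] lin_op_ker_def by blast
  then show m: "ft \<psi> \<in> ell2w (wt m1)" by (rule HperD(2))
  have "w k \<le> 1 * wt m1 k" for k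
    unfolding wt_def using m1 by (simp add: powr_mono)
  from ell2w_mono[OF m wt_nonneg this] show "\<psi> \<in> X" using psi(1) by (simp add: Hper_iff)
  show "ft \<psi> k = \<i> * of_real (2 * pi * of_int k / L) * ft \<phi> k" by (rule psi(2))
qed

lemma wt_m1: "wt m1 k = (w k)\<^sup>2"
  unfolding wt_def by (simp add: power2_eq_square powr_add[symmetric])

lemma weighted_psi_ell2: "(\<lambda>k. of_real (w k) * ft \<psi> k) \<in> ell2w (\<lambda>_. 1)"
  using psi_m1 by (simp add: ell2w_def wt_m1 norm_mult power_mult_distrib wt_nonneg)

text \<open>Testing against functions with one pair of frequencies turns a vector of the radical into an
  element of the kernel of the operator; the equation itself then provides the missing regularity.\<close>

lemma radical_multiple_of_psi:
  assumes h: "h \<in> X" and rad: "\<And>v. v \<in> X \<Longrightarrow> lin_form h v = 0"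
  shows "\<exists>c::real. \<forall>k. ft h k = of_real c * ft \<psi> k"
proof -
  let ?p = "ft (\<lambda>x. \<phi> x * h x)"
  define d where "d k = of_real (alpha k) * ft h k - ?p k" for k
  have alpha_even: "alpha (-k) = alpha k" for k by (simp add: alpha_def \<theta>_even)
  have dsym: "d (-k) = cnj (d k)" for k
    by (simp add: d_def alpha_even fcoeff_uminus_index)
  have d0: "d k = 0" for k
  proof -
    \<comment> \<open>a real test function with the single pair of frequencies \<open>k\<close>, \<open>-k\<close> and coefficients taken from \<open>d\<close>\<close>
    define S where "S = {k, -k}"
    define c where "c j = (if j \<in> S then d j else 0)" for j
    have S: "finite S" "\<And>j. -j \<in> S \<longleftrightarrow> j \<in> S" by (auto simp: S_def)
    have csym: "c (-j) = cnj (c j)" for j using dsym[of j] S(2)[of j] by (simp add: c_def)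
    have cw: "c \<in> ell2w w"
      by (rule ell2w_finite_support) (auto intro!: finite_subset[OF _ S(1)] simp: c_def split: if_splits)
    obtain v where v: "v \<in> X" "ft v = c"
      using fcoeff_realization[OF L exponent cw csym] by blast
    have pv: "(LINT x|cell L. \<phi> x * h x * v x) = L * l2ip ?p c"
      using Parseval(2)[OF L exponent v(1) phi_mult_L2[OF h]] v(2) by simp
    have cS: "\<And>j. j \<notin> S \<Longrightarrow> c j = 0" by (simp add: c_def)
    have "0 = L * (wip alpha (ft h) c - l2ip ?p c)"
      using rad[OF v(1)] pv v(2) by (simp add: lin_form_def right_diff_distrib)
    then have "0 = wip alpha (ft h) c - l2ip ?p c" using L by simp
    also have "\<dots> = (\<Sum>j\<in>S. alpha j * Re (ft h j * cnj (c j)) - 1 * Re (?p j * cnj (c j)))"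
    proof -
      have "wip \<beta> a c = (\<Sum>j\<in>S. \<beta> j * Re (a j * cnj (c j)))" for \<beta> a
        by (rule wip_finite_support[OF S(1)]) (rule cS)
      then show ?thesis by (simp only: sum_subtractf)
    qed
    also have "\<dots> = (\<Sum>j\<in>S. (cmod (d j))\<^sup>2)"
    proof (rule sum.cong[OF refl])
      fix j assume "j \<in> S"
      then have "alpha j * Re (ft h j * cnj (c j)) - 1 * Re (?p j * cnj (c j)) = Re (d j * cnj (d j))"
        by (simp add: c_def d_def algebra_simps)
      also have "\<dots> = (cmod (d j))\<^sup>2" by (metis Re_complex_of_real complex_norm_square)
      finally show "alpha j * Re (ft h j * cnj (c j)) - 1 * Re (?p j * cnj (c j)) = (cmod (d j))\<^sup>2" .
    qed
    finally have "(\<Sum>j\<in>S. (cmod (d j))\<^sup>2) = 0" by simp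
    then show "d k = 0" using S(1) by (subst (asm) sum_nonneg_eq_0_iff) (auto simp: S_def)
  qed
  then have eq: "of_real (alpha k) * ft h k = ?p k" for k using d0[of k] by (simp add: d_def)
  have "h \<in> lin_op_ker L \<theta> m1 \<omega> \<phi>"
    unfolding lin_op_ker_def
  proof (intro CollectI conjI allI)
    show "lin_op_coeff L \<theta> \<omega> \<phi> h k = 0" for k
      using eq[of k] by (simp add: lin_op_coeff_def mult_coeff_def alpha_def algebra_simps)
    have "ft h \<in> ell2w (wt m1)"
      unfolding ell2w_def mem_Collect_eq
    proof (rule summable_on_comparison_test)
      show "(\<lambda>k. coerc\<^sup>2 * (1 * (cmod (?p k))\<^sup>2)) summable_on UNIV"
        by (intro summable_on_cmult_right ell2wD Bessel_ell2[OF L phi_mult_L2[OF h]])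
      fix k
      have "wt m1 k \<le> (coerc * alpha k)\<^sup>2"
        unfolding wt_m1 by (intro power_mono w_le wt_nonneg)
      then have "wt m1 k * (cmod (ft h k))\<^sup>2 \<le> (coerc * alpha k)\<^sup>2 * (cmod (ft h k))\<^sup>2"
        by (intro mult_right_mono) auto
      also have "\<dots> = coerc\<^sup>2 * (1 * (cmod (?p k))\<^sup>2)"
        unfolding eq[symmetric] by (simp add: norm_mult power_mult_distrib)
      finally show "wt m1 k * (cmod (ft h k))\<^sup>2 \<le> coerc\<^sup>2 * (1 * (cmod (?p k))\<^sup>2)" .
    qed (simp add: wt_nonneg)
    then show "h \<in> Hper L m1" using HperD(1)[OF h] by (simp add: Hper_iff)
  qed
  then have "h \<in> per_span L \<psi>" unfolding kernel .
  then obtain c where c: "AE x in lborel. h x = c * \<psi> x" by (auto simp: per_span_def)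
  have ae: "AE x in cell L. h x = 0 + c * \<psi> x"
    unfolding AE_cell using c by eventually_elim simp
  note [measurable] = XL2(2)[OF psi_X]
  have "ft h k = ft (\<lambda>x. 0 + c * \<psi> x) k" for k
    by (rule fcoeff_cong_AE[OF XL2(2)[OF h] _ ae]) measurable
  then have "ft h k = of_real c * ft \<psi> k" for k
    using X_comb(2)[OF const_X(1)[of 0] psi_X, of c] by (simp add: const_X(2))
  then show ?thesis by blast
qed

definition Nneg :: real where "Nneg = - lin_form Psi Psi"

definition Qform :: "(real \<Rightarrow> real) \<Rightarrow> real" where
  "Qform h = lin_form h h + 2 / Nneg * (lin_form Psi h)\<^sup>2"

lemma Nneg_pos: "Nneg > 0" using lin_form_Psi_Psi_neg by (simp add: Nneg_def)

text \<open>The vector \<open>z = h + t\<Psi>\<close> with \<open>t = \<L>(\<Psi>,h)/N\<close> is orthogonal to \<open>\<Psi>\<close>, and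
  \<open>\<L>(z,z) = Q(h) - \<L>(\<Psi>,h)\<^sup>2/N\<close>.\<close>

lemma Qform_lower:
  assumes h: "h \<in> X"
  shows "Qform h \<ge> (lin_form Psi h)\<^sup>2 / Nneg"
proof -
  define t where "t = lin_form Psi h / Nneg"
  let ?z = "\<lambda>x. h x + t * Psi x"
  have z: "?z \<in> X" by (rule X_comb(1)[OF h Psi_X])
  have "lin_form ?z Psi = 0"
    unfolding lin_form_comb[OF h Psi_X Psi_X] lin_form_commute[of h Psi]
    using lin_form_Psi_Psi_neg by (simp add: t_def Nneg_def)
  then have "0 \<le> lin_form ?z ?z" by (rule lin_form_nonneg_orthogonal[OF z])
  also have "\<dots> = lin_form h h + 2 * t * lin_form Psi h - t\<^sup>2 * Nneg"
    unfolding lin_form_comb_self[OF h Psi_X] lin_form_commute[of h Psi] by (simp add: Nneg_def)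
  also have "\<dots> = lin_form h h + (lin_form Psi h)\<^sup>2 / Nneg"
    using Nneg_pos by (simp add: t_def power2_eq_square field_simps)
  finally show ?thesis by (simp add: Qform_def add_divide_distrib)
qed

lemma Qform_nonneg: "h \<in> X \<Longrightarrow> Qform h \<ge> 0"
  using Qform_lower[of h] Nneg_pos by (meson divide_nonneg_pos order_trans zero_le_power2)

lemma Qform_zero:
  assumes h: "h \<in> X" and Q: "Qform h \<le> 0"
  shows "lin_form Psi h = 0 \<and> (\<exists>c::real. \<forall>k. ft h k = of_real c * ft \<psi> k)"
proof -
  have "(lin_form Psi h)\<^sup>2 / Nneg \<le> 0" using Qform_lower[OF h] Q by linarith
  then have "(lin_form Psi h)\<^sup>2 \<le> 0" using Nneg_pos by (simp add: divide_le_0_iff)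
  then have P: "lin_form Psi h = 0" by simp
  then have "lin_form h h = 0" using Qform_nonneg[OF h] Q by (simp add: Qform_def)
  then show ?thesis
    using P radical_multiple_of_psi[OF h null_vector_in_radical[OF h]] lin_form_commute[of Psi h] by simp
qed

lemma scale_X:
  assumes h: "h \<in> X"
  shows "(\<lambda>x. h x + (r - 1) * h x) \<in> X"
    "nsq (\<lambda>x. h x + (r - 1) * h x) = r\<^sup>2 * nsq h"
    "Qform (\<lambda>x. h x + (r - 1) * h x) = r\<^sup>2 * Qform h"
    "wip w (ft (\<lambda>x. h x + (r - 1) * h x)) (ft \<psi>) = r * wip w (ft h) (ft \<psi>)"
proof -
  show "(\<lambda>x. h x + (r - 1) * h x) \<in> X" by (rule X_comb(1)[OF h h])
  show "nsq (\<lambda>x. h x + (r - 1) * h x) = r\<^sup>2 * nsq h"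
    unfolding nsq_def X_comb(2)[OF h h] wip_comb_self[OF wt_nonneg X_ell(1)[OF h] X_ell(1)[OF h]]
    by (simp add: power2_eq_square algebra_simps)
  show "wip w (ft (\<lambda>x. h x + (r - 1) * h x)) (ft \<psi>) = r * wip w (ft h) (ft \<psi>)"
    unfolding X_comb(2)[OF h h] wip_comb_left[OF wt_nonneg X_ell(1)[OF h] X_ell(1)[OF h] X_ell(1)[OF psi_X]]
    by (simp add: algebra_simps)
  have "lin_form Psi (\<lambda>x. h x + (r - 1) * h x) = r * lin_form Psi h"
    unfolding lin_form_comb_right[OF h h Psi_X] by (simp add: algebra_simps)
  moreover have "lin_form (\<lambda>x. h x + (r - 1) * h x) (\<lambda>x. h x + (r - 1) * h x) = r\<^sup>2 * lin_form h h"
    unfolding lin_form_comb_self[OF h h] by (simp add: power2_eq_square algebra_simps)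
  ultimately show "Qform (\<lambda>x. h x + (r - 1) * h x) = r\<^sup>2 * Qform h"
    by (simp add: Qform_def power_mult_distrib distrib_left mult.left_commute)
qed

lemma l2_limit_pairing:
  assumes e: "\<And>n. e n \<in> ell2w (\<lambda>_. 1)" "(\<lambda>n. l2ip (e n) (e n)) \<longlonglongrightarrow> 0" and a: "a \<in> ell2w (\<lambda>_. 1)"
  shows "(\<lambda>n. l2ip a (e n)) \<longlonglongrightarrow> 0"
proof (rule tendsto_0_le[where K=1])
  have "(\<lambda>n. sqrt (l2ip a a) * sqrt (l2ip (e n) (e n))) \<longlonglongrightarrow> sqrt (l2ip a a) * sqrt 0"
    by (intro tendsto_intros e(2))
  then show "(\<lambda>n. sqrt (l2ip a a) * sqrt (l2ip (e n) (e n))) \<longlonglongrightarrow> 0" by simp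
  show "\<forall>\<^sub>F n in sequentially. norm (l2ip a (e n)) \<le> norm (sqrt (l2ip a a) * sqrt (l2ip (e n) (e n))) * 1"
    using wip_Cauchy_Schwarz[OF _ a e(1)] wip_self_nonneg[of "\<lambda>_. 1"] by (intro always_eventually) auto
qed

text \<open>A minimising sequence for the quotient has a weakly convergent subsequence; the potential and the
  rank-one term pass to the limit by compactness, the leading term is lower semicontinuous. The limit is
  a null vector orthogonal to the kernel, hence zero, and then the leading term would tend to zero too.\<close>

lemma no_null_sequence:
  assumes H: "\<And>n. H n \<in> X" "\<And>n. nsq (H n) = 1" "\<And>n. wip w (ft (H n)) (ft \<psi>) = 0"
    and Q: "(\<lambda>n. Qform (H n)) \<longlonglongrightarrow> 0"
    and lim: "\<And>k. (\<lambda>n. ft (H n) k) \<longlonglongrightarrow> c k"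
  shows False
proof -
  let ?a = "\<lambda>n. ft (H n)"
  have nb: "wip w (?a n) (?a n) \<le> 1" for n using H(2)[of n] by (simp add: nsq_def)
  note conv = bounded_pointwise_imp_l2_convergent[OF w_ge_1 finite_w_sublevel X_ell(1)[OF H(1)] nb lim]
  have csym: "c (-k) = cnj (c k)" for k
  proof -
    have "(\<lambda>n. ?a n (-k)) \<longlonglongrightarrow> cnj (c k)" unfolding fcoeff_uminus_index by (intro tendsto_intros lim)
    then show ?thesis using lim[of "-k"] LIMSEQ_unique by blast
  qed
  obtain h where h: "h \<in> X" "ft h = c" using fcoeff_realization[OF L exponent conv(1) csym] by blast
  define e where "e n = (\<lambda>x. H n x + (-1) * h x)" for n
  have eX: "e n \<in> X" for n unfolding e_def by (rule X_comb(1)[OF H(1) h(1)])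
  have fe: "ft (e n) = (\<lambda>k. ?a n k - c k)" for n
    unfolding e_def X_comb(2)[OF H(1) h(1)] h(2) by simp
  have e0: "(\<lambda>n. l2ip (ft (e n)) (ft (e n))) \<longlonglongrightarrow> 0" unfolding fe by (rule conv(3))
  have He: "H n = (\<lambda>x. h x + 1 * e n x)" for n by (simp add: e_def)
  obtain b where b: "b \<ge> 0" "AE x in cell L. \<bar>\<phi> x\<bar> \<le> b" using phi_bounded by blast
  \<comment> \<open>the lower-order terms converge\<close>
  have pair0: "(\<lambda>n. LINT x|cell L. f x * e n x) \<longlonglongrightarrow> 0"
    if f: "f \<in> borel_measurable borel" "integrable (cell L) (\<lambda>x. (f x)\<^sup>2)" for f
  proof -
    have "(\<lambda>n. L * l2ip (ft f) (ft (e n))) \<longlonglongrightarrow> L * 0"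
      by (intro tendsto_intros l2_limit_pairing[OF X_ell(4)[OF eX] e0 Bessel_ell2[OF L f]])
    then show ?thesis using Parseval(2)[OF L exponent eX f] by simp
  qed
  have pot: "(\<lambda>n. LINT x|cell L. \<phi> x * H n x * H n x) \<longlonglongrightarrow> (LINT x|cell L. \<phi> x * h x * h x)"
  proof -
    have ee: "(\<lambda>n. LINT x|cell L. \<phi> x * e n x * e n x) \<longlonglongrightarrow> 0"
    proof (rule tendsto_0_le[where K=1])
      have "(\<lambda>n. b * (L * l2ip (ft (e n)) (ft (e n)))) \<longlonglongrightarrow> b * (L * 0)"
        by (intro tendsto_intros e0)
      then show "(\<lambda>n. b * (L * l2ip (ft (e n)) (ft (e n)))) \<longlonglongrightarrow> 0" by simp
      show "\<forall>\<^sub>F n in sequentially. norm (LINT x|cell L. \<phi> x * e n x * e n x)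
          \<le> norm (b * (L * l2ip (ft (e n)) (ft (e n)))) * 1"
        using potential_bound[OF b(2) eX] by (intro always_eventually allI) (smt (verit) real_norm_def mult_1_right)
    qed
    have "(LINT x|cell L. \<phi> x * H n x * H n x)
      = (LINT x|cell L. \<phi> x * h x * h x) + 2 * (LINT x|cell L. \<phi> x * h x * e n x) + (LINT x|cell L. \<phi> x * e n x * e n x)" for n
    proof -
      have "(LINT x|cell L. \<phi> x * H n x * H n x)
        = (LINT x|cell L. \<phi> x * h x * h x + 2 * (\<phi> x * h x * e n x) + \<phi> x * e n x * e n x)"
        unfolding He[of n] by (intro Bochner_Integration.integral_cong) (auto simp: e_def algebra_simps)
      then show ?thesis using X_product3 phi_X h(1) eX by simp
    qed
    moreover have "(\<lambda>n. (LINT x|cell L. \<phi> x * h x * h x) + 2 * (LINT x|cell L. \<phi> x * h x * e n x) + (LINT x|cell L. \<phi> x * e n x * e n x))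
      \<longlonglongrightarrow> (LINT x|cell L. \<phi> x * h x * h x) + 2 * 0 + 0"
      by (intro tendsto_intros ee pair0 phi_mult_L2 h(1))
    ultimately show ?thesis by simp
  qed
  have rk: "(\<lambda>n. lin_form Psi (H n)) \<longlonglongrightarrow> lin_form Psi h"
  proof -
    have "lin_form Psi (H n) = lin_form Psi h + (LINT x|cell L. op_Psi x * e n x)" for n
      unfolding He[of n] lin_form_comb_right[OF h(1) eX Psi_X] lin_form_Psi[OF eX] by simp
    moreover have "(\<lambda>n. lin_form Psi h + (LINT x|cell L. op_Psi x * e n x)) \<longlonglongrightarrow> lin_form Psi h + 0"
      by (intro tendsto_intros pair0 op_Psi_L2)
    ultimately show ?thesis by simp
  qed
  \<comment> \<open>the limit of the leading terms bounds the leading term of the limit, one finite set of frequencies at a time\<close>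
  define Z where "Z = (LINT x|cell L. \<phi> x * h x * h x) - 2 / Nneg * (lin_form Psi h)\<^sup>2"
  have lead: "(\<lambda>n. L * wip alpha (?a n) (?a n)) \<longlonglongrightarrow> Z"
  proof -
    have "L * wip alpha (?a n) (?a n) = Qform (H n) + (LINT x|cell L. \<phi> x * H n x * H n x) - 2 / Nneg * (lin_form Psi (H n))\<^sup>2" for n
      by (simp add: Qform_def lin_form_def)
    moreover have "(\<lambda>n. Qform (H n) + (LINT x|cell L. \<phi> x * H n x * H n x) - 2 / Nneg * (lin_form Psi (H n))\<^sup>2)
       \<longlonglongrightarrow> 0 + (LINT x|cell L. \<phi> x * h x * h x) - 2 / Nneg * (lin_form Psi h)\<^sup>2"
      by (intro tendsto_intros Q pot rk)
    ultimately show ?thesis by (simp add: Z_def)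
  qed
  have "(\<Sum>k\<in>F. alpha k * (cmod (c k))\<^sup>2) \<le> Z / L" if F: "finite F" for F
  proof -
    have "L * (\<Sum>k\<in>F. alpha k * (cmod (c k))\<^sup>2) \<le> Z"
    proof (rule LIMSEQ_le[OF _ lead])
      show "(\<lambda>n. L * (\<Sum>k\<in>F. alpha k * (cmod (?a n k))\<^sup>2)) \<longlonglongrightarrow> L * (\<Sum>k\<in>F. alpha k * (cmod (c k))\<^sup>2)"
        by (intro tendsto_intros lim)
      show "\<exists>N. \<forall>n\<ge>N. L * (\<Sum>k\<in>F. alpha k * (cmod (?a n k))\<^sup>2) \<le> L * wip alpha (?a n) (?a n)"
        using finite_sum_le_wip[OF alpha_nonneg X_ell(2)[OF H(1)] F] L by (intro exI[of _ 0] allI impI mult_left_mono) auto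
    qed
    then show ?thesis using L by (simp add: pos_le_divide_eq mult.commute)
  qed
  then have "wip alpha c c \<le> Z / L" by (rule wip_le_if_finite_sums_le(2)[OF alpha_nonneg])
  then have "L * wip alpha c c \<le> Z" using L by (simp add: pos_le_divide_eq mult.commute)
  then have "Qform h \<le> 0" by (simp add: Qform_def lin_form_def h(2) Z_def)
  from Qform_zero[OF h(1) this] obtain r :: real where Psi0: "lin_form Psi h = 0"
    and r: "\<And>k. c k = of_real r * ft \<psi> k" using h(2) by auto
  have "(\<lambda>n. l2ip (\<lambda>k. of_real (w k) * ft \<psi> k) (ft (e n))) \<longlonglongrightarrow> 0"
    by (rule l2_limit_pairing[OF X_ell(4)[OF eX] e0 weighted_psi_ell2])
  moreover have "l2ip (\<lambda>k. of_real (w k) * ft \<psi> k) (ft (e n)) = - wip w c (ft \<psi>)" for n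
  proof -
    have "l2ip (\<lambda>k. of_real (w k) * ft \<psi> k) (ft (e n)) = wip w (ft (e n)) (ft \<psi>)"
      by (subst wip_commute) (simp only: wip_scale_weight[of w])
    also have "\<dots> = wip w (?a n) (ft \<psi>) + (-1) * wip w c (ft \<psi>)"
      unfolding e_def X_comb(2)[OF H(1) h(1)] h(2)
      by (rule wip_comb_left[OF wt_nonneg X_ell(1)[OF H(1)] conv(1) X_ell(1)[OF psi_X]])
    finally show ?thesis using H(3) by simp
  qed
  ultimately have orth: "wip w c (ft \<psi>) = 0" using LIMSEQ_unique tendsto_const by fastforce
  have ce: "c = (\<lambda>k. ft \<psi> k + of_real (r - 1) * ft \<psi> k)" by (auto simp: r algebra_simps)
  have "wip w c c = r * wip w c (ft \<psi>)"
    by (subst (2) ce, subst wip_comb_right[OF wt_nonneg X_ell(1)[OF psi_X] X_ell(1)[OF psi_X] conv(1)])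
       (simp add: algebra_simps)
  then have c0: "c k = 0" for k using wip_self_eq_0D[OF wt_pos conv(1), of k] orth by simp
  have "l2ip c c = 0" by (simp add: wip_self c0)
  then have "(LINT x|cell L. \<phi> x * h x * h x) = 0" using potential_bound[OF b(2) h(1)] by (simp add: h(2))
  then have "Z = 0" by (simp add: Z_def Psi0)
  moreover have "L / coerc \<le> Z"
  proof (rule LIMSEQ_le_const[OF lead], intro exI[of _ 0] allI impI)
    fix n
    have "1 \<le> coerc * wip alpha (?a n) (?a n)"
      using wip_self_mono[OF X_ell(2)[OF H(1)] wt_nonneg w_le, of n] H(2)[of n] by (simp add: nsq_def)
    then show "L / coerc \<le> L * wip alpha (?a n) (?a n)"
      using L coerc_pos mult_left_mono[of 1 "coerc * wip alpha (?a n) (?a n)" L]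
      by (simp add: pos_divide_le_eq mult_ac)
  qed
  ultimately show False using L coerc_pos by (simp add: divide_le_0_iff)
qed

lemma coercivity:
  "\<exists>\<kappa>>0. \<forall>h\<in>X. wip w (ft h) (ft \<psi>) = 0 \<longrightarrow> \<kappa> * nsq h \<le> Qform h"
proof (rule ccontr)
  assume "\<not> ?thesis"
  then have "\<exists>h\<in>X. wip w (ft h) (ft \<psi>) = 0 \<and> Qform h < 1 / (real n + 1) * nsq h" for n
    by (metis not_le add_nonneg_pos of_nat_0_le_iff zero_less_divide_1_iff zero_less_one)
  then obtain G where G: "\<And>n. G n \<in> X" "\<And>n. wip w (ft (G n)) (ft \<psi>) = 0"
    "\<And>n. Qform (G n) < 1 / (real n + 1) * nsq (G n)" by metis
  have pos: "nsq (G n) > 0" for n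
  proof (rule ccontr)
    assume "\<not> nsq (G n) > 0"
    then have "nsq (G n) = 0" using nsq_nonneg[of "G n"] by linarith
    then show False using G(3)[of n] Qform_nonneg[OF G(1), of n] by simp
  qed
  define H where "H n = (\<lambda>x. G n x + (1 / sqrt (nsq (G n)) - 1) * G n x)" for n
  have r2: "(1 / sqrt (nsq (G n)))\<^sup>2 = 1 / nsq (G n)" for n using pos[of n] by (simp add: power_divide)
  have H: "H n \<in> X" "nsq (H n) = 1" "wip w (ft (H n)) (ft \<psi>) = 0" for n
    using scale_X[OF G(1), of n "1 / sqrt (nsq (G n))"] pos[of n] G(2)[of n] r2[of n] by (auto simp: H_def)
  have HQ: "Qform (H n) \<le> 1 / (real n + 1)" for n
  proof -
    have "Qform (H n) = Qform (G n) / nsq (G n)"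
      unfolding H_def scale_X(3)[OF G(1)] r2 by simp
    also have "\<dots> \<le> 1 / (real n + 1)" using G(3)[of n] pos[of n] by (simp add: pos_divide_le_eq less_imp_le)
    finally show ?thesis .
  qed
  have Q0: "(\<lambda>n. Qform (H n)) \<longlonglongrightarrow> 0"
  proof (rule tendsto_sandwich[of "\<lambda>_. 0" _ _ "\<lambda>n. 1 / (real n + 1)"])
    show "(\<lambda>n. 1 / (real n + 1)) \<longlonglongrightarrow> 0"
      using LIMSEQ_inverse_real_of_nat by (simp add: inverse_eq_divide add.commute)
  qed (use Qform_nonneg[OF H(1)] HQ in auto)
  have "cmod (ft (H n) k) \<le> 1" for n k
  proof -
    have "w k * (cmod (ft (H n) k))\<^sup>2 \<le> 1"
      using finite_sum_le_wip[OF wt_nonneg X_ell(1)[OF H(1)], of "{k}" n] H(2)[of n] by (simp add: nsq_def)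
    moreover have "1 * (cmod (ft (H n) k))\<^sup>2 \<le> w k * (cmod (ft (H n) k))\<^sup>2"
      by (intro mult_right_mono w_ge_1) auto
    ultimately have "(cmod (ft (H n) k))\<^sup>2 \<le> 1\<^sup>2" by simp
    then show ?thesis by (rule power2_le_imp_le) simp
  qed
  from bounded_coefficients_convergent_subseq[of "\<lambda>n. ft (H n)", OF this]
  obtain r c where r: "strict_mono (r :: nat \<Rightarrow> nat)" and lim: "\<And>k. (\<lambda>n. ft (H (r n)) k) \<longlonglongrightarrow> c k" by blast
  have "(\<lambda>n. Qform (H (r n))) \<longlonglongrightarrow> 0" using LIMSEQ_subseq_LIMSEQ[OF Q0 r] by (simp add: o_def)
  from no_null_sequence[OF H(1) H(2) H(3) this lim] show False .
qed

end

section \<open>A nearest translate\<close>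

lemma wave_derivative:
  assumes "L > 0"
  shows "((\<lambda>y. wave L k y) has_vector_derivative (\<i> * of_real (2 * pi * of_int k / L)) * wave L k y) (at y)"
proof -
  have "((\<lambda>y::real. exp (of_real y * (\<i> * of_real (2 * pi * of_int k / L)))) has_vector_derivative
      (\<i> * of_real (2 * pi * of_int k / L)) * exp (of_real y * (\<i> * of_real (2 * pi * of_int k / L)))) (at y)"
    using exp_scaleR_has_vector_derivative_right[of "\<i> * of_real (2 * pi * of_int k / L)" y UNIV]
    by (simp only: scaleR_conv_of_real mult.commute[of _ "\<i> * of_real (2 * pi * of_int k / L)"])
  moreover have "exp (of_real y * (\<i> * of_real (2 * pi * of_int k / L))) = wave L k y" for y
    by (simp add: wave_def cis_conv_exp mult_ac)
  ultimately show ?thesis by simp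
qed

text \<open>An enumeration of the integers turns the sum into a series that can be differentiated term by term.\<close>

lemma infsum_eq_suminf_int:
  fixes f :: "int \<Rightarrow> real"
  assumes "f summable_on UNIV"
  shows "summable (\<lambda>n. f (int_decode n))" "infsum f UNIV = (\<Sum>n. f (int_decode n))"
proof -
  have "(f has_sum infsum f UNIV) UNIV" using assms by simp
  then have "((\<lambda>n. f (int_decode n)) has_sum infsum f UNIV) UNIV"
    using has_sum_reindex_bij_betw[OF bij_int_decode, of f] by simp
  then have "(\<lambda>n. f (int_decode n)) sums infsum f UNIV" by (rule has_sum_imp_sums)
  then show "summable (\<lambda>n. f (int_decode n))" "infsum f UNIV = (\<Sum>n. f (int_decode n))"
    by (auto simp: sums_iff)
qed

context constrained_wave
begin

definition shift_coeff :: "real \<Rightarrow> (int \<Rightarrow> complex) \<Rightarrow> int \<Rightarrow> complex" where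
  "shift_coeff y a k = wave L k y * a k"

lemma norm_shift_coeff [simp]: "cmod (shift_coeff y a k) = cmod (a k)"
  by (simp add: shift_coeff_def norm_mult)

lemma shift_coeff_ell2w: "shift_coeff y a \<in> ell2w \<beta> \<longleftrightarrow> a \<in> ell2w \<beta>"
  by (simp add: ell2w_def)

lemma wip_shift_coeff: "wip \<beta> (shift_coeff y a) (shift_coeff y b) = wip \<beta> a b"
proof -
  have "shift_coeff y a k * cnj (shift_coeff y b k) = a k * cnj (b k)" for k
  proof -
    have "shift_coeff y a k * cnj (shift_coeff y b k) = (wave L k y * cnj (wave L k y)) * (a k * cnj (b k))"
      by (simp add: shift_coeff_def mult_ac)
    also have "wave L k y * cnj (wave L k y) = 1"
      by (simp add: cnj_wave wave_mult)
    finally show ?thesis by simp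
  qed
  then show ?thesis by (simp add: wip_def)
qed

lemma fcoeff_translate: "u \<in> L2per L \<Longrightarrow> ft (\<lambda>x. u (x + y)) = shift_coeff y (ft u)"
  using fcoeff_shift[of L u y, OF L] L2perD(1,5)[of u L] by (auto simp: shift_coeff_def)

lemma translate_L2:
  assumes "u \<in> L2per L"
  shows "(\<lambda>x. u (x + y)) \<in> L2per L"
proof -
  note [measurable] = L2perD(2)[OF assms]
  have "integrable (cell L) (\<lambda>x. (u (x + y))\<^sup>2)"
    by (rule integral_cell_shift(1)[OF L, of "\<lambda>x. (u x)\<^sup>2"]) (use L2perD(1,4)[OF assms] in auto)
  moreover have "u (x + L + y) = u (x + y)" for x
    using L2perD(1)[OF assms, of "x + y"] by (simp add: add_ac)
  ultimately show ?thesis by (auto simp: L2per_def set_integrable_cell)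
qed

lemma translate_X: "u \<in> X \<Longrightarrow> (\<lambda>x. u (x + y)) \<in> X"
  by (simp add: Hper_iff translate_L2 fcoeff_translate shift_coeff_ell2w)

lemma translate_cube:
  assumes "u \<in> X"
  shows "(LINT x|cell L. (u (x + y)) ^ 3) = (LINT x|cell L. (u x) ^ 3)"
  using X_product3[OF assms assms assms] XL2(1)[OF assms]
  by (intro integral_cell_shift(2)[OF L, of "\<lambda>x. (u x) ^ 3"]) (auto simp: power3_eq_cube)

lemma Hnorm_difference_translate:
  assumes u: "u \<in> X"
  shows "Xnorm (\<lambda>x. u x - \<phi> (x + y)) =
    sqrt (L * (nsq u + nsq \<phi> - 2 * wip w (ft u) (shift_coeff y (ft \<phi>))))"
proof -
  have T: "(\<lambda>x. \<phi> (x + y)) \<in> X" by (rule translate_X[OF phi_X])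
  have eq: "(\<lambda>x. u x - \<phi> (x + y)) = (\<lambda>x. u x + (-1) * \<phi> (x + y))" by auto
  have "nsq (\<lambda>x. u x - \<phi> (x + y)) = nsq u + nsq \<phi> - 2 * wip w (ft u) (shift_coeff y (ft \<phi>))"
    unfolding eq nsq_def X_comb(2)[OF u T] wip_comb_self[OF wt_nonneg X_ell(1)[OF u] X_ell(1)[OF T]]
    by (simp add: fcoeff_translate[OF HperD(1)[OF phi_X]] wip_shift_coeff)
  then show ?thesis by (simp only: Hnorm_nsq)
qed

text \<open>Differentiating \<open>\<phi>(\<cdot> + y)\<close> in \<open>y\<close> replaces its coefficients by those of \<open>\<psi>(\<cdot> + y)\<close>; the differentiated
  series is dominated by the product of two sequences in the weighted space.\<close>

lemma correlation_derivative:
  assumes u: "u \<in> X"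
  shows "((\<lambda>y. wip w (ft u) (shift_coeff y (ft \<phi>))) has_field_derivative
     wip w (ft u) (shift_coeff y (ft \<psi>))) (at y)"
proof -
  let ?a = "ft u"
  define f where "f k z = w k * Re (?a k * cnj (shift_coeff z (ft \<phi>) k))" for k z
  define f' where "f' k z = w k * Re (?a k * cnj (shift_coeff z (ft \<psi>) k))" for k z
  have df: "(f k has_field_derivative f' k z) (at z)" for k z
  proof -
    have "((\<lambda>y. wave L k y * ft \<phi> k) has_vector_derivative
       (\<i> * of_real (2 * pi * of_int k / L) * wave L k z) * ft \<phi> k) (at z)"
      by (intro has_vector_derivative_mult_left wave_derivative L)
    then have d: "((\<lambda>y. shift_coeff y (ft \<phi>) k) has_vector_derivative shift_coeff z (ft \<psi>) k) (at z)"
      by (simp add: shift_coeff_def fcoeff_psi mult_ac)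
    have bl: "bounded_linear (\<lambda>c. w k * Re (?a k * cnj c))"
      by (intro bounded_linear_const_mult bounded_linear_compose[OF bounded_linear_Re]
            bounded_linear_compose[OF bounded_linear_mult_right bounded_linear_cnj])
    show ?thesis
      using bounded_linear.has_vector_derivative[OF bl d]
      by (simp add: f_def[abs_def] f'_def has_real_derivative_iff_has_vector_derivative)
  qed
  have sm: "(\<lambda>k. f k z) summable_on UNIV" "(\<lambda>k. f' k z) summable_on UNIV" for z
    unfolding f_def f'_def
    by (intro wip_summable wt_nonneg X_ell(1) u; simp add: shift_coeff_ell2w X_ell(1) phi_X psi_X)+
  define M where "M k = w k * (cmod (?a k) * cmod (ft \<psi> k))" for k
  have "M summable_on UNIV" unfolding M_def by (rule ell2w_abs_product[OF wt_nonneg X_ell(1)[OF u] X_ell(1)[OF psi_X]])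
  then have sM: "summable (\<lambda>n. M (int_decode n))" by (rule infsum_eq_suminf_int(1))
  have bM: "norm (f' k z) \<le> M k" for k z
  proof -
    have "\<bar>Re (?a k * cnj (shift_coeff z (ft \<psi>) k))\<bar> \<le> cmod (?a k) * cmod (ft \<psi> k)"
      by (rule order_trans[OF abs_Re_le_cmod]) (simp add: norm_mult)
    then show ?thesis by (simp add: f'_def M_def abs_mult wt_nonneg mult_left_mono)
  qed
  have "uniform_limit UNIV (\<lambda>n z. \<Sum>i<n. f' (int_decode i) z) (\<lambda>z. \<Sum>i. f' (int_decode i) z) sequentially"
    by (rule Weierstrass_m_test[OF _ sM]) (rule bM)
  then have uc: "uniformly_convergent_on UNIV (\<lambda>n z. \<Sum>i<n. f' (int_decode i) z)"
    unfolding uniformly_convergent_on_def by blast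
  have "((\<lambda>z. \<Sum>n. f (int_decode n) z) has_field_derivative (\<Sum>n. f' (int_decode n) y)) (at y)"
    by (rule has_field_derivative_series'(2)[OF convex_UNIV _ uc UNIV_I infsum_eq_suminf_int(1)[OF sm(1)]])
       (use df in auto)
  moreover have "(\<Sum>n. f (int_decode n) z) = wip w ?a (shift_coeff z (ft \<phi>))" for z
    using infsum_eq_suminf_int(2)[OF sm(1)] by (simp add: wip_def f_def)
  moreover have "(\<Sum>n. f' (int_decode n) y) = wip w ?a (shift_coeff y (ft \<psi>))"
    using infsum_eq_suminf_int(2)[OF sm(2)] by (simp add: wip_def f'_def)
  ultimately show ?thesis by simp
qed

text \<open>Each coefficient of \<open>\<psi>\<close> is an imaginary multiple of that of \<open>\<phi>\<close>.\<close>

lemma phi_orthogonal_psi: "wip w (ft \<phi>) (ft \<psi>) = 0"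
proof -
  have "Re (ft \<phi> k * cnj (ft \<psi> k)) = 0" for k
    unfolding fcoeff_psi by (simp add: algebra_simps)
  then show ?thesis by (simp add: wip_def)
qed

text \<open>The distance to the orbit is attained by periodicity, and at a maximum of the correlation
  \<open>y \<mapsto> \<langle>u, \<phi>(\<cdot> + y)\<rangle>\<close> its derivative vanishes, which is the orthogonality that coercivity needs.\<close>

lemma nearest_translate:
  assumes u: "u \<in> X"
  shows "\<exists>y. odist u = Xnorm (\<lambda>x. u x - \<phi> (x + y)) \<and>
     wip w (ft u) (shift_coeff y (ft \<psi>)) = 0"
proof -
  let ?p = "\<lambda>y. wip w (ft u) (shift_coeff y (ft \<phi>))"
  have "continuous_on {0..L} ?p"
    by (rule continuous_at_imp_continuous_on) (blast intro: DERIV_isCont correlation_derivative[OF u])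
  from continuous_attains_sup[OF compact_Icc _ this] L
  obtain y where "\<forall>z\<in>{0..L}. ?p z \<le> ?p y" by auto
  then have y: "?p z \<le> ?p y" if "z \<in> {0..L}" for z using that by blast
  have per: "?p (z + L) = ?p z" for z
    unfolding shift_coeff_def wave_periodic[OF L] ..
  have max: "?p z \<le> ?p y" for z
  proof -
    define z' where "z' = z + of_int (- \<lfloor>z / L\<rfloor>) * L"
    have "of_int \<lfloor>z / L\<rfloor> \<le> z / L" "z / L \<le> of_int \<lfloor>z / L\<rfloor> + 1" by linarith+
    then have "of_int \<lfloor>z / L\<rfloor> * L \<le> z" "z \<le> (of_int \<lfloor>z / L\<rfloor> + 1) * L"
      using L by (simp_all only: pos_le_divide_eq pos_divide_le_eq)
    then have "z' \<in> {0..L}" by (simp add: z'_def algebra_simps)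
    moreover have "?p z' = ?p z" unfolding z'_def by (rule periodic_of_int[of ?p L, OF per])
    ultimately show ?thesis using y[of z'] by simp
  qed
  have d0: "wip w (ft u) (shift_coeff y (ft \<psi>)) = 0"
    by (rule DERIV_local_max[OF correlation_derivative[OF u], of 1]) (use max in auto)
  have "Xnorm (\<lambda>x. u x - \<phi> (x + y)) \<le> Xnorm (\<lambda>x. u x - \<phi> (x + z))" for z
    unfolding Hnorm_difference_translate[OF u] using max[of z] L by (intro real_sqrt_le_mono mult_left_mono) auto
  then have "odist u = Xnorm (\<lambda>x. u x - \<phi> (x + y))"
    unfolding orbit_dist_def by (intro cInf_eq_minimum) auto
  then show ?thesis using d0 by blast
qed

lemma Hnorm_nonneg: "Xnorm u \<ge> 0"
  unfolding Hnorm_nsq using L nsq_nonneg by simp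

lemma orbit_dist_le: "odist u \<le> Xnorm (\<lambda>x. u x - \<phi> (x + y))"
  unfolding orbit_dist_def by (rule cINF_lower) (auto intro: bdd_belowI2[of _ 0] Hnorm_nonneg)

lemma Hnorm_triangle:
  assumes "u \<in> X" "v \<in> X"
  shows "Xnorm (\<lambda>x. u x + v x) \<le> Xnorm u + Xnorm v"
proof -
  have "sqrt (nsq (\<lambda>x. u x + 1 * v x)) \<le> sqrt (nsq u) + sqrt (nsq v)"
    unfolding nsq_def X_comb(2)[OF assms] using wip_triangle[OF wt_nonneg X_ell(1)[OF assms(1)] X_ell(1)[OF assms(2)]] by simp
  then have "sqrt L * sqrt (nsq (\<lambda>x. u x + 1 * v x)) \<le> sqrt L * (sqrt (nsq u) + sqrt (nsq v))"
    using L by (intro mult_left_mono) auto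
  then show ?thesis by (simp add: Hnorm_nsq real_sqrt_mult distrib_left)
qed

lemma diff_X: "u \<in> X \<Longrightarrow> v \<in> X \<Longrightarrow> (\<lambda>x. u x - v x) \<in> X"
  using X_comb(1)[of u v "-1"] by simp

lemma Hnorm_minus_commute:
  assumes "u \<in> X" "v \<in> X"
  shows "Xnorm (\<lambda>x. u x - v x) = Xnorm (\<lambda>x. v x - u x)"
proof -
  have "ft (\<lambda>x. u x - v x) = (\<lambda>k. ft u k - ft v k)" if "u \<in> X" "v \<in> X" for u v
    using X_comb(2)[OF that, of "-1"] by simp
  then show ?thesis using assms by (simp add: Hnorm_nsq nsq_def wip_self norm_minus_commute)
qed

text \<open>This carries continuity of solutions in time over to their distance from the orbit.\<close>

lemma orbit_dist_lipschitz:
  assumes u: "u \<in> X" and v: "v \<in> X"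
  shows "\<bar>odist u - odist v\<bar> \<le> Xnorm (\<lambda>x. u x - v x)"
proof -
  have one: "odist u \<le> Xnorm (\<lambda>x. u x - v x) + odist v"
    if u: "u \<in> X" and v: "v \<in> X" for u v
  proof -
    obtain y where y: "odist v = Xnorm (\<lambda>x. v x - \<phi> (x + y))"
      using nearest_translate[OF v] by blast
    have "odist u \<le> Xnorm (\<lambda>x. u x - \<phi> (x + y))" by (rule orbit_dist_le)
    also have "(\<lambda>x. u x - \<phi> (x + y)) = (\<lambda>x. (u x - v x) + (v x - \<phi> (x + y)))" by auto
    also have "Xnorm \<dots> \<le> Xnorm (\<lambda>x. u x - v x) + Xnorm (\<lambda>x. v x - \<phi> (x + y))"
      by (intro Hnorm_triangle diff_X u v translate_X phi_X)
    finally show ?thesis using y by simp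
  qed
  show ?thesis using one[OF u v] one[OF v u] Hnorm_minus_commute[OF u v] by linarith
qed

section \<open>The Lyapunov functional\<close>

definition action :: "(real \<Rightarrow> real) \<Rightarrow> real" where
  "action u = functional_P L \<theta> u + (\<omega> - 1) * functional_F L \<theta> u"

text \<open>A conserved quantity whose derivative at \<open>\<phi>\<close> is \<open>\<L>(\<Psi>,\<cdot>)\<close>: it detects the direction in
  which the second variation of the action is negative.\<close>

definition transversal :: "(real \<Rightarrow> real) \<Rightarrow> real" where
  "transversal u = (\<omega> - 1) * functional_M L u - \<omega> * functional_F L \<theta> u"

definition lyapunov :: "(real \<Rightarrow> real) \<Rightarrow> real" where
  "lyapunov u = (action u - action \<phi>) + (transversal u - transversal \<phi>)\<^sup>2 / Nneg"

lemma functional_P_wip: "u \<in> X \<Longrightarrow> functional_P L \<theta> u =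
    1/2 * (L * wip tw (ft u) (ft u) - 1/3 * (LINT x|cell L. (u x) ^ 3))"
  by (simp add: functional_P_def set_integral_cell dual_pairing_wip[OF tw_nonneg X_ell(3)])

lemma functional_F_wip: "u \<in> X \<Longrightarrow> functional_F L \<theta> u =
    1/2 * (L * wip tw (ft u) (ft u) + L * l2ip (ft u) (ft u))"
  by (simp add: functional_F_def set_integral_cell dual_pairing_wip[OF tw_nonneg X_ell(3)] integral_sq)

lemma functional_M_cell: "functional_M L u = (LINT x|cell L. u x)"
  by (simp add: functional_M_def set_integral_cell)

lemma wip_alpha_split:
  assumes "u \<in> X" "v \<in> X"
  shows "wip alpha (ft u) (ft v) = \<omega> * wip tw (ft u) (ft v) + (\<omega> - 1) * l2ip (ft u) (ft v)"
  using wip_weight_comb[of tw "\<lambda>_. 1" "ft u" "ft v" \<omega> "\<omega> - 1"] X_ell[OF assms(1)] X_ell[OF assms(2)] tw_nonneg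
  by (simp add: alpha_def[abs_def])

lemma action_wip:
  assumes u: "u \<in> X"
  shows "action u = 1/2 * (L * wip alpha (ft u) (ft u)) - 1/6 * (LINT x|cell L. (u x) ^ 3)"
  unfolding action_def functional_P_wip[OF u] functional_F_wip[OF u] wip_alpha_split[OF u u] by (simp add: field_simps)

lemma lyapunov_translate:
  assumes u: "u \<in> X"
  shows "lyapunov (\<lambda>x. u (x + y)) = lyapunov u"
proof -
  note T = translate_X[OF u, of y] and c = fcoeff_translate[OF HperD(1)[OF u], of y]
  have M: "functional_M L (\<lambda>x. u (x + y)) = functional_M L u"
    unfolding functional_M_cell by (rule integral_cell_shift(2)[OF L XL2(1)[OF u] XL2(5)[OF u]])
  have F: "functional_F L \<theta> (\<lambda>x. u (x + y)) = functional_F L \<theta> u"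
    unfolding functional_F_wip[OF T] functional_F_wip[OF u] c wip_shift_coeff ..
  have P: "functional_P L \<theta> (\<lambda>x. u (x + y)) = functional_P L \<theta> u"
    unfolding functional_P_wip[OF T] functional_P_wip[OF u] c wip_shift_coeff translate_cube[OF u] ..
  show ?thesis by (simp add: lyapunov_def action_def transversal_def M F P)
qed

lemma action_expansion:
  assumes h: "h \<in> X"
  shows "action (\<lambda>x. \<phi> x + 1 * h x) - action \<phi> = 1/2 * lin_form h h - 1/6 * (LINT x|cell L. (h x) ^ 3)"
proof -
  note u = X_comb(1)[OF phi_X h, of 1]
  have "(LINT x|cell L. (\<phi> x + 1 * h x) ^ 3)
      = (LINT x|cell L. (\<phi> x * \<phi> x * \<phi> x + 3 * (\<phi> x * \<phi> x * h x)) + (3 * (\<phi> x * h x * h x) + h x * h x * h x))"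
    by (intro Bochner_Integration.integral_cong) (auto simp: power3_eq_cube algebra_simps)
  also have "\<dots> = (LINT x|cell L. \<phi> x * \<phi> x * \<phi> x) + 3 * (LINT x|cell L. \<phi> x * \<phi> x * h x)
      + 3 * (LINT x|cell L. \<phi> x * h x * h x) + (LINT x|cell L. h x * h x * h x)"
    using X_product3 phi_X h by simp
  finally have cube: "(LINT x|cell L. (\<phi> x + 1 * h x) ^ 3) = (LINT x|cell L. (\<phi> x) ^ 3) + 3 * (LINT x|cell L. \<phi> x * \<phi> x * h x)
      + 3 * (LINT x|cell L. \<phi> x * h x * h x) + (LINT x|cell L. (h x) ^ 3)"
    by (simp add: power3_eq_cube)
  have mix: "2 * (L * wip alpha (ft \<phi>) (ft h)) = (LINT x|cell L. \<phi> x * \<phi> x * h x)"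
    unfolding wave_weak[OF h] integral_mult_right_zero[symmetric]
    by (intro Bochner_Integration.integral_cong) (auto simp: power2_eq_square)
  have W: "wip alpha (ft (\<lambda>x. \<phi> x + 1 * h x)) (ft (\<lambda>x. \<phi> x + 1 * h x))
     = wip alpha (ft \<phi>) (ft \<phi>) + 2 * wip alpha (ft \<phi>) (ft h) + wip alpha (ft h) (ft h)"
    unfolding X_comb(2)[OF phi_X h] wip_comb_self[OF alpha_nonneg X_ell(2)[OF phi_X] X_ell(2)[OF h]] by simp
  show ?thesis
    unfolding action_wip[OF u] action_wip[OF phi_X] cube mix[symmetric] W lin_form_def by (simp add: algebra_simps)
qed

text \<open>Minus the purely quadratic part of \<open>transversal\<close>.\<close>

definition remainder :: "(real \<Rightarrow> real) \<Rightarrow> real" where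
  "remainder h = \<omega> / 2 * (L * wip tw (ft h) (ft h) + L * l2ip (ft h) (ft h))"

lemma transversal_expansion:
  assumes h: "h \<in> X"
  shows "transversal (\<lambda>x. \<phi> x + 1 * h x) - transversal \<phi> = lin_form Psi h - remainder h"
proof -
  note u = X_comb(1)[OF phi_X h, of 1]
  note i = XL2(5)[OF h] X_product2[OF phi_X h] Parseval(1)[OF L exponent h phi_square_L2]
  have M: "functional_M L (\<lambda>x. \<phi> x + 1 * h x) = functional_M L \<phi> + (LINT x|cell L. h x)"
    unfolding functional_M_cell using XL2(5)[OF phi_X] i(1) by simp
  have W: "wip \<beta> (ft (\<lambda>x. \<phi> x + 1 * h x)) (ft (\<lambda>x. \<phi> x + 1 * h x))
     = wip \<beta> (ft \<phi>) (ft \<phi>) + 2 * wip \<beta> (ft \<phi>) (ft h) + wip \<beta> (ft h) (ft h)"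
    if "\<And>k. \<beta> k \<ge> 0" "ft \<phi> \<in> ell2w \<beta>" "ft h \<in> ell2w \<beta>" for \<beta>
    unfolding X_comb(2)[OF phi_X h] wip_comb_self[OF that] by simp
  have W1: "l2ip (ft (\<lambda>x. \<phi> x + 1 * h x)) (ft (\<lambda>x. \<phi> x + 1 * h x))
     = l2ip (ft \<phi>) (ft \<phi>) + 2 * l2ip (ft \<phi>) (ft h) + l2ip (ft h) (ft h)"
    by (rule W[OF _ X_ell(4)[OF phi_X] X_ell(4)[OF h]]) simp
  have F: "functional_F L \<theta> (\<lambda>x. \<phi> x + 1 * h x) = functional_F L \<theta> \<phi>
     + (L * wip tw (ft \<phi>) (ft h) + L * l2ip (ft \<phi>) (ft h))
     + 1/2 * (L * wip tw (ft h) (ft h) + L * l2ip (ft h) (ft h))"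
    unfolding functional_F_wip[OF u] functional_F_wip[OF phi_X]
      W[of tw, OF tw_nonneg X_ell(3)[OF phi_X] X_ell(3)[OF h]] W1
    by (simp add: algebra_simps)
  have one: "L * l2ip (ft \<phi>) (ft h) = (LINT x|cell L. \<phi> x * h x)"
    using Parseval(2)[OF L exponent h XL2(2)[OF phi_X] XL2(4)[OF phi_X]] by simp
  have "\<omega> * (L * wip tw (ft \<phi>) (ft h)) = L * wip alpha (ft \<phi>) (ft h)
      - (\<omega> - 1) * (L * l2ip (ft \<phi>) (ft h))"
    unfolding wip_alpha_split[OF phi_X h] by (simp add: algebra_simps)
  then have tw': "\<omega> * (L * wip tw (ft \<phi>) (ft h)) = (LINT x|cell L. (\<phi> x)\<^sup>2 / 2 * h x) - (\<omega> - 1) * (LINT x|cell L. \<phi> x * h x)"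
    unfolding one wave_weak[OF h] .
  have "lin_form Psi h = (LINT x|cell L. (\<omega> - 1) * h x - \<phi> x * h x - (\<phi> x)\<^sup>2 / 2 * h x)"
    unfolding lin_form_Psi[OF h] by (intro Bochner_Integration.integral_cong) (auto simp: op_Psi_def algebra_simps)
  also have "\<dots> = (\<omega> - 1) * (LINT x|cell L. h x) - (LINT x|cell L. \<phi> x * h x) - (LINT x|cell L. (\<phi> x)\<^sup>2 / 2 * h x)"
    by (simp only: Bochner_Integration.integral_diff[OF Bochner_Integration.integrable_diff[OF integrable_mult_right[OF i(1)] i(2)] i(3)]
        Bochner_Integration.integral_diff[OF integrable_mult_right[OF i(1)] i(2)] integral_mult_right_zero)
  finally have lp: "lin_form Psi h = (\<omega> - 1) * (LINT x|cell L. h x) - (LINT x|cell L. \<phi> x * h x) - (LINT x|cell L. (\<phi> x)\<^sup>2 / 2 * h x)" .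
  have "transversal (\<lambda>x. \<phi> x + 1 * h x) - transversal \<phi> = (\<omega> - 1) * (LINT x|cell L. h x)
     - (\<omega> * (L * wip tw (ft \<phi>) (ft h)) + \<omega> * (LINT x|cell L. \<phi> x * h x)) - remainder h"
    unfolding transversal_def M F one remainder_def by (simp add: algebra_simps)
  then show ?thesis unfolding tw' lp by (simp add: algebra_simps)
qed

lemma form_bounds:
  "\<exists>C\<ge>0. \<forall>h\<in>X. 0 \<le> remainder h \<and> remainder h \<le> C * nsq h \<and> \<bar>LINT x|cell L. (h x) ^ 3\<bar> \<le> C * sqrt (nsq h) ^ 3 \<and>
     \<bar>lin_form Psi h\<bar> \<le> C * sqrt (nsq h) \<and> \<bar>lin_form h h\<bar> \<le> C * nsq h"
proof -
  obtain b where b: "b \<ge> 0" "AE x in cell L. \<bar>\<phi> x\<bar> \<le> b" using phi_bounded by blast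
  obtain K where K: "K \<ge> 0" "\<And>u. u \<in> X \<Longrightarrow> integrable (cell L) (\<lambda>x. \<bar>u x\<bar> ^ 3)"
    "\<And>u. u \<in> X \<Longrightarrow> (LINT x|cell L. \<bar>u x\<bar> ^ 3) \<le> K * sqrt (wip w (ft u) (ft u)) ^ 3"
    using Hper_cube_bound[OF L exponent] by blast
  define S where "S = sqrt (l2ip (ft op_Psi) (ft op_Psi))"
  have S: "S \<ge> 0" by (simp add: S_def wip_self_nonneg)
  define c1 where "c1 = \<omega> / 2 * (L * \<upsilon>2 + L)"
  define c2 where "c2 = L * (\<omega> * \<upsilon>2 + (\<omega> - 1)) + b * L"
  have pos: "c1 \<ge> 0" "c2 \<ge> 0" "L * S \<ge> 0" using L \<upsilon> \<omega> b S by (auto simp: c1_def c2_def)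
  define C where "C = c1 + K + L * S + c2"
  have CC: "c1 \<le> C" "K \<le> C" "L * S \<le> C" "c2 \<le> C" "C \<ge> 0" using pos K(1) by (auto simp: C_def)
  show ?thesis
  proof (intro exI[of _ C] conjI ballI CC)
    fix h assume h: "h \<in> X"
    have n1: "l2ip (ft h) (ft h) \<le> nsq h"
      using wip_self_mono[OF X_ell(1)[OF h], of "\<lambda>_. 1" 1] w_ge_1 by (simp add: nsq_def)
    have nt: "wip tw (ft h) (ft h) \<le> \<upsilon>2 * nsq h"
      using wip_self_mono[OF X_ell(1)[OF h] tw_nonneg tw_le] by (simp add: nsq_def)
    have na: "wip alpha (ft h) (ft h) \<le> (\<omega> * \<upsilon>2 + (\<omega> - 1)) * nsq h"
      using wip_self_mono[OF X_ell(1)[OF h] alpha_nonneg alpha_le] by (simp add: nsq_def)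
    have n0: "l2ip (ft h) (ft h) \<ge> 0" "wip tw (ft h) (ft h) \<ge> 0" "wip alpha (ft h) (ft h) \<ge> 0"
      using wip_self_nonneg tw_nonneg alpha_nonneg by auto
    show "0 \<le> remainder h" unfolding remainder_def using n0 L \<omega> by simp
    have up: "x \<le> C * z" if "x \<le> c * z" "c \<le> C" "z \<ge> 0" for x c z
      using that mult_right_mono[of c C z] by linarith
    have "remainder h \<le> c1 * nsq h"
    proof -
      have "L * wip tw (ft h) (ft h) + L * l2ip (ft h) (ft h) \<le> L * (\<upsilon>2 * nsq h) + L * nsq h"
        using n1 nt L by (intro add_mono mult_left_mono) auto
      then have "remainder h \<le> \<omega> / 2 * (L * (\<upsilon>2 * nsq h) + L * nsq h)"
        unfolding remainder_def using \<omega> by (intro mult_left_mono) auto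
      then show ?thesis by (simp add: c1_def algebra_simps)
    qed
    then show "remainder h \<le> C * nsq h" using up[OF _ CC(1)] nsq_nonneg by blast
    have "\<bar>LINT x|cell L. (h x) ^ 3\<bar> \<le> K * sqrt (nsq h) ^ 3"
      using integral_abs_bound[of "cell L" "\<lambda>x. (h x) ^ 3"] K(3)[OF h] by (simp add: power_abs nsq_def)
    then show "\<bar>LINT x|cell L. (h x) ^ 3\<bar> \<le> C * sqrt (nsq h) ^ 3" using up[OF _ CC(2)] nsq_nonneg by simp
    have "\<bar>lin_form Psi h\<bar> \<le> (L * S) * sqrt (nsq h)"
    proof -
      have "\<bar>l2ip (ft op_Psi) (ft h)\<bar> \<le> S * sqrt (l2ip (ft h) (ft h))"
        unfolding S_def by (rule wip_Cauchy_Schwarz[OF _ Bessel_ell2[OF L op_Psi_L2] X_ell(4)[OF h]]) simp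
      also have "\<dots> \<le> S * sqrt (nsq h)" using n1 S by (intro mult_left_mono real_sqrt_le_mono)
      finally have "L * \<bar>l2ip (ft op_Psi) (ft h)\<bar> \<le> L * (S * sqrt (nsq h))" using L by (intro mult_left_mono) auto
      then show ?thesis unfolding lin_form_Psi[OF h] Parseval(2)[OF L exponent h op_Psi_L2] using L by (simp add: abs_mult mult.assoc)
    qed
    then show "\<bar>lin_form Psi h\<bar> \<le> C * sqrt (nsq h)" using up[OF _ CC(3)] nsq_nonneg by simp
    have "\<bar>lin_form h h\<bar> \<le> L * wip alpha (ft h) (ft h) + b * (L * l2ip (ft h) (ft h))"
    proof -
      have "0 \<le> L * wip alpha (ft h) (ft h)" using L n0(3) by simp
      then show ?thesis using potential_bound[OF b(2) h] unfolding lin_form_def by linarith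
    qed
    also have "\<dots> \<le> L * ((\<omega> * \<upsilon>2 + (\<omega> - 1)) * nsq h) + b * (L * nsq h)"
      using na n1 L b by (intro add_mono mult_left_mono) auto
    also have "\<dots> = c2 * nsq h" by (simp add: c2_def algebra_simps)
    finally show "\<bar>lin_form h h\<bar> \<le> C * nsq h" using up[OF _ CC(4)] nsq_nonneg by blast
  qed
qed

lemma lyapunov_expansion:
  assumes h: "h \<in> X"
  shows "lyapunov (\<lambda>x. \<phi> x + 1 * h x) = 1/2 * Qform h - 1/6 * (LINT x|cell L. (h x) ^ 3)
     - 2 / Nneg * (lin_form Psi h * remainder h) + (remainder h)\<^sup>2 / Nneg"
  unfolding lyapunov_def action_expansion[OF h] transversal_expansion[OF h] Qform_def
  using Nneg_pos by (simp add: power2_diff field_simps)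

text \<open>The square of the linear term of \<open>transversal\<close> completes the form \<open>Q\<close>; the mixed term is of third order,
  and the square of the remainder has the favourable sign.\<close>

lemma lyapunov_lower:
  "\<exists>\<kappa>>0. \<exists>C\<ge>0. \<forall>h\<in>X. wip w (ft h) (ft \<psi>) = 0 \<longrightarrow>
     \<kappa> * nsq h - C * sqrt (nsq h) ^ 3 \<le> lyapunov (\<lambda>x. \<phi> x + 1 * h x)"
proof -
  obtain \<kappa> where \<kappa>: "\<kappa> > 0" "\<And>h. h \<in> X \<Longrightarrow> wip w (ft h) (ft \<psi>) = 0 \<Longrightarrow> \<kappa> * nsq h \<le> Qform h"
    using coercivity by blast
  obtain C where C: "C \<ge> 0" and b: "\<And>h. h \<in> X \<Longrightarrow> 0 \<le> remainder h \<and> remainder h \<le> C * nsq h \<and>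
     \<bar>LINT x|cell L. (h x) ^ 3\<bar> \<le> C * sqrt (nsq h) ^ 3 \<and>
     \<bar>lin_form Psi h\<bar> \<le> C * sqrt (nsq h) \<and> \<bar>lin_form h h\<bar> \<le> C * nsq h" using form_bounds by blast
  define K where "K = C / 6 + 2 / Nneg * (C * C)"
  have K: "K \<ge> 0" using C Nneg_pos by (simp add: K_def)
  have "\<kappa> / 2 * nsq h - K * sqrt (nsq h) ^ 3 \<le> lyapunov (\<lambda>x. \<phi> x + 1 * h x)"
    if h: "h \<in> X" and o: "wip w (ft h) (ft \<psi>) = 0" for h
  proof -
    have n3: "sqrt (nsq h) ^ 3 = sqrt (nsq h) * nsq h" using nsq_nonneg[of h] by (simp add: power3_eq_cube)
    have "lin_form Psi h * remainder h \<le> (C * sqrt (nsq h)) * (C * nsq h)"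
      using b[OF h] C nsq_nonneg[of h] by (intro mult_mono) auto
    also have "\<dots> = (C * C) * sqrt (nsq h) ^ 3" unfolding n3 by simp
    finally have "2 / Nneg * (lin_form Psi h * remainder h) \<le> 2 / Nneg * ((C * C) * sqrt (nsq h) ^ 3)"
      using Nneg_pos by (intro mult_left_mono) auto
    moreover have "1/6 * (LINT x|cell L. (h x) ^ 3) \<le> 1/6 * (C * sqrt (nsq h) ^ 3)" using b[OF h] by auto
    moreover have "(remainder h)\<^sup>2 / Nneg \<ge> 0" using Nneg_pos by simp
    moreover have "K * sqrt (nsq h) ^ 3 = 1/6 * (C * sqrt (nsq h) ^ 3) + 2 / Nneg * ((C * C) * sqrt (nsq h) ^ 3)"
      by (simp add: K_def algebra_simps)
    ultimately show ?thesis unfolding lyapunov_expansion[OF h] using \<kappa>(2)[OF h o] by simp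
  qed
  then show ?thesis using \<kappa>(1) K by (intro exI[of _ "\<kappa> / 2"] conjI exI[of _ K]) auto
qed

lemma lyapunov_upper:
  "\<exists>C\<ge>0. \<forall>h\<in>X. nsq h \<le> 1 \<longrightarrow> lyapunov (\<lambda>x. \<phi> x + 1 * h x) \<le> C * nsq h"
proof -
  obtain C where C: "C \<ge> 0" and b: "\<And>h. h \<in> X \<Longrightarrow> 0 \<le> remainder h \<and> remainder h \<le> C * nsq h \<and>
     \<bar>LINT x|cell L. (h x) ^ 3\<bar> \<le> C * sqrt (nsq h) ^ 3 \<and>
     \<bar>lin_form Psi h\<bar> \<le> C * sqrt (nsq h) \<and> \<bar>lin_form h h\<bar> \<le> C * nsq h" using form_bounds by blast
  define K where "K = C / 2 + C / 6 + (2 * C)\<^sup>2 / Nneg"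
  have K: "K \<ge> 0" using C Nneg_pos by (simp add: K_def)
  have "lyapunov (\<lambda>x. \<phi> x + 1 * h x) \<le> K * nsq h" if h: "h \<in> X" and n1: "nsq h \<le> 1" for h
  proof -
    have n0: "nsq h \<ge> 0" by (rule nsq_nonneg)
    have q1: "sqrt (nsq h) \<le> 1" using n1 by simp
    have n: "nsq h = sqrt (nsq h) * sqrt (nsq h)" using n0 by simp
    have le: "nsq h \<le> sqrt (nsq h)"
      using mult_right_mono[OF q1, of "sqrt (nsq h)"] n0 by simp
    have n3: "sqrt (nsq h) ^ 3 \<le> nsq h"
    proof -
      have "sqrt (nsq h) ^ 3 = sqrt (nsq h) * nsq h" using n0 by (simp add: power3_eq_cube)
      then show ?thesis using mult_right_mono[OF q1 n0] by simp
    qed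
    have "\<bar>lin_form Psi h - remainder h\<bar> \<le> C * sqrt (nsq h) + C * nsq h" using b[OF h] by linarith
    also have "\<dots> \<le> 2 * C * sqrt (nsq h)" using mult_left_mono[OF le C] by linarith
    finally have "\<bar>lin_form Psi h - remainder h\<bar>\<^sup>2 \<le> (2 * C * sqrt (nsq h))\<^sup>2" by (intro power_mono) auto
    then have "(lin_form Psi h - remainder h)\<^sup>2 / Nneg \<le> (2 * C * sqrt (nsq h))\<^sup>2 / Nneg"
      using Nneg_pos by (intro divide_right_mono) auto
    also have "\<dots> = (2 * C)\<^sup>2 / Nneg * nsq h" using n0 by (simp add: power_mult_distrib)
    finally have t: "(lin_form Psi h - remainder h)\<^sup>2 / Nneg \<le> (2 * C)\<^sup>2 / Nneg * nsq h" .
    have "- (1/6 * (LINT x|cell L. (h x) ^ 3)) \<le> C / 6 * nsq h"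
      using b[OF h] mult_left_mono[OF n3 C] by linarith
    moreover have "1/2 * lin_form h h \<le> C / 2 * nsq h" using b[OF h] by linarith
    moreover have "K * nsq h = C / 2 * nsq h + C / 6 * nsq h + (2 * C)\<^sup>2 / Nneg * nsq h"
      unfolding K_def by (simp only: distrib_right)
    moreover have "x - y + z \<le> k" if "- y \<le> b" "x \<le> a" "k = a + b + c" "z \<le> c" for x y z a b c k :: real
      using that by linarith
    ultimately show ?thesis
      unfolding lyapunov_def action_expansion[OF h] transversal_expansion[OF h] using t by blast
  qed
  then show ?thesis using K by blast
qed

text \<open>Translating \<open>u\<close> back by the optimal \<open>y\<close> leaves the functional unchanged and makes the difference to \<open>\<phi>\<close>
  orthogonal to \<open>\<psi>\<close>; close to the orbit half of the quadratic term absorbs the cubic one.\<close>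

lemma lyapunov_lower_orbit:
  "\<exists>\<kappa>>0. \<exists>\<eta>>0. \<forall>u\<in>X. odist u \<le> \<eta> \<longrightarrow> \<kappa> * (odist u)\<^sup>2 \<le> lyapunov u"
proof -
  obtain \<kappa> C where \<kappa>: "\<kappa> > 0" and C: "C \<ge> 0"
    and low: "\<And>h. h \<in> X \<Longrightarrow> wip w (ft h) (ft \<psi>) = 0 \<Longrightarrow>
     \<kappa> * nsq h - C * sqrt (nsq h) ^ 3 \<le> lyapunov (\<lambda>x. \<phi> x + 1 * h x)" using lyapunov_lower by blast
  define q where "q = \<kappa> / 2 / (C + 1)"
  have q: "q > 0" using \<kappa> C by (simp add: q_def)
  define \<eta> where "\<eta> = sqrt L * q"
  have main: "\<kappa> / (2 * L) * (odist u)\<^sup>2 \<le> lyapunov u"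
    if u: "u \<in> X" and near: "odist u \<le> \<eta>" for u
  proof -
    obtain y where y: "odist u = Xnorm (\<lambda>x. u x - \<phi> (x + y))"
      and o: "wip w (ft u) (shift_coeff y (ft \<psi>)) = 0" using nearest_translate[OF u] by blast
    define T where "T = (\<lambda>x. u (x + (- y)))"
    have TX: "T \<in> X" unfolding T_def by (rule translate_X[OF u])
    have fT: "ft T = shift_coeff (- y) (ft u)"
      unfolding T_def by (rule fcoeff_translate[OF HperD(1)[OF u]])
    have inv: "shift_coeff (- y) (shift_coeff y a) = a" for a
    proof
      fix k
      have "wave L k (- y) * wave L k y = 1" using wave_shift[of L k y "- y"] by (simp add: wave_def)
      then show "shift_coeff (- y) (shift_coeff y a) k = a k"
        by (simp add: shift_coeff_def mult.assoc[symmetric])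
    qed
    define h where "h = (\<lambda>x. T x + (-1) * \<phi> x)"
    have h: "h \<in> X" unfolding h_def by (rule X_comb(1)[OF TX phi_X])
    have fh: "ft h = (\<lambda>k. ft T k + of_real (-1) * ft \<phi> k)"
      unfolding h_def by (rule X_comb(2)[OF TX phi_X])
    have "wip w (ft T) (ft \<psi>) = wip w (ft u) (shift_coeff y (ft \<psi>))"
      using wip_shift_coeff[of w "- y" "ft u" "shift_coeff y (ft \<psi>)"] by (simp add: fT inv)
    then have orth: "wip w (ft h) (ft \<psi>) = 0"
      unfolding fh wip_comb_left[OF wt_nonneg X_ell(1)[OF TX] X_ell(1)[OF phi_X] X_ell(1)[OF psi_X]]
      using o phi_orthogonal_psi by simp
    have "nsq h = nsq u + nsq \<phi> - 2 * wip w (ft u) (shift_coeff y (ft \<phi>))"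
    proof -
      have "wip w (ft T) (ft \<phi>) = wip w (ft u) (shift_coeff y (ft \<phi>))"
        using wip_shift_coeff[of w "- y" "ft u" "shift_coeff y (ft \<phi>)"] by (simp add: fT inv)
      then show ?thesis
        unfolding nsq_def fh wip_comb_self[OF wt_nonneg X_ell(1)[OF TX] X_ell(1)[OF phi_X]]
        by (simp add: fT wip_shift_coeff)
    qed
    then have dist: "odist u = sqrt (L * nsq h)"
      unfolding y Hnorm_difference_translate[OF u] by simp
    have "(\<lambda>x. \<phi> x + 1 * h x) = T" by (auto simp: h_def)
    then have V: "lyapunov (\<lambda>x. \<phi> x + 1 * h x) = lyapunov u"
      using lyapunov_translate[OF u, of "- y"] by (simp add: T_def)
    have "sqrt L * sqrt (nsq h) \<le> sqrt L * q" using near unfolding dist \<eta>_def by (simp add: real_sqrt_mult)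
    then have sq: "sqrt (nsq h) \<le> q" using L by simp
    have "C * sqrt (nsq h) ^ 3 = (C * sqrt (nsq h)) * nsq h" using nsq_nonneg[of h] by (simp add: power3_eq_cube)
    also have "\<dots> \<le> (\<kappa> / 2) * nsq h"
    proof (rule mult_right_mono[OF _ nsq_nonneg])
      have "C * sqrt (nsq h) \<le> (C + 1) * q" using sq C nsq_nonneg[of h] by (intro mult_mono) auto
      also have "\<dots> = \<kappa> / 2"
      proof -
        have "C + 1 \<noteq> 0" using C by simp
        then show ?thesis unfolding q_def by (subst times_divide_eq_right) (rule nonzero_mult_div_cancel_left)
      qed
      finally show "C * sqrt (nsq h) \<le> \<kappa> / 2" .
    qed
    finally have "\<kappa> / 2 * nsq h \<le> lyapunov u" using low[OF h orth] V by simp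
    moreover have "\<kappa> / (2 * L) * (odist u)\<^sup>2 = \<kappa> / 2 * nsq h"
      unfolding dist using L nsq_nonneg[of h] by simp
    ultimately show ?thesis by simp
  qed
  show ?thesis
  proof (rule exI[of _ "\<kappa> / (2 * L)"], intro conjI exI[of _ \<eta>] ballI impI)
    show "\<kappa> / (2 * L) > 0" using \<kappa> L by simp
    show "\<eta> > 0" using q L by (simp add: \<eta>_def)
  qed (use main in auto)
qed

lemma lyapunov_small_near_phi:
  assumes e: "e > 0"
  shows "\<exists>\<delta>>0. \<forall>u\<in>X. Xnorm (\<lambda>x. u x - \<phi> x) < \<delta> \<longrightarrow> lyapunov u < e"
proof -
  obtain C where C: "C \<ge> 0" and up: "\<And>h. h \<in> X \<Longrightarrow> nsq h \<le> 1 \<Longrightarrow> lyapunov (\<lambda>x. \<phi> x + 1 * h x) \<le> C * nsq h"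
    using lyapunov_upper by blast
  define m where "m = min 1 (e / (C + 1))"
  have m: "m > 0" "m \<le> 1" using e C by (auto simp: m_def)
  have "m \<le> e / (C + 1)" by (simp add: m_def)
  then have m3: "(C + 1) * m \<le> e" using C by (simp add: pos_le_divide_eq mult.commute)
  show ?thesis
  proof (intro exI[of _ "sqrt (L * m)"] conjI ballI impI)
    show "sqrt (L * m) > 0" using L m by simp
    fix u assume u: "u \<in> X" and near: "Xnorm (\<lambda>x. u x - \<phi> x) < sqrt (L * m)"
    define h where "h = (\<lambda>x. u x - \<phi> x)"
    have h: "h \<in> X" unfolding h_def by (rule diff_X[OF u phi_X])
    have "sqrt (L * nsq h) < sqrt (L * m)" using near unfolding Hnorm_nsq h_def .
    then have n: "nsq h < m" using L by simp
    have "(\<lambda>x. \<phi> x + 1 * h x) = u" by (auto simp: h_def)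
    then have "lyapunov u \<le> C * nsq h" using up[OF h] n m(2) by simp
    also have "\<dots> \<le> C * m" using n C by (intro mult_left_mono) auto
    also have "\<dots> < (C + 1) * m" using m(1) by simp
    also have "\<dots> \<le> e" by (rule m3)
    finally show "lyapunov u < e" .
  qed
qed

text \<open>A solution that starts with \<open>V < \<kappa> e\<^sup>2\<close> cannot cross the sphere of radius \<open>e\<close> around the orbit, because
  there \<open>V \<ge> \<kappa> e\<^sup>2\<close> and \<open>V\<close> is conserved.\<close>

lemma orbital_stability:
  assumes wp: "globally_well_posed L \<theta> (m1/2)"
    and cP: "conserved L \<theta> (m1/2) (functional_P L \<theta>)"
    and cF: "conserved L \<theta> (m1/2) (functional_F L \<theta>)"
    and cM: "conserved L \<theta> (m1/2) (functional_M L)"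
  shows "orbitally_stable L \<theta> (m1/2) \<phi>"
  unfolding orbitally_stable_def
proof (intro allI impI)
  fix \<epsilon> :: real assume \<epsilon>: "\<epsilon> > 0"
  obtain \<kappa> \<eta> where \<kappa>: "\<kappa> > 0" and \<eta>: "\<eta> > 0"
    and low: "\<And>u. u \<in> X \<Longrightarrow> odist u \<le> \<eta> \<Longrightarrow> \<kappa> * (odist u)\<^sup>2 \<le> lyapunov u"
    using lyapunov_lower_orbit by blast
  define e where "e = min \<epsilon> \<eta>"
  have e: "e > 0" "e \<le> \<epsilon>" "e \<le> \<eta>" using \<epsilon> \<eta> by (auto simp: e_def)
  have "\<kappa> * e\<^sup>2 > 0" using \<kappa> e by simp
  from lyapunov_small_near_phi[OF this] obtain d where d: "d > 0"
    and small: "\<And>u. u \<in> X \<Longrightarrow> Xnorm (\<lambda>x. u x - \<phi> x) < d \<Longrightarrow> lyapunov u < \<kappa> * e\<^sup>2" by blast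
  show "\<exists>\<delta>>0. \<forall>u0\<in>X. Xnorm (\<lambda>x. u0 x - \<phi> x) < \<delta> \<longrightarrow>
     (\<exists>u. global_solution L \<theta> (m1/2) u0 u) \<and>
     (\<forall>u. global_solution L \<theta> (m1/2) u0 u \<longrightarrow> (\<forall>t\<ge>0. odist (u t) < \<epsilon>))"
  proof (intro exI[of _ "min d e"] conjI ballI impI allI)
    show "min d e > 0" using d e by simp
    fix u0 assume u0: "u0 \<in> X" and near: "Xnorm (\<lambda>x. u0 x - \<phi> x) < min d e"
    show "\<exists>u. global_solution L \<theta> (m1/2) u0 u" using wp u0 unfolding globally_well_posed_def by blast
    fix u t assume sol: "global_solution L \<theta> (m1/2) u0 u" and t: "t \<ge> (0::real)"
    let ?\<rho> = "\<lambda>r. odist (u r)"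
    have uX: "u r \<in> X" if "r \<ge> 0" for r using sol that unfolding global_solution_def by blast
    have ut: "((\<lambda>r. Xnorm (\<lambda>x. u r x - u r0 x)) \<longlongrightarrow> 0) (at r0 within {0..})" if "r0 \<ge> 0" for r0
      using sol that unfolding global_solution_def by blast
    have V: "lyapunov (u r) < \<kappa> * e\<^sup>2" if "r \<ge> 0" for r
    proof -
      have "functional_P L \<theta> (u r) = functional_P L \<theta> u0" "functional_F L \<theta> (u r) = functional_F L \<theta> u0"
        "functional_M L (u r) = functional_M L u0"
        using cP cF cM u0 sol that unfolding conserved_def by blast+
      then have "lyapunov (u r) = lyapunov u0" by (simp add: lyapunov_def action_def transversal_def)
      then show ?thesis using small[OF u0] near by simp
    qed
    have start: "?\<rho> 0 < e"
    proof -
      have ae: "AE x in cell L. u 0 x - \<phi> x = u0 x - \<phi> x"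
      proof -
        have "AE x in lborel. u 0 x = u0 x" using sol unfolding global_solution_def by blast
        then show ?thesis unfolding AE_cell by eventually_elim simp
      qed
      have "ft (\<lambda>x. u 0 x - \<phi> x) k = ft (\<lambda>x. u0 x - \<phi> x) k" for k
        by (rule fcoeff_cong_AE[OF XL2(2)[OF diff_X[OF uX phi_X]] XL2(2)[OF diff_X[OF u0 phi_X]] ae]) simp
      then have "Xnorm (\<lambda>x. u 0 x - \<phi> x) = Xnorm (\<lambda>x. u0 x - \<phi> x)" by (simp add: Hnorm_def)
      then show ?thesis using orbit_dist_le[of "u 0" 0] near by simp
    qed
    have cont: "continuous_on {0..} ?\<rho>"
      unfolding continuous_on_def
    proof
      fix r0 :: real assume r0: "r0 \<in> {0..}"
      have "((\<lambda>r. ?\<rho> r - ?\<rho> r0) \<longlongrightarrow> 0) (at r0 within {0..})"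
      proof (rule tendsto_0_le[OF ut, where K=1])
        show "\<forall>\<^sub>F r in at r0 within {0..}. norm (?\<rho> r - ?\<rho> r0) \<le> norm (Xnorm (\<lambda>x. u r x - u r0 x)) * 1"
          using r0 orbit_dist_lipschitz[OF uX uX] Hnorm_nonneg by (auto simp: eventually_at_filter)
      qed (use r0 in simp)
      then show "(?\<rho> \<longlongrightarrow> ?\<rho> r0) (at r0 within {0..})" by (simp add: LIM_zero_iff)
    qed
    have "?\<rho> t < e"
    proof (rule ccontr)
      assume "\<not> ?\<rho> t < e"
      then obtain r where r: "0 \<le> r" "r \<le> t" "?\<rho> r = e"
        using IVT'[of ?\<rho> 0 e t] start t continuous_on_subset[OF cont, of "{0..t}"] by auto
      have "\<kappa> * e\<^sup>2 \<le> lyapunov (u r)" using low[OF uX[OF r(1)]] r(3) e(3) by simp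
      then show False using V[OF r(1)] by simp
    qed
    then show "?\<rho> t < \<epsilon>" using e(2) by simp
  qed
qed

end

theorem theorem4p4:
  fixes L0 \<omega>0 \<gamma> m1 \<upsilon>1 \<upsilon>2 :: real
    and \<theta> \<phi> :: "real \<Rightarrow> real"
  assumes "m1 > 1/3" and "\<upsilon>1 > 0" and "\<upsilon>2 > 0"
    and "continuous_on UNIV \<theta>" and "\<And>x. \<theta> (- x) = \<theta> x"
    and "\<And>\<kappa>::int. \<upsilon>1 * \<bar>of_int \<kappa>\<bar> powr m1 \<le> \<theta> (of_int \<kappa>)"
    and "\<And>\<kappa>::int. \<theta> (of_int \<kappa>) \<le> \<upsilon>2 * \<bar>of_int \<kappa>\<bar> powr m1"
    and "L0 > 0" and "\<omega>0 > 1" and "\<gamma> > 0" and "\<gamma> > 2 * (\<omega>0 - 1) * L0"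
    and "globally_well_posed L0 \<theta> (m1/2)"
    and "conserved L0 \<theta> (m1/2) (functional_P L0 \<theta>)"
    and "conserved L0 \<theta> (m1/2) (functional_F L0 \<theta>)"
    and "conserved L0 \<theta> (m1/2) (functional_M L0)"
    and minimizer: "is_arg_min (functional_B L0 \<theta> \<omega>0) (\<lambda>u. u \<in> Yset L0 (m1/2) \<gamma>) \<phi>"
    and multiplier: "wave_equation L0 \<theta> \<omega>0 \<phi>"
    and H1_even: "AE x in lborel. \<phi> (- x) = \<phi> x"
    and H1_kernel: "\<exists>\<psi>. has_per_deriv L0 \<phi> \<psi> \<and> lin_op_ker L0 \<theta> m1 \<omega>0 \<phi> = per_span L0 \<psi>"
  shows "orbitally_stable L0 \<theta> (m1/2) \<phi>"
proof -
  obtain \<psi> where \<psi>: "has_per_deriv L0 \<phi> \<psi>" "lin_op_ker L0 \<theta> m1 \<omega>0 \<phi> = per_span L0 \<psi>"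
    using H1_kernel by blast
  have "constrained_wave L0 m1 \<upsilon>1 \<upsilon>2 \<omega>0 \<gamma> \<theta> \<phi> \<psi>"
    by unfold_locales (fact assms \<psi>)+
  then show ?thesis
    using assms by (intro constrained_wave.orbital_stability)
qed

end
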